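(* Let $\mathbb{K}$ be a field and let $n,p,r$ be non-negative integers such that $n \geq p \geq r$. Let $\mathcal{S}$ be an affine subspace of $\operatorname{M}_{n,p}(\mathbb{K})$ in which every matrix has rank at most $r$. Assume that $\dim \mathcal{S} \geq nr-(n-p+r)$ and $\# \mathbb{K}>2$. Then: (a) either $\mathcal{S}$ is $r$-decomposable; (b) or $\# \mathbb{K}=3$ and $\mathcal{S}$ is equivalent to $\mathcal{U}_3(\mathbb{K})$.
   Context: $\operatorname{M}_{n,p}(\mathbb{K})$ is the space of all $n\times p$ matrices with entries in $\mathbb{K}$. For $0\le s\le n$ and $0\le t\le p$, $\mathcal{R}(s,t)$ denotes the linear subspace of $\operatorname{M}_{n,p}(\mathbb{K})$ of all matrices of the form $\begin{bmatrix} A & C\\ B & 0\end{bmatrix}$ with $A\in \operatorname{M}_{s,t}(\mathbb{K})$, $B\in \operatorname{M}_{n-s,t}(\mathbb{K})$, $C\in \operatorname{M}_{s,p-t}(\mathbb{K})$ and zero block of size $(n-s)\times(p-t)$. Subsets $\mathcal{V},\mathcal{W}$ of $\operatorname{M}_{n,p}(\mathbb{K})$ are equivalent when $\mathcal{V}=P\mathcal{W}Q$ for some $P\in \operatorname{GL}_n(\mathbb{K})$, $Q\in \operatorname{GL}_p(\mathbb{K})$ (so equivalence to a set of $3\times 3$ matrices entails $n=p=3$). For $r\le \min(n,p)$, a subset of $\operatorname{M}_{n,p}(\mathbb{K})$ is $r$-decomposable when it is included in a subspace equivalent to $\mathcal{R}(s,t)$ for some non-negative integers $s,t$ with $s+t=r$.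 When $\#\mathbb{K}=3$, $\mathcal{U}_3(\mathbb{K})$ is the affine subspace of $\operatorname{M}_3(\mathbb{K})$ defined by $$\mathcal{U}_3(\mathbb{K}):=\left\{\begin{bmatrix} x & a & b \\ 0 & x+1 & c \\ 0 & 0 & x-1 \end{bmatrix} \mid (x,a,b,c)\in \mathbb{K}^4\right\}.$$ *)

theory Defs
  imports "Jordan_Normal_Form.DL_Rank"
begin

definition affine_subspace_mat :: "nat \<Rightarrow> nat \<Rightarrow> 'a :: field mat set \<Rightarrow> bool" where
  "affine_subspace_mat n p S \<longleftrightarrow>
     (\<exists>A \<in> carrier_mat n p. \<exists>V.
        VectorSpace.subspace class_ring V (module_mat TYPE('a) n p) \<and>
        S = {A + X | X. X \<in> V})"

definition translation_space :: "'a :: field mat set \<Rightarrow> 'a mat set" where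
  "translation_space S = {A - B | A B. A \<in> S \<and> B \<in> S}"

definition affine_dim_mat :: "nat \<Rightarrow> nat \<Rightarrow> 'a :: field mat set \<Rightarrow> nat" where
  "affine_dim_mat n p S =
     vectorspace.dim class_ring ((module_mat TYPE('a) n p)\<lparr>carrier := translation_space S\<rparr>)"

definition equivalent_mat_sets ::
    "nat \<Rightarrow> nat \<Rightarrow> 'a :: field mat set \<Rightarrow> 'a mat set \<Rightarrow> bool" where
  "equivalent_mat_sets n p V W \<longleftrightarrow>
     V \<subseteq> carrier_mat n p \<and> W \<subseteq> carrier_mat n p \<and>
     (\<exists>P Q. P \<in> carrier_mat n n \<and> invertible_mat P \<and>
            Q \<in> carrier_mat p p \<and> invertible_mat Q \<and>
            V = {P * M * Q | M. M \<in> W})"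

(* Meaningful only for s \<le> n and t \<le> p. The library lists the blocks row by row. *)
definition compression_space :: "nat \<Rightarrow> nat \<Rightarrow> nat \<Rightarrow> nat \<Rightarrow> 'a :: field mat set" where
  "compression_space n p s t =
     {four_block_mat A C B (0\<^sub>m (n - s) (p - t)) | A B C.
        A \<in> carrier_mat s t \<and> B \<in> carrier_mat (n - s) t \<and> C \<in> carrier_mat s (p - t)}"

definition decomposable_mat_set ::
    "nat \<Rightarrow> nat \<Rightarrow> nat \<Rightarrow> 'a :: field mat set \<Rightarrow> bool" where
  "decomposable_mat_set n p r S \<longleftrightarrow>
     (\<exists>s t W. s \<le> n \<and> t \<le> p \<and> s + t = r \<and>
        VectorSpace.subspace class_ring W (module_mat TYPE('a) n p) \<and>
        equivalent_mat_sets n p W (compression_space n p s t) \<and> S \<subseteq> W)"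

definition U3 :: "'a :: field mat set" where
  "U3 = {mat_of_rows_list 3 [[x, a, b], [0, x + 1, c], [0, 0, x - 1]] | x a b c. True}"

(* The translation space recovers the linear subspace of which S is a translate. *)
lemma translation_space_translate:
  fixes A :: "'a :: field mat"
  assumes A: "A \<in> carrier_mat n p"
    and V: "VectorSpace.subspace class_ring V (module_mat TYPE('a) n p)"
  shows "translation_space {A + X | X. X \<in> V} = V"
proof -
  have sm: "submodule class_ring V (module_mat TYPE('a) n p)"
    using V unfolding VectorSpace.subspace_def by blast
  have car: "X \<in> carrier_mat n p" if "X \<in> V" for X
    using submodule.subset[OF sm] that unfolding module_mat_simps by blast
  have zero: "0\<^sub>m n p \<in> V"
    using submodule.zero_closed[OF sm] unfolding module_mat_simps .
  have add: "X + Y \<in> V" if "X \<in> V" "Y \<in> V" for X Y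
    using submodule.m_closed[OF sm that] unfolding module_mat_simps .
  have smult: "c \<cdot>\<^sub>m X \<in> V" if "X \<in> V" for c X
    using submodule.smult_closed[OF sm _ that, of c] unfolding module_mat_simps by simp
  have diff: "(A + X) - (A + Y) = X + (-1) \<cdot>\<^sub>m Y" if "X \<in> V" "Y \<in> V" for X Y
    using A car[OF that(1)] car[OF that(2)] by (intro eq_matI) auto
  have "X \<in> translation_space {A + X | X. X \<in> V}" if X: "X \<in> V" for X
  proof -
    have "X = (A + X) - (A + 0\<^sub>m n p)"
      using A car[OF X] by (intro eq_matI) auto
    then show ?thesis
      unfolding translation_space_def using X zero by blast
  qed
  moreover have "X \<in> V" if X: "X \<in> translation_space {A + X | X. X \<in> V}" for X
  proof -
    obtain Y Z where "Y \<in> V" "Z \<in> V" "X = (A + Y) - (A + Z)"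
      using X unfolding translation_space_def by blast
    then show ?thesis using diff add smult by metis
  qed
  ultimately show ?thesis by blast
qed

lemma equivalent_U3_dims:
  assumes "equivalent_mat_sets n p S (U3 :: 'a :: field mat set)"
  shows "n = 3 \<and> p = 3"
proof -
  have "mat_of_rows_list 3 [[0, 0, 0], [0, 0 + 1, 0], [0, 0, 0 - 1]] \<in> (U3 :: 'a mat set)"
    unfolding U3_def by blast
  then have "mat_of_rows_list 3 [[0, 0, 0], [0, 0 + 1, 0], [0, 0, 0 - 1 :: 'a]] \<in> carrier_mat n p"
    using assms unfolding equivalent_mat_sets_def by blast
  then show ?thesis unfolding mat_of_rows_list_def carrier_mat_def by simp
qed

end

theory Submission
  imports Defs "HOL-Library.Function_Algebras"
begin

text \<open>
  A matrix is read as a bilinear form on \<open>E \<times> D\<close>, where \<open>E\<close> is \<open>K\<^sup>p\<close> and \<open>D\<close> is the dual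
  of \<open>K\<^sup>n\<close>; decomposability becomes the existence of subspaces \<open>F \<le> E\<close>, \<open>Y \<le> D\<close> with
  \<open>dim F + dim Y = dim E + dim D - r\<close> on whose product every form vanishes. The proof is by induction on
  \<open>dim E + dim D\<close>. For a hyperplane \<open>H\<close> of \<open>D\<close>, consider how much the dimension of the direction space
  drops when the forms are restricted to \<open>E \<times> H\<close>. If the drop is at least \<open>r\<close> for all \<open>H\<close>, the radicals of
  the forms of maximal rank coincide and the space is decomposable. If it lies strictly between \<open>0\<close> and \<open>r\<close>,
  a form of rank one in the direction space allows to pass to hyperplanes of \<open>E\<close> and \<open>D\<close> with \<open>r\<close> lowered by
  one; if it is \<open>0\<close>, one may restrict to \<open>E \<times> H\<close>, unless \<open>dim E = dim D = r + 1\<close>. In both reductions the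
  induction hypothesis gives a vanishing rectangle of total size one too small, and the two blocks beside
  it form a pair of families of which one member is always singular. Since an affine space is not the union of
  two proper affine subspaces when there are more than two scalars, either one block is always singular,
  which enlarges the rectangle, or the family is triangular of size three with a product of three affine functions
  vanishing identically on the field; the latter is possible only for three scalars and gives \<open>U\<^sub>3\<close>.
  The case \<open>dim E = dim D = r + 1\<close> is settled according to whether the direction space contains a form of
  rank one.
\<close>

section \<open>Finite-dimensional subspaces\<close>

text \<open>The dimension hypothesis is exactly what the induction can afford. For the rank bound
  \<open>min - 1\<close> it says that at most \<open>2 * max - 1\<close> dimensions are missing
  among all forms. A vanishing rectangle with \<open>dim F + dim Y = max + 1\<close> costs at least
  \<open>max\<close> dimensions, and two different ones cost at least \<open>2 * max - 1\<close>.
  One dimension above the threshold the rectangle is therefore unique, and so it does not depend on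
  the member from which it was obtained; this turns statements about cosets into statements about
  the whole family. The obstacle of the affine setting is that the directions need not satisfy the
  rank bound: those of the exceptional family contain invertible matrices. Hence members are
  compared with their translates along a rank-one direction. In the few sizes where the count leaves
  no room, namely two square blocks of size two and the triangular pattern of size three, rank-one
  directions are used by hand, and there the exceptional family appears.\<close>

text \<open>Dimensions vary in the induction, so finite dimension is a property of subspaces of one ambient
  vector space, which itself has infinite dimension.\<close>

locale field_space = vector_space scale
  for scale :: "'a :: field \<Rightarrow> 'b :: ab_group_add \<Rightarrow> 'b"
begin

definition fdsub :: "'b set \<Rightarrow> bool" where
  "fdsub W \<longleftrightarrow> subspace W \<and> (\<exists>B. finite B \<and> W \<subseteq> span B)"

lemma fdsub_subspace: "fdsub W \<Longrightarrow> subspace W"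
  by (simp add: fdsub_def)

lemma fdsub_extend_basis:
  assumes "fdsub W" "C \<subseteq> W" "independent C"
  obtains B where "C \<subseteq> B" "B \<subseteq> W" "finite B" "independent B" "span B = W" "card B = dim W"
proof -
  obtain B where B: "C \<subseteq> B" "B \<subseteq> W" "independent B" "W \<subseteq> span B"
    using maximal_independent_subset_extend[OF assms(2,3)] by blast
  obtain T where T: "finite T" "W \<subseteq> span T" using assms(1) by (auto simp: fdsub_def)
  have "finite B" using independent_span_bound[OF T(1) B(3)] B(2) T(2) by auto
  moreover have "span B = W"
    using B(2,4) assms(1) by (meson fdsub_def span_minimal subset_antisym)
  moreover have "card B = dim W" using B basis_card_eq_dim by blast
  ultimately show ?thesis using that B by blast
qed

lemma fdsub_basis:
  assumes "fdsub W"
  obtains B where "B \<subseteq> W" "finite B" "independent B" "span B = W" "card B = dim W"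
  using fdsub_extend_basis[OF assms empty_subsetI independent_empty] by metis

lemma fdsub_subset:
  assumes "fdsub W" "subspace U" "U \<subseteq> W"
  shows "fdsub U"
  using assms unfolding fdsub_def by blast

lemma independent_card_le:
  assumes "fdsub W" "C \<subseteq> W" "independent C"
  shows "finite C" "card C \<le> dim W"
proof -
  obtain B where B: "C \<subseteq> B" "finite B" "card B = dim W"
    using fdsub_extend_basis[OF assms] by metis
  then show "finite C" "card C \<le> dim W" using finite_subset card_mono by metis+
qed

lemma fdsub_dim_mono:
  assumes "fdsub W" "subspace U" "U \<subseteq> W"
  shows "dim U \<le> dim W"
  using fdsub_basis[OF fdsub_subset[OF assms]] independent_card_le[OF assms(1)] assms(3)
  by (metis subset_trans)

lemma fdsub_dim_eq:
  assumes "fdsub W" "subspace U" "U \<subseteq> W" "dim W \<le> dim U"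
  shows "U = W"
proof -
  obtain C where C: "C \<subseteq> U" "finite C" "independent C" "span C = U" "card C = dim U"
    by (rule fdsub_basis[OF fdsub_subset[OF assms(1-3)]])
  obtain B where B: "C \<subseteq> B" "B \<subseteq> W" "finite B" "independent B" "span B = W" "card B = dim W"
    by (rule fdsub_extend_basis[OF assms(1) subset_trans[OF C(1) assms(3)] C(3)])
  have "B = C" using B C assms(4) card_seteq by metis
  then show ?thesis using B C by simp
qed

lemma fdsub_span: "finite B \<Longrightarrow> fdsub (span B)"
  by (auto simp: fdsub_def)

lemma fdsub_Int: "fdsub U \<Longrightarrow> subspace W \<Longrightarrow> fdsub (U \<inter> W)"
  by (rule fdsub_subset[of U]) (auto simp: fdsub_def subspace_inter)

lemma fdsub_zero: "fdsub {0}" "dim {0} = 0"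
  using fdsub_span[of "{}"] dim_span_eq_card_independent[OF independent_empty] by auto

lemma fdsub_dim_0: "fdsub W \<Longrightarrow> dim W = 0 \<Longrightarrow> W = {0}"
  using fdsub_dim_eq[of W "{0}"] subspace_0 fdsub_subspace by (auto simp: fdsub_zero)

lemma exists_nonzero:
  assumes "fdsub W" "dim W > 0"
  obtains x where "x \<in> W" "x \<noteq> 0"
proof -
  have "W \<noteq> {0}" using assms(2) fdsub_zero(2) by auto
  then show ?thesis using that subspace_0[OF fdsub_subspace[OF assms(1)]] by blast
qed

lemma dim_span_singleton: "x \<noteq> 0 \<Longrightarrow> dim (span {x}) = 1"
  using dim_span_eq_card_independent[of "{x}"] by simp

lemma subspace_avoiding:
  assumes W: "fdsub W" and U: "subspace U" "U \<subseteq> W" and x: "x \<in> W" "x \<notin> U"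
  obtains H where "subspace H" "U \<subseteq> H" "H \<subseteq> W" "x \<notin> H" "dim H + 1 = dim W"
proof -
  obtain C where C: "C \<subseteq> U" "finite C" "independent C" "span C = U" "card C = dim U"
    by (rule fdsub_basis[OF fdsub_subset[OF W U]])
  have xC: "x \<notin> C" using C x by blast
  have ind: "independent (insert x C)" using C x independent_insertI by blast
  have sub: "insert x C \<subseteq> W" using C U x by blast
  obtain B where B: "insert x C \<subseteq> B" "B \<subseteq> W" "finite B" "independent B" "span B = W" "card B = dim W"
    using fdsub_extend_basis[OF W sub ind] by blast
  have i: "independent (B - {x})" using B(4) independent_mono by blast
  show ?thesis
  proof
    show "subspace (span (B - {x}))" by simp
    show "U \<subseteq> span (B - {x})" using B(1) xC C(4) span_mono[of C "B - {x}"] by blast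
    show "span (B - {x}) \<subseteq> W" using B(5) span_mono[of "B - {x}" B] by blast
    show "x \<notin> span (B - {x})" using B(1,4) unfolding dependent_def by blast
    show "dim (span (B - {x})) + 1 = dim W"
      using B(1,6) dim_span_eq_card_independent[OF i] card_Suc_Diff1[OF B(3), of x] by simp
  qed
qed

lemma subspace_between:
  assumes W: "fdsub W" and U: "subspace U" "U \<subseteq> W" and k: "dim U \<le> k" "k \<le> dim W"
  obtains Z where "subspace Z" "U \<subseteq> Z" "Z \<subseteq> W" "dim Z = k"
proof -
  have "\<exists>Z. subspace Z \<and> U \<subseteq> Z \<and> Z \<subseteq> W \<and> dim Z = dim W - j" if "j \<le> dim W - dim U" for j
    using that
  proof (induction j)
    case 0 then show ?case using W U fdsub_subspace by auto
  next
    case (Suc j)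
    then obtain Z where Z: "subspace Z" "U \<subseteq> Z" "Z \<subseteq> W" "dim Z = dim W - j" by auto
    have fZ: "fdsub Z" using fdsub_subset[OF W] Z by blast
    have "dim U < dim Z" using Suc Z by auto
    then obtain x where "x \<in> Z" "x \<notin> U" using Z by (metis nat_less_le subsetI subset_antisym)
    then obtain H where "subspace H" "U \<subseteq> H" "H \<subseteq> Z" "dim H + 1 = dim Z"
      using subspace_avoiding[OF fZ U(1) Z(2)] by metis
    then show ?case using Z Suc by (intro exI[of _ H]) auto
  qed
  from this[OF diff_le_mono2[OF k(1)]] k(2) that show ?thesis by auto
qed

section \<open>Linear functionals, sums of subspaces and pairings\<close>

definition lin_on :: "'b set \<Rightarrow> ('b \<Rightarrow> 'a) \<Rightarrow> bool" where
  "lin_on W f \<longleftrightarrow> (\<forall>x\<in>W. \<forall>y\<in>W. f (x + y) = f x + f y) \<and> (\<forall>c. \<forall>x\<in>W. f (scale c x) = c * f x)"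

lemma lin_on_kernel: "subspace W \<Longrightarrow> lin_on W f \<Longrightarrow> subspace {x \<in> W. f x = 0}"
  unfolding lin_on_def subspace_def
  by (auto; metis mult_zero_left scale_zero_left)

lemma lin_on_subset: "lin_on W f \<Longrightarrow> U \<subseteq> W \<Longrightarrow> lin_on U f"
  unfolding lin_on_def by blast

lemma dim_kernel_functional:
  assumes W: "fdsub W" and f: "lin_on W f"
  shows "dim W \<le> dim {x \<in> W. f x = 0} + 1"
proof -
  let ?K = "{x \<in> W. f x = 0}"
  have sW: "subspace W" using W fdsub_subspace by blast
  have K: "subspace ?K" using lin_on_kernel[OF sW f] .
  have "fdsub ?K" using K by (rule fdsub_subset[OF W]) blast
  then obtain B where B: "B \<subseteq> ?K" "finite B" "independent B" "span B = ?K" "card B = dim ?K"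
    by (rule fdsub_basis)
  show ?thesis
  proof (cases "?K = W")
    case False
    then obtain p where p: "p \<in> W" "f p \<noteq> 0" by blast
    have "W \<subseteq> span (insert p B)"
    proof
      fix x assume x: "x \<in> W"
      let ?c = "f x / f p"
      have "f (x + scale (- ?c) p) = 0"
      proof -
        have "scale (- ?c) p \<in> W" using p(1) sW subspace_scale by blast
        then have "f (x + scale (- ?c) p) = f x + (- ?c) * f p"
          using f p(1) x unfolding lin_on_def by metis
        then show ?thesis using p(2) by simp
      qed
      then have "x + scale (- ?c) p \<in> ?K" using x p(1) sW subspace_add[OF sW x subspace_scale[OF sW p(1)]] by blast
      then have "x - scale ?c p \<in> span B" using B(4) by simp
      then show "x \<in> span (insert p B)" using span_breakdown_eq by blast
    qed
    then have "dim W \<le> card (insert p B)" using dim_le_card[of W "insert p B"] B(2) by simp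
    also have "\<dots> \<le> card B + 1" using B(2) by (simp add: card_insert_if)
    finally show ?thesis using B(5) by simp
  qed simp
qed

lemma dim_kernel_functionals:
  assumes W: "fdsub W" and I: "finite I" and f: "\<And>i. i \<in> I \<Longrightarrow> lin_on W (f i)"
  shows "dim W \<le> dim {x \<in> W. \<forall>i\<in>I. f i x = 0} + card I \<and> subspace {x \<in> W. \<forall>i\<in>I. f i x = 0}"
  using I f
proof (induction I)
  case empty
  then show ?case using W fdsub_subspace by auto
next
  case (insert i I)
  let ?K = "{x \<in> W. \<forall>i\<in>I. f i x = 0}"
  have IH: "dim W \<le> dim ?K + card I" "subspace ?K" using insert by auto
  have fK: "fdsub ?K" by (rule fdsub_subset[OF W IH(2)]) blast
  have l: "lin_on ?K (f i)" by (rule lin_on_subset[of W]) (use insert.prems in auto)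
  have e: "{x \<in> W. \<forall>i\<in>insert i I. f i x = 0} = {x \<in> ?K. f i x = 0}" by auto
  show ?case unfolding e
    using dim_kernel_functional[OF fK l] IH(1) insert.hyps lin_on_kernel[OF IH(2) l] by simp
qed

definition ssum :: "'b set \<Rightarrow> 'b set \<Rightarrow> 'b set" where
  "ssum U W = {x + y | x y. x \<in> U \<and> y \<in> W}"

lemma subspace_ssum: "subspace U \<Longrightarrow> subspace W \<Longrightarrow> subspace (ssum U W)"
  unfolding ssum_def by (rule subspace_sums)

lemma ssumI: "x \<in> U \<Longrightarrow> y \<in> W \<Longrightarrow> x + y \<in> ssum U W"
  unfolding ssum_def by blast

lemma ssumE: assumes "z \<in> ssum U W" obtains x y where "x \<in> U" "y \<in> W" "z = x + y"
  using assms unfolding ssum_def by blast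

lemma ssum_upper: "subspace U \<Longrightarrow> subspace W \<Longrightarrow> U \<subseteq> ssum U W \<and> W \<subseteq> ssum U W"
proof -
  assume "subspace U" "subspace W"
  then have 0: "0 \<in> U" "0 \<in> W" using subspace_0 by auto
  show ?thesis using ssumI[OF _ 0(2)] ssumI[OF 0(1)] by force
qed

lemma ssum_least: "subspace Z \<Longrightarrow> U \<subseteq> Z \<Longrightarrow> W \<subseteq> Z \<Longrightarrow> ssum U W \<subseteq> Z"
  by (auto elim!: ssumE intro: subspace_add)

text \<open>The coordinates along the basis vectors of \<open>Z\<close> outside a basis of
  \<open>U\<close> are \<open>dim Z - dim U\<close> functionals, and their common kernel in
  \<open>W\<close> lies in \<open>U\<close>.\<close>

lemma dim_add_le:
  assumes Z: "fdsub Z" and U: "subspace U" "U \<subseteq> Z" and W: "subspace W" "W \<subseteq> Z"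
  shows "dim U + dim W \<le> dim Z + dim (U \<inter> W)"
proof -
  obtain C where C: "C \<subseteq> U" "finite C" "independent C" "span C = U" "card C = dim U"
    by (rule fdsub_basis[OF fdsub_subset[OF Z U]])
  obtain B where B: "C \<subseteq> B" "B \<subseteq> Z" "finite B" "independent B" "span B = Z" "card B = dim Z"
    by (rule fdsub_extend_basis[OF Z subset_trans[OF C(1) U(2)] C(3)])
  define f where "f = (\<lambda>v x. representation B x v)"
  have l: "lin_on Z (f v)" for v
    using B(4,5) unfolding lin_on_def f_def by (simp add: representation_add representation_scale)
  have "{x \<in> W. \<forall>v\<in>B - C. f v x = 0} \<subseteq> U \<inter> W"
  proof safe
    fix x assume x: "x \<in> W" "\<forall>v\<in>B - C. f v x = 0"
    then have xZ: "x \<in> span B" using W B by blast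
    have "x = (\<Sum>v\<in>B. scale (representation B x v) v)"
      using sum_representation_eq[OF B(4) xZ B(3)] by simp
    also have "\<dots> = (\<Sum>v\<in>C. scale (representation B x v) v)"
      using x(2) B(1,3) by (intro sum.mono_neutral_right) (auto simp: f_def)
    also have "\<dots> \<in> U" using C by (metis (no_types, lifting) span_base span_scale span_sum)
    finally show "x \<in> U" .
  qed
  moreover have fW: "fdsub W" using fdsub_subset[OF Z W] .
  moreover have "dim W \<le> dim {x \<in> W. \<forall>v\<in>B - C. f v x = 0} + card (B - C) \<and> subspace {x \<in> W. \<forall>v\<in>B - C. f v x = 0}"
    using dim_kernel_functionals[OF fW, of "B - C" f] l lin_on_subset[OF _ W(2)] B(3) by blast
  moreover have "fdsub (U \<inter> W)" using fdsub_Int[OF fW U(1)] by (simp add: Int_commute)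
  ultimately have "dim W \<le> dim (U \<inter> W) + card (B - C)" using fdsub_dim_mono by (meson add_le_mono1 le_trans)
  moreover have "card (B - C) + dim U = dim Z" using B C card_Diff_subset[OF C(2) B(1)] card_mono[OF B(3,1)] by simp
  ultimately show ?thesis by simp
qed

lemma fdsub_ssum:
  assumes "fdsub U" "fdsub W"
  shows "fdsub (ssum U W)"
proof -
  obtain B C where "finite B" "U \<subseteq> span B" "finite C" "W \<subseteq> span C"
    using assms fdsub_def by metis
  then have "finite (B \<union> C)" "ssum U W \<subseteq> span (B \<union> C)"
    by (auto elim!: ssumE simp: span_Un)
  then show ?thesis using assms subspace_ssum unfolding fdsub_def by metis
qed

lemma dim_ssum_le:
  assumes U: "fdsub U" and W: "fdsub W"
  shows "dim (ssum U W) + dim (U \<inter> W) \<le> dim U + dim W"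
proof -
  have "subspace (U \<inter> W)" "U \<inter> W \<subseteq> U" "U \<inter> W \<subseteq> W" using U W fdsub_subspace subspace_inter by auto
  then have "fdsub (U \<inter> W)" using fdsub_subset[OF U] by blast
  then obtain C where C: "C \<subseteq> U \<inter> W" "finite C" "independent C" "span C = U \<inter> W" "card C = dim (U \<inter> W)"
    by (rule fdsub_basis)
  have CU: "C \<subseteq> U" "C \<subseteq> W" using C(1) by auto
  obtain B1 where B1: "C \<subseteq> B1" "B1 \<subseteq> U" "finite B1" "independent B1" "span B1 = U" "card B1 = dim U"
    by (rule fdsub_extend_basis[OF U CU(1) C(3)])
  obtain B2 where B2: "C \<subseteq> B2" "B2 \<subseteq> W" "finite B2" "independent B2" "span B2 = W" "card B2 = dim W"
    by (rule fdsub_extend_basis[OF W CU(2) C(3)])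
  have "ssum U W = span (B1 \<union> B2)" unfolding ssum_def span_Un B1(5) B2(5) by blast
  then have "dim (ssum U W) \<le> card (B1 \<union> B2)"
    using dim_le_card[of "ssum U W" "B1 \<union> B2"] B1(3) B2(3) by simp
  moreover have "card (B1 \<union> B2) + card (B1 \<inter> B2) = card B1 + card B2"
    using card_Un_Int[OF B1(3) B2(3)] by simp
  moreover have "card C \<le> card (B1 \<inter> B2)" using B1(1,3) B2(1,3) by (intro card_mono) auto
  ultimately show ?thesis using B1(6) B2(6) C(5) by linarith
qed

lemma dim_ssum:
  assumes U: "fdsub U" and W: "fdsub W"
  shows "dim (ssum U W) + dim (U \<inter> W) = dim U + dim W"
proof -
  note s = fdsub_subspace[OF U] fdsub_subspace[OF W]
  show ?thesis
    using dim_ssum_le[OF U W] dim_add_le[OF fdsub_ssum[OF U W] s(1) _ s(2)] ssum_upper[OF s] by simp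
qed

lemma complement_exists:
  assumes W: "fdsub W" and U: "subspace U" "U \<subseteq> W"
  obtains U' where "subspace U'" "U' \<subseteq> W" "U \<inter> U' = {0}" "ssum U U' = W" "dim U + dim U' = dim W"
proof -
  obtain C where C: "C \<subseteq> U" "finite C" "independent C" "span C = U" "card C = dim U"
    by (rule fdsub_basis[OF fdsub_subset[OF W U]])
  obtain B where B: "C \<subseteq> B" "B \<subseteq> W" "finite B" "independent B" "span B = W" "card B = dim W"
    by (rule fdsub_extend_basis[OF W subset_trans[OF C(1) U(2)] C(3)])
  define U' where "U' = span (B - C)"
  have i: "independent (B - C)" using B(4) independent_mono by blast
  have "C \<union> (B - C) = B" using B(1) by blast
  then have s: "ssum U U' = W" unfolding ssum_def U'_def using span_Un[of C "B - C"] B(5) C(4) by simp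
  have U': "subspace U'" "U' \<subseteq> W" unfolding U'_def using span_mono[of "B - C" B] B(5) by auto
  have d: "dim U + dim U' = dim W"
    unfolding U'_def using dim_span_eq_card_independent[OF i] B C card_Diff_subset[OF C(2) B(1)] card_mono[OF B(3,1)]
    by simp
  have "fdsub U" "fdsub U'" using fdsub_subset[OF W] U U' by auto
  then have "dim (U \<inter> U') = 0" "fdsub (U \<inter> U')"
    using dim_ssum[of U U'] d s fdsub_Int[of U U'] U'(1) by auto
  then have "U \<inter> U' = {0}" using fdsub_dim_0 by blast
  then show ?thesis using that U' s d by blast
qed

text \<open>A hyperplane through \<open>y1 - y2\<close> that misses \<open>y1\<close> also misses
  \<open>y2\<close>. It exists unless \<open>y1\<close> is a multiple of \<open>y1 - y2\<close>;
  then \<open>y1\<close> and \<open>y2\<close> are proportional, and missing one of them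
  suffices.\<close>

lemma hyperplane_avoiding_two:
  assumes W: "fdsub W" and y: "y1 \<in> W" "y1 \<noteq> 0" "y2 \<in> W" "y2 \<noteq> 0"
  obtains H where "subspace H" "H \<subseteq> W" "y1 \<notin> H" "y2 \<notin> H" "dim H + 1 = dim W"
proof (cases "y1 \<in> span {y1 - y2}")
  case False
  have sW: "subspace W" using W fdsub_subspace by blast
  then have "span {y1 - y2} \<subseteq> W" using y by (intro span_minimal) (auto simp: subspace_diff)
  then obtain H where H: "subspace H" "span {y1 - y2} \<subseteq> H" "H \<subseteq> W" "y1 \<notin> H" "dim H + 1 = dim W"
    using subspace_avoiding[OF W _ _ y(1) False] by auto
  have "y2 \<notin> H"
  proof
    assume "y2 \<in> H"
    moreover have "y1 - y2 \<in> H" using H(2) span_base by blast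
    ultimately have "y1 \<in> H" using subspace_add[OF H(1), of "y1 - y2" y2] by simp
    then show False using H by simp
  qed
  then show ?thesis using that H by blast
next
  case True
  then obtain k where k: "y1 = scale k (y1 - y2)" using span_singleton by blast
  have sW: "subspace W" using W fdsub_subspace by blast
  have "{0} \<subseteq> W" using sW subspace_0 by blast
  then obtain H where H: "subspace H" "H \<subseteq> W" "y1 \<notin> H" "dim H + 1 = dim W"
    using subspace_avoiding[OF W subspace_single_0 _ y(1)] y(2) by auto
  have "y2 \<notin> H"
  proof
    assume a: "y2 \<in> H"
    have k0: "k \<noteq> 0" using k y(2) by auto
    have "scale k y2 = scale (k - 1) y1" using k by (simp add: scale_right_diff_distrib scale_left_diff_distrib)
       (metis add_diff_cancel_left' diff_add_cancel)
    then have e: "scale (k - 1) y1 \<in> H" using a H(1) subspace_scale by metis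
    show False
    proof (cases "k = 1")
      case True then show False using k y by simp
    next
      case False
      have "scale (1 / (k - 1)) (scale (k - 1) y1) \<in> H" using e H(1) subspace_scale by metis
      then show False using False H(3) by simp
    qed
  qed
  then show ?thesis using that H by blast
qed

lemma lin_on_kernels:
  assumes W: "subspace W" and l: "\<And>i. i \<in> I \<Longrightarrow> lin_on W (f i)"
  shows "subspace {x \<in> W. \<forall>i\<in>I. f i x = 0}"
proof (rule subspaceI)
  show "0 \<in> {x \<in> W. \<forall>i\<in>I. f i x = 0}"
    using subspace_0[OF lin_on_kernel[OF W l]] subspace_0[OF W] by blast
  show "x + y \<in> {x \<in> W. \<forall>i\<in>I. f i x = 0}" if "x \<in> {x \<in> W. \<forall>i\<in>I. f i x = 0}" "y \<in> {x \<in> W. \<forall>i\<in>I. f i x = 0}" for x y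
    using subspace_add[OF lin_on_kernel[OF W l], of _ x y] subspace_add[OF W] that by blast
  show "scale c x \<in> {x \<in> W. \<forall>i\<in>I. f i x = 0}" if "x \<in> {x \<in> W. \<forall>i\<in>I. f i x = 0}" for c x
    using subspace_scale[OF lin_on_kernel[OF W l], of _ x c] subspace_scale[OF W] that by blast
qed

text \<open>Only a complement \<open>Q1\<close> of the right radical matters: a basis of it imposes
  \<open>dim Q1\<close> linear conditions on \<open>P\<close>, and their common kernel is the left
  radical. Exchanging the sides then gives equality of row rank and column rank.\<close>

lemma dim_pairing_le:
  assumes P: "fdsub P" and Q: "fdsub Q"
    and l1: "\<And>q. q \<in> Q \<Longrightarrow> lin_on P (\<lambda>p. f p q)" and l2: "\<And>p. p \<in> P \<Longrightarrow> lin_on Q (f p)"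
  shows "dim P + dim {q \<in> Q. \<forall>p\<in>P. f p q = 0} \<le> dim Q + dim {p \<in> P. \<forall>q\<in>Q. f p q = 0}"
proof -
  let ?Q0 = "{q \<in> Q. \<forall>p\<in>P. f p q = 0}"
  have sQ: "subspace Q" using Q fdsub_subspace by blast
  have s0: "subspace ?Q0" using lin_on_kernels[OF sQ l2] .
  obtain Q1 where Q1: "subspace Q1" "Q1 \<subseteq> Q" "?Q0 \<inter> Q1 = {0}" "ssum ?Q0 Q1 = Q" "dim ?Q0 + dim Q1 = dim Q"
    by (rule complement_exists[OF Q s0]) auto
  have "fdsub Q1" by (rule fdsub_subset[OF Q Q1(1,2)])
  then obtain B where B: "B \<subseteq> Q1" "finite B" "independent B" "span B = Q1" "card B = dim Q1"
    by (rule fdsub_basis)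
  have "{p \<in> P. \<forall>q\<in>B. f p q = 0} \<subseteq> {p \<in> P. \<forall>q\<in>Q. f p q = 0}"
  proof safe
    fix p q assume p: "p \<in> P" "\<forall>q\<in>B. f p q = 0" and q: "q \<in> Q"
    have k: "subspace {q \<in> Q. f p q = 0}" by (rule lin_on_kernel[OF sQ l2[OF p(1)]])
    have "B \<subseteq> {q \<in> Q. f p q = 0}" using p(2) B(1) Q1(2) by auto
    then have "span B \<subseteq> {q \<in> Q. f p q = 0}" using k by (rule span_minimal)
    moreover have "q \<in> ssum ?Q0 Q1" using q Q1(4) by simp
    then obtain q0 q1 where q01: "q0 \<in> ?Q0" "q1 \<in> Q1" "q = q0 + q1" by (rule ssumE)
    ultimately have "f p q1 = 0" using B(4) by blast
    moreover have "f p q = f p q0 + f p q1" using l2[OF p(1)] q01 Q1(2) unfolding lin_on_def by blast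
    ultimately show "f p q = 0" using q01(1) p(1) by simp
  qed
  moreover have k: "dim P \<le> dim {p \<in> P. \<forall>q\<in>B. f p q = 0} + card B \<and> subspace {p \<in> P. \<forall>q\<in>B. f p q = 0}"
    by (rule dim_kernel_functionals[OF P B(2)]) (use l1 B(1) Q1(2) in auto)
  moreover have "fdsub {p \<in> P. \<forall>q\<in>Q. f p q = 0}"
  proof (rule fdsub_subset[OF P])
    show "subspace {p \<in> P. \<forall>q\<in>Q. f p q = 0}" using lin_on_kernels[OF fdsub_subspace[OF P] l1] .
  qed auto
  ultimately have "dim P \<le> dim {p \<in> P. \<forall>q\<in>Q. f p q = 0} + card B"
    using fdsub_dim_mono[of "{p \<in> P. \<forall>q\<in>Q. f p q = 0}" "{p \<in> P. \<forall>q\<in>B. f p q = 0}"] by linarith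
  then show ?thesis using Q1(5) B(5) by linarith
qed

lemma dim_pairing:
  assumes P: "fdsub P" and Q: "fdsub Q"
    and l1: "\<And>q. q \<in> Q \<Longrightarrow> lin_on P (\<lambda>p. f p q)" and l2: "\<And>p. p \<in> P \<Longrightarrow> lin_on Q (f p)"
  shows "dim P + dim {q \<in> Q. \<forall>p\<in>P. f p q = 0} = dim Q + dim {p \<in> P. \<forall>q\<in>Q. f p q = 0}"
  using dim_pairing_le[OF assms] dim_pairing_le[OF Q P, of "\<lambda>q p. f p q"] l1 l2 by (simp add: add.commute)

lemma span_of_subspace: "subspace S \<Longrightarrow> span S = S"
  by (intro antisym span_minimal span_superset) auto

lemma Int_span_singleton:
  assumes "subspace L" "x \<notin> L"
  shows "L \<inter> span {x} = {0}"
proof -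
  have "k = 0" if "scale k x \<in> L" for k
  proof (rule ccontr)
    assume "k \<noteq> 0"
    moreover have "scale (1 / k) (scale k x) \<in> L" using that assms(1) subspace_scale by blast
    ultimately show False using assms by simp
  qed
  then show ?thesis using subspace_0[OF assms(1)] span_zero by (auto simp: span_singleton)
qed

lemma dim_span_pair:
  assumes "x \<noteq> 0" "y \<notin> span {x}"
  shows "dim (span {x, y}) = 2"
proof -
  have "independent {y, x}" using assms by (intro independent_insertI) (simp_all add: independent_empty)
  moreover have "y \<noteq> x" using assms(2) span_base by blast
  ultimately show ?thesis using dim_span_eq_card_independent[of "{y, x}"] by (simp add: insert_commute)
qed

lemma hyperplane_decomp:
  assumes W: "fdsub W" and H: "subspace H" "H \<subseteq> W" "dim H + 1 = dim W" and y: "y \<in> W" "y \<notin> H" and w: "w \<in> W"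
  obtains h c where "h \<in> H" "w = h + scale c y"
proof -
  have fH: "fdsub H" by (rule fdsub_subset[OF W H(1,2)])
  have fy: "fdsub (span {y})" by (rule fdsub_span) simp
  have sy: "span {y} \<subseteq> W" using y fdsub_subspace[OF W] by (simp add: span_minimal)
  have y0: "y \<noteq> 0" using y subspace_0[OF H(1)] by blast
  have "H \<inter> span {y} = {0}" using Int_span_singleton[OF H(1) y(2)] .
  then have "dim (ssum H (span {y})) = dim W"
    using dim_ssum[OF fH fy] dim_span_singleton[OF y0] H(3) fdsub_zero by simp
  then have "ssum H (span {y}) = W"
    by (intro fdsub_dim_eq[OF W]) (auto simp: subspace_ssum H ssum_least[OF fdsub_subspace[OF W] H(2) sy])
  then show ?thesis using w that by (auto elim!: ssumE simp: span_singleton)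
qed

end

section \<open>Spaces of bilinear forms\<close>

text \<open>Forms and vectors live in the same type, so that interchanging the two arguments (transposition)
  is again an instance of the locale.\<close>

locale form_space = field_space scale
  for scale :: "'a :: field \<Rightarrow> 'b :: ab_group_add \<Rightarrow> 'b" +
  fixes b :: "'b \<Rightarrow> 'b \<Rightarrow> 'b \<Rightarrow> 'a"
  assumes add_form: "b (M + N) x y = b M x y + b N x y"
    and scale_form: "b (scale c N) x y = c * b N x y"
    and add_left: "b N (x + x') y = b N x y + b N x' y"
    and scale_left: "b N (scale c x) y = c * b N x y"
    and add_right: "b N x (y + y') = b N x y + b N x y'"
    and scale_right: "b N x (scale c y) = c * b N x y"
    and third_scalar: "\<exists>c :: 'a. c \<noteq> 0 \<and> c \<noteq> 1"
begin

lemma zero_form: "b 0 x y = 0" using scale_form[of 0 0 x y] by simp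
lemma zero_left: "b N 0 y = 0" using scale_left[of N 0 0 y] by simp
lemma zero_right: "b N x 0 = 0" using scale_right[of N x 0 0] by simp
lemma minus_form: "b (- N) x y = - b N x y" using add_form[of N "- N" x y] by (simp add: zero_form eq_neg_iff_add_eq_0 add.commute)
lemma minus_left: "b N (- x) y = - b N x y" using add_left[of N x "- x" y] by (simp add: zero_left eq_neg_iff_add_eq_0 add.commute)
lemma minus_right: "b N x (- y) = - b N x y" using add_right[of N x y "- y"] by (simp add: zero_right eq_neg_iff_add_eq_0 add.commute)
lemma diff_form: "b (M - N) x y = b M x y - b N x y" using add_form[of M "- N" x y] by (simp add: minus_form)
lemma diff_left: "b N (x - x') y = b N x y - b N x' y" using add_left[of N x "- x'" y] by (simp add: minus_left)
lemma diff_right: "b N x (y - y') = b N x y - b N x y'" using add_right[of N x y "- y'"] by (simp add: minus_right)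

lemmas form_simps = add_form scale_form add_left scale_left add_right scale_right
  zero_form zero_left zero_right minus_form minus_left minus_right diff_form diff_left diff_right

lemma flip_form_space: "form_space scale (\<lambda>N x y. b N y x)"
  by unfold_locales (auto simp: form_simps third_scalar)

definition vanish :: "'b \<Rightarrow> 'b set \<Rightarrow> 'b set \<Rightarrow> bool" where
  "vanish N F Y \<longleftrightarrow> (\<forall>x\<in>F. \<forall>y\<in>Y. b N x y = 0)"

definition ann :: "'b set \<Rightarrow> 'b set \<Rightarrow> 'b set \<Rightarrow> 'b set" where
  "ann V F Y = {N \<in> V. vanish N F Y}"

definition rad :: "'b \<Rightarrow> 'b set \<Rightarrow> 'b set \<Rightarrow> 'b set" where
  "rad M E D = {x \<in> E. \<forall>y\<in>D. b M x y = 0}"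

text \<open>\<open>rk M E D\<close> is the rank of the restriction of \<open>M\<close> to \<open>E \<times> D\<close>, and \<open>rd V E D\<close> is the dimension of the space
  of restrictions of the members of \<open>V\<close>.\<close>

definition rk :: "'b \<Rightarrow> 'b set \<Rightarrow> 'b set \<Rightarrow> nat" where
  "rk M E D = dim E - dim (rad M E D)"

definition rd :: "'b set \<Rightarrow> 'b set \<Rightarrow> 'b set \<Rightarrow> nat" where
  "rd V E D = dim V - dim (ann V E D)"

lemma vanishI: "(\<And>x y. x \<in> F \<Longrightarrow> y \<in> Y \<Longrightarrow> b N x y = 0) \<Longrightarrow> vanish N F Y"
  by (simp add: vanish_def)

lemma vanishD: "vanish N F Y \<Longrightarrow> x \<in> F \<Longrightarrow> y \<in> Y \<Longrightarrow> b N x y = 0"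
  by (simp add: vanish_def)

lemma vanish_mono: "vanish N F Y \<Longrightarrow> F' \<subseteq> F \<Longrightarrow> Y' \<subseteq> Y \<Longrightarrow> vanish N F' Y'"
  by (auto simp: vanish_def)

lemma vanish_diff: "vanish M F Y \<Longrightarrow> vanish N F Y \<Longrightarrow> vanish (M - N) F Y"
  by (simp add: vanish_def form_simps)

lemma vanish_ssum_left: "vanish N F Y \<Longrightarrow> vanish N F' Y \<Longrightarrow> vanish N (ssum F F') Y"
  by (auto simp: vanish_def form_simps elim!: ssumE)

lemma vanish_ssum_right: "vanish N F Y \<Longrightarrow> vanish N F Y' \<Longrightarrow> vanish N F (ssum Y Y')"
  by (auto simp: vanish_def form_simps elim!: ssumE)

lemma vanish_span: "vanish N A B \<Longrightarrow> vanish N (span A) (span B)"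
proof -
  assume v: "vanish N A B"
  have 1: "subspace {x. \<forall>y\<in>B. b N x y = 0}" by (auto simp: subspace_def form_simps)
  have "span A \<subseteq> {x. \<forall>y\<in>B. b N x y = 0}" using v 1 by (intro span_minimal) (auto simp: vanish_def)
  moreover have 2: "subspace {y. \<forall>x\<in>span A. b N x y = 0}" by (auto simp: subspace_def form_simps)
  ultimately have "span B \<subseteq> {y. \<forall>x\<in>span A. b N x y = 0}" by (intro span_minimal) auto
  then show ?thesis by (auto simp: vanish_def)
qed

lemma vanish_span_left: "subspace Y \<Longrightarrow> vanish N A Y \<Longrightarrow> vanish N (span A) Y"
  using vanish_span[of N A Y] span_of_subspace[of Y] by simp

lemma vanish_span_right: "subspace F \<Longrightarrow> vanish N F B \<Longrightarrow> vanish N F (span B)"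
  using vanish_span[of N F B] span_of_subspace[of F] by simp

lemma vanish_zero_left: "vanish N {0} Y"
  by (auto simp: vanish_def form_simps)

lemma subspace_ann: "subspace V \<Longrightarrow> subspace (ann V F Y)"
  by (auto simp: subspace_def ann_def vanish_def form_simps)

lemma ann_subset: "ann V F Y \<subseteq> V"
  by (auto simp: ann_def)

lemma fdsub_ann: "fdsub V \<Longrightarrow> fdsub (ann V F Y)"
  using fdsub_subset subspace_ann fdsub_subspace ann_subset by blast

lemma ann_ann: "ann (ann V F Y) E D = ann V F Y \<inter> ann V E D"
  by (auto simp: ann_def)

lemma ann_mono: "F \<subseteq> E \<Longrightarrow> Y \<subseteq> D \<Longrightarrow> ann V E D \<subseteq> ann V F Y"
  by (auto simp: ann_def vanish_def)

lemma subspace_rad: "subspace E \<Longrightarrow> subspace (rad M E D)"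
  by (auto simp: subspace_def rad_def form_simps)

lemma rad_subset: "rad M E D \<subseteq> E"
  by (auto simp: rad_def)

lemma fdsub_rad: "fdsub E \<Longrightarrow> fdsub (rad M E D)"
  using fdsub_subset subspace_rad fdsub_subspace rad_subset by blast

lemma rk_rad: "fdsub E \<Longrightarrow> rk M E D + dim (rad M E D) = dim E"
  unfolding rk_def using fdsub_dim_mono[OF _ subspace_rad rad_subset] fdsub_subspace by simp

lemma rd_ann: "fdsub V \<Longrightarrow> rd V E D + dim (ann V E D) = dim V"
  unfolding rd_def using fdsub_dim_mono[OF _ subspace_ann ann_subset] fdsub_subspace by simp

lemma lin_form: "lin_on V (\<lambda>N. b N x y)" and lin_left: "lin_on V (\<lambda>x. b N x y)" and lin_right: "lin_on V (b N x)"
  by (auto simp: lin_on_def form_simps)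

lemma rk_flip:
  assumes "fdsub E" "fdsub D"
  shows "form_space.rk scale (\<lambda>N x y. b N y x) M D E = rk M E D"
proof -
  interpret fl: form_space scale "\<lambda>N x y. b N y x" by (rule flip_form_space)
  have "dim E + dim {y \<in> D. \<forall>x\<in>E. b M x y = 0} = dim D + dim {x \<in> E. \<forall>y\<in>D. b M x y = 0}"
    using assms by (rule dim_pairing) (auto simp: lin_left lin_right)
  then show ?thesis using fl.rk_rad[OF assms(2), of M E] rk_rad[OF assms(1), of M D]
    by (simp add: rad_def fl.rad_def)
qed

lemma vanish_flip: "form_space.vanish (\<lambda>N x y. b N y x) N Y F \<longleftrightarrow> vanish N F Y"
proof -
  interpret fl: form_space scale "\<lambda>N x y. b N y x" by (rule flip_form_space)
  show ?thesis by (auto simp: vanish_def fl.vanish_def)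
qed

lemma ann_flip: "form_space.ann (\<lambda>N x y. b N y x) V Y F = ann V F Y"
proof -
  interpret fl: form_space scale "\<lambda>N x y. b N y x" by (rule flip_form_space)
  show ?thesis by (auto simp: ann_def fl.ann_def vanish_flip)
qed

lemma rd_flip: "form_space.rd scale (\<lambda>N x y. b N y x) V Y F = rd V F Y"
proof -
  interpret fl: form_space scale "\<lambda>N x y. b N y x" by (rule flip_form_space)
  show ?thesis by (simp add: rd_def fl.rd_def ann_flip)
qed

section \<open>Inequalities for ranks and for dimensions of restrictions\<close>

lemma rk_mono:
  assumes E: "fdsub E" and s: "subspace E'" "E' \<subseteq> E" "D' \<subseteq> D"
  shows "rk M E' D' \<le> rk M E D"
proof -
  have E': "fdsub E'" by (rule fdsub_subset[OF E s(1,2)])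
  have sE: "subspace E" using E fdsub_subspace by blast
  have "dim E' + dim (rad M E D) \<le> dim E + dim (E' \<inter> rad M E D)"
    by (rule dim_add_le[OF E s(1,2) subspace_rad[OF sE] rad_subset])
  moreover have "dim (E' \<inter> rad M E D) \<le> dim (rad M E' D')"
    by (rule fdsub_dim_mono[OF fdsub_rad[OF E']]) (use s sE in \<open>auto simp: rad_def subspace_inter intro!: subspace_inter subspace_rad[unfolded rad_def]\<close>)
  ultimately show ?thesis using rk_rad[OF E, of M D] rk_rad[OF E', of M D'] by linarith
qed

text \<open>The radical of \<open>M\<close> on \<open>E\<close> against \<open>Y\<close> contains
  both \<open>F\<close> and the radical against \<open>D\<close>, and these two meet in the radical
  on \<open>F\<close>. Comparing dimensions gives the rank bound for the diagonal blocks of a block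
  triangular form.\<close>

lemma rk_blocks:
  assumes E: "fdsub E" and D: "subspace D" and F: "subspace F" "F \<subseteq> E" and Y: "Y \<subseteq> D" and v: "vanish M F Y"
    and E1: "subspace E1" "E1 \<subseteq> E" and D1: "D1 \<subseteq> D"
  shows "rk M F D1 + rk M E1 Y \<le> rk M E D"
proof -
  have fF: "fdsub F" by (rule fdsub_subset[OF E F])
  have sE: "subspace E" using E fdsub_subspace by blast
  have "dim F + dim (rad M E D) \<le> dim (rad M E Y) + dim (F \<inter> rad M E D)"
    by (rule dim_add_le[OF fdsub_rad[OF E]]) (use F Y v subspace_rad[OF sE] in \<open>auto simp: rad_def vanish_def\<close>)
  moreover have "F \<inter> rad M E D = rad M F D" using F by (auto simp: rad_def)
  ultimately have "rk M F D + rk M E Y \<le> rk M E D"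
    using rk_rad[OF E, of M D] rk_rad[OF E, of M Y] rk_rad[OF fF, of M D] by simp
  then show ?thesis using rk_mono[OF fF F(1) _ D1, of M] rk_mono[OF E E1, of Y Y M] by simp
qed

lemma rk_le_dim: "rk M E D \<le> dim E"
  by (simp add: rk_def)

lemma rk_le_dim': "fdsub E \<Longrightarrow> fdsub D \<Longrightarrow> rk M E D \<le> dim D"
  using form_space.rk_le_dim[OF flip_form_space, of M D E] by (simp add: rk_flip)

lemma rk_0_iff:
  assumes "fdsub E"
  shows "rk M E D = 0 \<longleftrightarrow> vanish M E D"
proof
  assume "rk M E D = 0"
  then have "rad M E D = E"
    using rk_rad[OF assms, of M D] fdsub_dim_eq[OF assms subspace_rad rad_subset] fdsub_subspace[OF assms] by simp
  then show "vanish M E D" by (auto simp: rad_def vanish_def)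
next
  assume "vanish M E D"
  then have "rad M E D = E" by (auto simp: rad_def vanish_def)
  then show "rk M E D = 0" by (simp add: rk_def)
qed

text \<open>On \<open>F\<close> only a complement \<open>D1\<close> of \<open>Y\<close> matters, so
  the radical on \<open>F\<close> has codimension at most \<open>dim D1\<close> in \<open>F\<close>,
  and it lies in the radical on \<open>E\<close>.\<close>

lemma rk_le_vanish:
  assumes E: "fdsub E" and D: "fdsub D" and F: "subspace F" "F \<subseteq> E" and Y: "subspace Y" "Y \<subseteq> D" and v: "vanish M F Y"
  shows "rk M E D + dim F + dim Y \<le> dim E + dim D"
proof -
  obtain D1 where D1: "subspace D1" "D1 \<subseteq> D" "Y \<inter> D1 = {0}" "ssum Y D1 = D" "dim Y + dim D1 = dim D"
    by (rule complement_exists[OF D Y])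
  have fF: "fdsub F" and fD1: "fdsub D1" using fdsub_subset[OF E F] fdsub_subset[OF D D1(1,2)] by auto
  have "rad M F D1 \<subseteq> rad M E D"
  proof
    fix x assume x: "x \<in> rad M F D1"
    have "b M x y = 0" if "y \<in> D" for y
    proof -
      have "y \<in> ssum Y D1" using that D1(4) by simp
      then obtain y1 y2 where "y1 \<in> Y" "y2 \<in> D1" "y = y1 + y2" by (rule ssumE)
      then show ?thesis using x v by (auto simp: form_simps rad_def vanish_def)
    qed
    then show "x \<in> rad M E D" using x F by (auto simp: rad_def)
  qed
  then have "dim (rad M F D1) \<le> dim (rad M E D)"
    by (rule fdsub_dim_mono[OF fdsub_rad[OF E] subspace_rad[OF F(1)]])
  then show ?thesis using rk_le_dim'[OF fF fD1, of M] rk_rad[OF fF, of M D1] rk_rad[OF E, of M D] D1(5) by linarith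
qed

lemma rd_le_product:
  assumes V: "fdsub V" and E: "fdsub E" and D: "fdsub D"
  shows "rd V E D \<le> dim E * dim D"
proof -
  obtain B where B: "B \<subseteq> E" "finite B" "independent B" "span B = E" "card B = dim E" by (rule fdsub_basis[OF E])
  obtain C where C: "C \<subseteq> D" "finite C" "independent C" "span C = D" "card C = dim D" by (rule fdsub_basis[OF D])
  have e: "{N \<in> V. \<forall>i\<in>B \<times> C. b N (fst i) (snd i) = 0} = ann V E D"
  proof -
    have "vanish N E D \<longleftrightarrow> vanish N B C" for N
      using vanish_span[of N B C] vanish_mono[of N E D B C] B(1,4) C(1,4) by auto
    then show ?thesis by (auto simp: ann_def vanish_def)
  qed
  have "dim V \<le> dim {N \<in> V. \<forall>i\<in>B \<times> C. b N (fst i) (snd i) = 0} + card (B \<times> C) \<and> subspace {N \<in> V. \<forall>i\<in>B \<times> C. b N (fst i) (snd i) = 0}"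
    by (rule dim_kernel_functionals[OF V]) (auto simp: B C lin_form)
  then show ?thesis unfolding e using rd_ann[OF V, of E D] B C by (simp add: card_cartesian_product)
qed

lemma rd_mono:
  assumes V: "fdsub V" and s: "F \<subseteq> E" "Y \<subseteq> D"
  shows "rd V F Y \<le> rd V E D"
  using fdsub_dim_mono[OF fdsub_ann[OF V] subspace_ann[OF fdsub_subspace[OF V]] ann_mono[OF s]]
    rd_ann[OF V, of F Y] rd_ann[OF V, of E D] by linarith

lemma rd_ssum_right:
  assumes V: "fdsub V" and Y: "subspace Y" "subspace Y'"
  shows "rd V E (ssum Y Y') \<le> rd V E Y + rd V E Y'"
proof -
  have sV: "subspace V" using V fdsub_subspace by blast
  have "ann V E (ssum Y Y') = ann V E Y \<inter> ann V E Y'"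
    using ssum_upper[OF Y] vanish_ssum_right vanish_mono by (fastforce simp: ann_def)
  then show ?thesis
    using dim_add_le[OF V subspace_ann[OF sV] ann_subset subspace_ann[OF sV] ann_subset, of E Y E Y']
      rd_ann[OF V, of E Y] rd_ann[OF V, of E Y'] rd_ann[OF V, of E "ssum Y Y'"] by simp
qed

lemma rd_ssum_left:
  assumes "fdsub V" "subspace F" "subspace F'"
  shows "rd V (ssum F F') D \<le> rd V F D + rd V F' D"
  using form_space.rd_ssum_right[OF flip_form_space assms, of D] by (simp add: rd_flip)

lemma rd_le_quotient:
  assumes V: "fdsub V" and E: "fdsub E" and D: "fdsub D" and Y: "subspace Y" "Y \<subseteq> D"
    and v: "\<And>N. N \<in> V \<Longrightarrow> vanish N E Y"
  shows "rd V E D \<le> dim E * (dim D - dim Y)"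
proof -
  obtain D1 where D1: "subspace D1" "D1 \<subseteq> D" "Y \<inter> D1 = {0}" "ssum Y D1 = D" "dim Y + dim D1 = dim D"
    by (rule complement_exists[OF D Y])
  have "rd V E D \<le> rd V E Y + rd V E D1" using rd_ssum_right[OF V Y(1) D1(1)] D1(4) by simp
  also have "rd V E Y = 0" 
  proof -
    have "ann V E Y = V" using v by (auto simp: ann_def)
    then show ?thesis by (simp add: rd_def)
  qed
  also have "rd V E D1 \<le> dim E * dim D1" by (rule rd_le_product[OF V E fdsub_subset[OF D D1(1,2)]])
  finally show ?thesis using D1(5) by (metis add_0 diff_add_inverse)
qed

lemma rd_restrict:
  assumes V: "fdsub V" and s: "F \<subseteq> E" "Y \<subseteq> D"
  shows "rd V E D = rd V F Y + rd (ann V F Y) E D"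
proof -
  have "ann (ann V F Y) E D = ann V E D" using ann_ann ann_mono[OF s] by blast
  then show ?thesis using rd_ann[OF V, of E D] rd_ann[OF V, of F Y] rd_ann[OF fdsub_ann[OF V], of F Y E D] by simp
qed

lemma rd_kernel_functional:
  assumes V: "fdsub V" and f: "lin_on V f"
  shows "rd V E D \<le> rd {N \<in> V. f N = 0} E D + 1"
proof -
  let ?V0 = "{N \<in> V. f N = 0}"
  have s0: "subspace ?V0" using lin_on_kernel[OF fdsub_subspace[OF V] f] .
  have f0: "fdsub ?V0" by (rule fdsub_subset[OF V s0]) auto
  have "dim (ann ?V0 E D) \<le> dim (ann V E D)"
    by (rule fdsub_dim_mono[OF fdsub_ann[OF V] subspace_ann[OF s0]]) (auto simp: ann_def)
  then show ?thesis using dim_kernel_functional[OF V f] rd_ann[OF V, of E D] rd_ann[OF f0, of E D] by linarith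
qed

text \<open>Since \<open>M\<close> vanishes against \<open>y\<close>, a vector in the radical of
  \<open>M + N\<close> is killed by \<open>N\<close> against \<open>y\<close>, hence by
  \<open>N\<close> altogether because \<open>y\<close> lies outside \<open>H\<close>. So that
  radical is contained in the radical of \<open>M\<close>, and it misses \<open>x\<close>.\<close>

lemma rk_add_rank_one:
  assumes E: "fdsub E" and D: "fdsub D" and H: "subspace H" "H \<subseteq> D" "dim H + 1 = dim D"
    and N: "vanish N E H" and y: "y \<in> D" "\<And>x. x \<in> E \<Longrightarrow> b M x y = 0"
    and x: "x \<in> rad M E D" and nz: "b N x y \<noteq> 0"
  shows "rk M E D < rk (M + N) E D"
proof -
  have xE: "x \<in> E" using x by (simp add: rad_def)
  have yH: "y \<notin> H" using N nz xE by (auto simp: vanish_def)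
  have sub: "rad (M + N) E D \<subseteq> rad M E D"
  proof
    fix x' assume x': "x' \<in> rad (M + N) E D"
    then have x'E: "x' \<in> E" by (simp add: rad_def)
    have 0: "b N x' y = 0" using x' y by (auto simp: rad_def form_simps)
    have "b N x' z = 0" if "z \<in> D" for z
      by (rule hyperplane_decomp[OF D H y(1) yH that]) (use N x'E 0 in \<open>auto simp: form_simps vanish_def\<close>)
    then show "x' \<in> rad M E D" using x' by (auto simp: rad_def form_simps)
  qed
  have "x \<notin> rad (M + N) E D" 
  proof
    assume "x \<in> rad (M + N) E D"
    then have "b (M + N) x y = 0" using y(1) by (simp add: rad_def)
    then show False using nz y(2)[OF xE] by (simp add: form_simps)
  qed
  then have "\<not> dim (rad M E D) \<le> dim (rad (M + N) E D)"
    using fdsub_dim_eq[OF fdsub_rad[OF E] subspace_rad[OF fdsub_subspace[OF E]] sub] x by blast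
  then show ?thesis using rk_rad[OF E, of M D] rk_rad[OF E, of "M + N" D] by linarith
qed

lemma rank_one_radical:
  assumes E: "fdsub E" and D: "fdsub D" and H: "subspace H" "H \<subseteq> D" "dim H + 1 = dim D"
    and N: "vanish N E H" "\<not> vanish N E D"
  shows "dim (rad N E D) + 1 = dim E"
proof -
  have "H \<noteq> D" using H by auto
  then obtain y where y: "y \<in> D" "y \<notin> H" using H by blast
  have e: "rad N E D = {x \<in> E. b N x y = 0}"
  proof (safe)
    fix x assume x: "x \<in> E" "b N x y = 0"
    have "b N x z = 0" if "z \<in> D" for z
      by (rule hyperplane_decomp[OF D H y that]) (use N x in \<open>auto simp: form_simps vanish_def\<close>)
    then show "x \<in> rad N E D" using x by (simp add: rad_def)
  qed (auto simp: rad_def y)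
  have "dim E \<le> dim (rad N E D) + 1" unfolding e by (rule dim_kernel_functional[OF E lin_left])
  moreover have "rk N E D \<noteq> 0" using rk_0_iff[OF E] N by blast
  ultimately show ?thesis using rk_rad[OF E, of N D] by linarith
qed

text \<open>Both \<open>M\<close> and \<open>M + N\<close> have a vector outside \<open>E'\<close> in their radical; if \<open>M\<close> still had rank \<open>r\<close> on
  \<open>E' \<times> D'\<close>, the difference of suitable multiples would force \<open>N\<close> to vanish on such a vector.\<close>

lemma rk_extract:
  assumes E: "fdsub E" and D: "fdsub D"
    and E': "subspace E'" "E' \<subseteq> E" "dim E' + 1 = dim E" and D': "subspace D'" "D' \<subseteq> D"
    and N: "vanish N E' D" "vanish N E D'" "\<not> vanish N E D"
    and r: "rk M E D \<le> r" "rk (M + N) E D \<le> r"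
  shows "rk M E' D' < r"
proof (rule ccontr)
  assume "\<not> rk M E' D' < r"
  then have le: "r \<le> rk M E' D'" by simp
  have fE': "fdsub E'" by (rule fdsub_subset[OF E E'(1,2)])
  let ?K = "rad M E' D'"
  have sE: "subspace E" using E fdsub_subspace by blast
  have K: "dim ?K + r + 1 \<le> dim E" using rk_rad[OF fE', of M D'] le E'(3) by linarith
  have ex: "\<exists>x\<in>rad L E D. x \<notin> E'" if L: "rk L E D \<le> r" "rad L E D \<inter> E' \<subseteq> ?K" for L
  proof (rule ccontr)
    assume "\<not> ?thesis"
    then have "rad L E D \<subseteq> ?K" using L(2) by blast
    then have "dim (rad L E D) \<le> dim ?K"
      by (rule fdsub_dim_mono[OF fdsub_rad[OF fE'] subspace_rad[OF sE]])
    then show False using rk_rad[OF E, of L D] L K by linarith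
  qed
  obtain x1 where x1: "x1 \<in> rad M E D" "x1 \<notin> E'" using ex[OF r(1)] D' by (auto simp: rad_def)
  have "rad (M + N) E D \<inter> E' \<subseteq> ?K" using D' N(1) by (auto simp: rad_def form_simps vanish_def)
  then obtain x2 where x2: "x2 \<in> rad (M + N) E D" "x2 \<notin> E'" using ex[OF r(2)] by blast
  have x12: "x1 \<in> E" "x2 \<in> E" using x1 x2 by (auto simp: rad_def)
  obtain z c where z: "z \<in> E'" "x2 = z + scale c x1" by (rule hyperplane_decomp[OF E E' x12(1) x1(2) x12(2)])
  have zK: "z \<in> ?K"
  proof -
    have "b M z y = 0" if "y \<in> D'" for y
    proof -
      have y: "y \<in> D" using that D' by blast
      have "b (M + N) x2 y = 0" "b M x1 y = 0" "b N x2 y = 0"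
        using x1(1) x2(1) y that N(2) x12(2) by (auto simp: rad_def vanish_def)
      then have "b M x2 y = 0" by (simp add: add_form)
      then show ?thesis using \<open>b M x1 y = 0\<close> z(2) by (simp add: form_simps)
    qed
    then show ?thesis using z by (simp add: rad_def)
  qed
  have s: "rad M E D \<inter> E' \<subseteq> ?K" using D' by (auto simp: rad_def)
  have "dim (rad M E D) + dim E' \<le> dim E + dim (rad M E D \<inter> E')"
    by (rule dim_add_le[OF E subspace_rad[OF sE] rad_subset E'(1,2)])
  then have "dim ?K \<le> dim (rad M E D \<inter> E')" using rk_rad[OF E, of M D] r(1) K E'(3) by linarith
  then have "rad M E D \<inter> E' = ?K"
    by (intro fdsub_dim_eq[OF fdsub_rad[OF fE'] _ s]) (auto intro: subspace_inter subspace_rad sE E')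
  then have zM: "b M z y = 0" if "y \<in> D" for y using zK that by (auto simp: rad_def)
  have 0: "b N x2 y = 0" if "y \<in> D" for y
  proof -
    have "b (M + N) x2 y = 0" "b M x1 y = 0" using x1(1) x2(1) that by (auto simp: rad_def)
    moreover have "b M x2 y = 0" using z(2) zM[OF that] \<open>b M x1 y = 0\<close> by (simp add: form_simps)
    ultimately show ?thesis by (simp add: add_form)
  qed
  have "b N w y = 0" if w: "w \<in> E" and y: "y \<in> D" for w y
    by (rule hyperplane_decomp[OF E E' x12(2) x2(2) w]) (use N(1) 0[OF y] y in \<open>auto simp: form_simps vanish_def\<close>)
  then have "vanish N E D" by (rule vanishI)
  then show False using N(3) by blast
qed

section \<open>Affine families of forms\<close>

definition aff :: "'b \<Rightarrow> 'b set \<Rightarrow> 'b set" where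
  "aff A V = (\<lambda>N. A + N) ` V"

lemma aff_base: "subspace V \<Longrightarrow> A \<in> aff A V"
  unfolding aff_def using subspace_0[of V] by force

lemma aff_translate: "subspace V \<Longrightarrow> M \<in> aff A V \<Longrightarrow> N \<in> V \<Longrightarrow> M + N \<in> aff A V"
  by (auto simp: aff_def subspace_add add.assoc)

lemma aff_subset: "subspace V \<Longrightarrow> M \<in> aff A V \<Longrightarrow> U \<subseteq> V \<Longrightarrow> aff M U \<subseteq> aff A V"
  using aff_translate by (auto simp: aff_def[of M])

lemma aff_diff: "subspace V \<Longrightarrow> M \<in> aff A V \<Longrightarrow> M' \<in> aff A V \<Longrightarrow> M' - M \<in> V"
  by (auto simp: aff_def subspace_diff)

lemma vanish_aff_direction:
  assumes V: "subspace V" and v: "\<And>M. M \<in> aff A V \<Longrightarrow> vanish M F Y" and N: "N \<in> V"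
  shows "vanish N F Y"
proof -
  have "vanish (A + N) F Y" "vanish A F Y" using v aff_base[OF V] aff_translate[OF V _ N] by auto
  then show ?thesis using vanish_diff[of "A + N" F Y A] by simp
qed

text \<open>A member violating the first condition and one violating the second span an affine line
  on which each condition holds at exactly one point. The third point with parameter
  \<open>c\<close> violates both.\<close>

lemma aff_union:
  assumes V: "subspace V"
    and un: "\<And>M. M \<in> aff A V \<Longrightarrow> vanish M F1 Y1 \<or> vanish M F2 Y2"
  shows "(\<forall>M\<in>aff A V. vanish M F1 Y1) \<or> (\<forall>M\<in>aff A V. vanish M F2 Y2)"
proof (rule ccontr)
  assume "\<not> ?thesis"
  then obtain M1 M2 where M: "M1 \<in> aff A V" "\<not> vanish M1 F1 Y1" "M2 \<in> aff A V" "\<not> vanish M2 F2 Y2" by blast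
  then have v: "vanish M1 F2 Y2" "vanish M2 F1 Y1" using un by blast+
  obtain x1 y1 where 1: "x1 \<in> F1" "y1 \<in> Y1" "b M1 x1 y1 \<noteq> 0" using M by (auto simp: vanish_def)
  obtain x2 y2 where 2: "x2 \<in> F2" "y2 \<in> Y2" "b M2 x2 y2 \<noteq> 0" using M by (auto simp: vanish_def)
  obtain c :: 'a where c: "c \<noteq> 0" "c \<noteq> 1" using third_scalar by blast
  let ?M = "M1 + scale c (M2 - M1)"
  have "?M \<in> aff A V" using aff_translate[OF V M(1)] aff_diff[OF V M(1,3)] V subspace_scale by blast
  then have "vanish ?M F1 Y1 \<or> vanish ?M F2 Y2" by (rule un)
  moreover have "b ?M x1 y1 = (1 - c) * b M1 x1 y1"
    using 1 v by (simp add: form_simps vanish_def algebra_simps)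
  moreover have "b ?M x2 y2 = c * b M2 x2 y2" using 2 v by (simp add: form_simps vanish_def)
  ultimately show False using 1 2 c by (auto simp: vanish_def)
qed

definition compressed :: "'b set \<Rightarrow> nat \<Rightarrow> 'b set \<Rightarrow> 'b set \<Rightarrow> bool" where
  "compressed S r E D \<longleftrightarrow> (\<exists>F Y. subspace F \<and> F \<subseteq> E \<and> subspace Y \<and> Y \<subseteq> D \<and>
     dim F + dim Y + r = dim E + dim D \<and> (\<forall>M\<in>S. vanish M F Y))"

text \<open>The family \<open>U\<^sub>3\<close> in suitable bases; together with the dimension \<open>4\<close> the equations determine the family.\<close>

definition exceptional :: "'b \<Rightarrow> 'b set \<Rightarrow> nat \<Rightarrow> 'b set \<Rightarrow> 'b set \<Rightarrow> bool" where
  "exceptional A V r E D \<longleftrightarrow> r = 2 \<and> dim E = 3 \<and> dim D = 3 \<and> rd V E D = 4 \<and> card (UNIV :: 'a set) = 3 \<and>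
     (\<exists>x0 x1 x2 y0 y1 y2. span {x0, x1, x2} = E \<and> span {y0, y1, y2} = D \<and>
       (\<forall>M\<in>aff A V. b M x0 y1 = 0 \<and> b M x0 y2 = 0 \<and> b M x1 y2 = 0 \<and>
          b M x1 y1 = b M x0 y0 + 1 \<and> b M x2 y2 = b M x0 y0 - 1))"

text \<open>The theorem for forms, below a bound on the total dimension. With \<open>max\<close> and \<open>min\<close> it is invariant under
  transposition.\<close>

definition classified :: "nat \<Rightarrow> bool" where
  "classified k \<longleftrightarrow> (\<forall>A V r E D. fdsub V \<longrightarrow> fdsub E \<longrightarrow> fdsub D \<longrightarrow> dim E + dim D < k \<longrightarrow>
     r \<le> min (dim E) (dim D) \<longrightarrow> (\<forall>M\<in>aff A V. rk M E D \<le> r) \<longrightarrow>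
     max (dim E) (dim D) * r + min (dim E) (dim D) \<le> rd V E D + max (dim E) (dim D) + r \<longrightarrow>
     compressed (aff A V) r E D \<or> exceptional A V r E D)"

section \<open>Vanishing rectangles\<close>

text \<open>Inclusion and exclusion for a union of two rectangles. \<open>E\<close> is split into
  the intersection \<open>G\<close> of \<open>F1\<close> and \<open>F2\<close>, complements
  \<open>A\<close> and \<open>B\<close> of \<open>G\<close> in \<open>F1\<close> and
  \<open>F2\<close>, and a rest \<open>C\<close>; on these parts the forms see only the quotients of
  \<open>D\<close> by \<open>ssum Y1 Y2\<close>, \<open>Y1\<close>, \<open>Y2\<close> and
  zero.\<close>

lemma rd_vanish_two:
  assumes V: "fdsub V" and E: "fdsub E" and D: "fdsub D"
    and F1: "subspace F1" "F1 \<subseteq> E" and F2: "subspace F2" "F2 \<subseteq> E"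
    and Y1: "subspace Y1" "Y1 \<subseteq> D" and Y2: "subspace Y2" "Y2 \<subseteq> D"
    and v1: "\<And>N. N \<in> V \<Longrightarrow> vanish N F1 Y1" and v2: "\<And>N. N \<in> V \<Longrightarrow> vanish N F2 Y2"
  shows "rd V E D + dim F1 * dim Y1 + dim F2 * dim Y2 \<le> dim E * dim D + dim (F1 \<inter> F2) * dim (Y1 \<inter> Y2)"
proof -
  define G where "G = F1 \<inter> F2"
  have G: "subspace G" "G \<subseteq> F1" "G \<subseteq> F2" using F1 F2 by (auto simp: G_def subspace_inter)
  note fF1 = fdsub_subset[OF E F1] and fF2 = fdsub_subset[OF E F2]
  note fY1 = fdsub_subset[OF D Y1] and fY2 = fdsub_subset[OF D Y2]
  obtain A where A: "subspace A" "A \<subseteq> F1" "G \<inter> A = {0}" "ssum G A = F1" "dim G + dim A = dim F1"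
    by (rule complement_exists[OF fF1 G(1,2)])
  obtain B where B: "subspace B" "B \<subseteq> F2" "G \<inter> B = {0}" "ssum G B = F2" "dim G + dim B = dim F2"
    by (rule complement_exists[OF fF2 G(1,3)])
  have fA: "fdsub A" and fB: "fdsub B" and fG: "fdsub G"
    using fdsub_subset[OF fF1 A(1,2)] fdsub_subset[OF fF2 B(1,2)] fdsub_subset[OF fF1 G(1,2)] by auto
  have "F1 \<inter> B = {0}" using B(2,3) subspace_0[OF F1(1)] subspace_0[OF B(1)] by (auto simp: G_def)
  then have dFB: "dim (ssum F1 B) = dim F1 + dim B" using dim_ssum[OF fF1 fB] fdsub_zero by simp
  have sFB: "subspace (ssum F1 B)" "ssum F1 B \<subseteq> E"
    using subspace_ssum[OF F1(1) B(1)] ssum_least[OF fdsub_subspace[OF E] F1(2)] B(2) F2(2) by auto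
  obtain C where C: "subspace C" "C \<subseteq> E" "ssum F1 B \<inter> C = {0}" "ssum (ssum F1 B) C = E" "dim (ssum F1 B) + dim C = dim E"
    by (rule complement_exists[OF E sFB])
  have fC: "fdsub C" by (rule fdsub_subset[OF E C(1,2)])
  define Z where "Z = ssum Y1 Y2"
  have Z: "subspace Z" "Z \<subseteq> D" "dim Z + dim (Y1 \<inter> Y2) = dim Y1 + dim Y2"
    using subspace_ssum[OF Y1(1) Y2(1)] ssum_least[OF fdsub_subspace[OF D] Y1(2) Y2(2)] dim_ssum[OF fY1 fY2]
    by (auto simp: Z_def)
  have vG: "vanish N G Z" if "N \<in> V" for N
    unfolding Z_def using vanish_ssum_right[OF vanish_mono[OF v1[OF that] G(2) subset_refl] vanish_mono[OF v2[OF that] G(3) subset_refl]] .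
  have "rd V G D \<le> dim G * (dim D - dim Z)"
    by (rule rd_le_quotient[OF V fG D Z(1,2)]) (use vG in auto)
  moreover have "rd V A D \<le> dim A * (dim D - dim Y1)"
    by (rule rd_le_quotient[OF V fA D Y1]) (use vanish_mono[OF v1 A(2) subset_refl] in auto)
  moreover have "rd V B D \<le> dim B * (dim D - dim Y2)"
    by (rule rd_le_quotient[OF V fB D Y2]) (use vanish_mono[OF v2 B(2) subset_refl] in auto)
  moreover have "rd V C D \<le> dim C * dim D" by (rule rd_le_product[OF V fC D])
  moreover have "rd V E D \<le> rd V (ssum F1 B) D + rd V C D" using rd_ssum_left[OF V sFB(1) C(1), of D] C(4) by simp
  moreover have "rd V (ssum F1 B) D \<le> rd V F1 D + rd V B D" by (rule rd_ssum_left[OF V F1(1) B(1)])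
  moreover have "rd V F1 D \<le> rd V G D + rd V A D" using rd_ssum_left[OF V G(1) A(1), of D] A(4) by simp
  ultimately have "rd V E D \<le> dim G * (dim D - dim Z) + dim A * (dim D - dim Y1) + dim B * (dim D - dim Y2) + dim C * dim D"
    by linarith
  then have "int (rd V E D) \<le> int (dim G * (dim D - dim Z) + dim A * (dim D - dim Y1) + dim B * (dim D - dim Y2) + dim C * dim D)"
    by (rule zle_int[THEN iffD2])
  moreover have "dim Z \<le> dim D" "dim Y1 \<le> dim D" "dim Y2 \<le> dim D"
    using fdsub_dim_mono[OF D] Y1 Y2 Z by auto
  ultimately have i: "int (rd V E D) \<le> int (dim G) * (int (dim D) - int (dim Z)) + int (dim A) * (int (dim D) - int (dim Y1))
     + int (dim B) * (int (dim D) - int (dim Y2)) + int (dim C) * int (dim D)"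
    by (simp add: of_nat_diff)
  have e: "int (dim Z) = int (dim Y1) + int (dim Y2) - int (dim (Y1 \<inter> Y2))" "int (dim A) = int (dim F1) - int (dim G)"
     "int (dim B) = int (dim F2) - int (dim G)" "int (dim C) = int (dim E) - int (dim F1) - int (dim F2) + int (dim G)"
    using Z(3) A(5) B(5) C(5) dFB by linarith+
  have "int (rd V E D) + int (dim F1) * int (dim Y1) + int (dim F2) * int (dim Y2) \<le> int (dim E) * int (dim D) + int (dim G) * int (dim (Y1 \<inter> Y2))"
    using i unfolding e by (simp add: algebra_simps)
  then have "int (rd V E D + dim F1 * dim Y1 + dim F2 * dim Y2) \<le> int (dim E * dim D + dim G * dim (Y1 \<inter> Y2))" by simp
  then show ?thesis unfolding G_def by (rule zle_int[THEN iffD1])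
qed

lemma rd_vanish:
  assumes V: "fdsub V" and E: "fdsub E" and D: "fdsub D"
    and F: "subspace F" "F \<subseteq> E" and Y: "subspace Y" "Y \<subseteq> D"
    and v: "\<And>N. N \<in> V \<Longrightarrow> vanish N F Y"
  shows "rd V E D + dim F * dim Y \<le> dim E * dim D"
  using rd_vanish_two[OF V E D F F Y Y v v] by simp

lemma product_ge_sum:
  assumes "f + y = m + 1" "1 \<le> f" "1 \<le> y"
  shows "m \<le> f * (y :: nat)"
proof -
  obtain f' where "f = Suc f'" using assms(2) by (cases f) auto
  moreover obtain y' where "y = Suc y'" using assms(3) by (cases y) auto
  ultimately show ?thesis using assms by simp
qed

text \<open>Two different rectangles with half-perimeter \<open>m + 1\<close> in a box of sides
  \<open>e\<close> and \<open>d\<close> cover an area of at least \<open>2 * m - 1\<close>, where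
  \<open>g\<close> and \<open>h\<close> measure the overlap; \<open>c\<close> denies this. The two
  implications in \<open>gh\<close> record that subspaces of full dimension coincide.\<close>

lemma two_rectangles_count:
  fixes f1 f2 y1 y2 g h e d m :: nat
  assumes s: "f1 + y1 = m + 1" "f2 + y2 = m + 1" and le: "f1 \<le> e" "f2 \<le> e" "y1 \<le> d" "y2 \<le> d" "e \<le> m" "d \<le> m"
    and gh: "g \<le> f1" "g \<le> f2" "h \<le> y1" "h \<le> y2" "f1 = e \<Longrightarrow> f2 = e \<Longrightarrow> g = e" "y1 = d \<Longrightarrow> y2 = d \<Longrightarrow> h = d"
    and c: "f1 * y1 + f2 * y2 + 2 \<le> g * h + 2 * m"
  shows "f1 = f2 \<and> y1 = y2 \<and> g = f1 \<and> h = y1"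
proof -
  \<comment> \<open>Different shapes: the overlap has at most the smaller width and the smaller
    height, here \<open>f2\<close> and \<open>y1\<close>.\<close>
  have key: False if h: "f1 = f2 + k" "y2 = y1 + k" "1 \<le> k" "f2 + k + y1 = m + 1" "1 \<le> f2" "1 \<le> y1" "g \<le> f2" "h \<le> y1"
    "f1 * y1 + f2 * y2 + 2 \<le> g * h + 2 * m" for f1 f2 y1 y2 k :: nat
  proof -
    obtain a where "f2 = Suc a" using h(5) by (cases f2) auto
    moreover obtain b where "y1 = Suc b" using h(6) by (cases y1) auto
    moreover obtain c where "k = Suc c" using h(3) by (cases k) auto
    moreover have "g * h \<le> f2 * y1" using h(7,8) by (rule mult_le_mono)
    ultimately show False using h by (simp add: algebra_simps)
  qed
  have pos: "1 \<le> f1" "1 \<le> y1" "1 \<le> f2" "1 \<le> y2" using s le by auto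
  consider "f2 < f1" | "f1 < f2" | "f1 = f2" by linarith
  then show ?thesis
  proof cases
    case 1
    then have k: "f1 = f2 + (f1 - f2)" "y2 = y1 + (f1 - f2)" "1 \<le> f1 - f2" "f2 + (f1 - f2) + y1 = m + 1"
      using s by linarith+
    show ?thesis using key[OF k pos(3,2) gh(2,3) c] by blast
  next
    case 2
    then have k: "f2 = f1 + (f2 - f1)" "y1 = y2 + (f2 - f1)" "1 \<le> f2 - f1" "f1 + (f2 - f1) + y2 = m + 1"
      using s by linarith+
    have "f2 * y2 + f1 * y1 + 2 \<le> g * h + 2 * m" using c by simp
    then show ?thesis using key[OF k pos(1,4) gh(1,4)] by blast
  next
    case 3
    then have y: "y1 = y2" using s by simp
    \<comment> \<open>With equal widths a narrower overlap is possible only below the full width,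
      and then \<open>e \<le> m\<close> forces a height of at least two.\<close>
    have "g = f1"
    proof (rule ccontr)
      assume "g \<noteq> f1"
      then have "f1 + 1 \<le> e" "g + 1 \<le> f1" using 3 gh le by (cases "f1 = e"; simp)+
      then obtain a where a: "f1 = Suc a" using pos(1) by (cases f1) auto
      have "2 \<le> y1" using \<open>f1 + 1 \<le> e\<close> s le by linarith
      then obtain c where cc: "y1 = Suc (Suc c)" using le_Suc_ex[of 2 y1] by auto
      have p: "g * h \<le> a * y1" using \<open>g + 1 \<le> f1\<close> gh a by (intro mult_le_mono) auto
      have e: "f1 = Suc a" "f2 = Suc a" "y1 = c + 2" "y2 = c + 2" "m = a + c + 2" using 3 y a cc s(1) by auto
      show False using assms(15) p unfolding e by (simp add: algebra_simps)
    qed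
    moreover have "h = y1"
    proof (rule ccontr)
      assume "h \<noteq> y1"
      then have "y1 + 1 \<le> d" "h + 1 \<le> y1" using y gh le by (cases "y1 = d"; simp)+
      then obtain a where a: "y1 = Suc a" using pos(2) by (cases y1) auto
      have "2 \<le> f1" using \<open>y1 + 1 \<le> d\<close> s le by linarith
      then obtain c where cc: "f1 = Suc (Suc c)" using le_Suc_ex[of 2 f1] by auto
      have p: "g * h \<le> f1 * a" using \<open>h + 1 \<le> y1\<close> gh a by (intro mult_le_mono) auto
      have e: "y1 = Suc a" "y2 = Suc a" "f1 = c + 2" "f2 = c + 2" "m = a + c + 2" using 3 y a cc s(1) by auto
      show False using assms(15) p unfolding e by (simp add: algebra_simps)
    qed
    ultimately show ?thesis using 3 y by simp
  qed
qed

text \<open>If the smaller dimension is one, the only rectangle of this size is \<open>E\<close>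
  times \<open>D\<close>. Otherwise \<open>c\<close> puts the space one dimension above the
  threshold, which is too large for vanishing on two different rectangles.\<close>

lemma vanishing_rectangle_unique:
  assumes V: "fdsub V" and E: "fdsub E" and D: "fdsub D"
    and F1: "subspace F1" "F1 \<subseteq> E" and F2: "subspace F2" "F2 \<subseteq> E"
    and Y1: "subspace Y1" "Y1 \<subseteq> D" and Y2: "subspace Y2" "Y2 \<subseteq> D"
    and v: "\<And>N. N \<in> V \<Longrightarrow> vanish N F1 Y1" "\<And>N. N \<in> V \<Longrightarrow> vanish N F2 Y2"
    and s: "dim F1 + dim Y1 = max (dim E) (dim D) + 1" "dim F2 + dim Y2 = max (dim E) (dim D) + 1"
    and c: "min (dim E) (dim D) = 1 \<or> dim E * dim D + 2 \<le> rd V E D + 2 * max (dim E) (dim D)"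
  shows "F1 = F2 \<and> Y1 = Y2"
proof -
  note fF1 = fdsub_subset[OF E F1] and fF2 = fdsub_subset[OF E F2]
  note fY1 = fdsub_subset[OF D Y1] and fY2 = fdsub_subset[OF D Y2]
  have le: "dim F1 \<le> dim E" "dim F2 \<le> dim E" "dim Y1 \<le> dim D" "dim Y2 \<le> dim D"
    using fdsub_dim_mono[OF E] fdsub_dim_mono[OF D] F1 F2 Y1 Y2 by auto
  have sI: "subspace (F1 \<inter> F2)" "subspace (Y1 \<inter> Y2)" using F1 F2 Y1 Y2 by (auto intro: subspace_inter)
  have top: "dim F1 = dim E \<Longrightarrow> F1 = E" "dim F2 = dim E \<Longrightarrow> F2 = E" "dim Y1 = dim D \<Longrightarrow> Y1 = D" "dim Y2 = dim D \<Longrightarrow> Y2 = D"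
    using fdsub_dim_eq[OF E F1] fdsub_dim_eq[OF E F2] fdsub_dim_eq[OF D Y1] fdsub_dim_eq[OF D Y2] by auto
  show ?thesis
  proof (cases "min (dim E) (dim D) = 1")
    case True
    then have "dim F1 = dim E" "dim F2 = dim E" "dim Y1 = dim D" "dim Y2 = dim D" using s le by linarith+
    then show ?thesis using top by simp
  next
    case False
    have "dim F1 = dim F2 \<and> dim Y1 = dim Y2 \<and> dim (F1 \<inter> F2) = dim F1 \<and> dim (Y1 \<inter> Y2) = dim Y1"
    proof (rule two_rectangles_count[OF s le])
      show "dim (F1 \<inter> F2) \<le> dim F1" "dim (F1 \<inter> F2) \<le> dim F2" "dim (Y1 \<inter> Y2) \<le> dim Y1" "dim (Y1 \<inter> Y2) \<le> dim Y2"
        using fdsub_dim_mono[OF fF1 sI(1)] fdsub_dim_mono[OF fF2 sI(1)] fdsub_dim_mono[OF fY1 sI(2)] fdsub_dim_mono[OF fY2 sI(2)] by auto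
      show "dim F1 * dim Y1 + dim F2 * dim Y2 + 2 \<le> dim (F1 \<inter> F2) * dim (Y1 \<inter> Y2) + 2 * max (dim E) (dim D)"
        using rd_vanish_two[OF V E D F1 F2 Y1 Y2 v] c False by linarith
    qed (use top in auto)
    then show ?thesis
      using fdsub_dim_eq[OF fF1 sI(1)] fdsub_dim_eq[OF fF2 sI(1)] fdsub_dim_eq[OF fY1 sI(2)] fdsub_dim_eq[OF fY2 sI(2)] by auto
  qed
qed

text \<open>For the rank bound \<open>min - 1\<close> the dimension hypothesis of
  \<open>classified\<close> is exactly the second alternative of \<open>c\<close>, and for
  \<open>min = 1\<close> it always holds. The exceptional family attains equality there;
  \<open>ne\<close> excludes it.\<close>

lemma classified_singular:
  assumes IH: "classified k" and k: "dim E + dim D < k"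
    and V: "fdsub V" and E: "fdsub E" and D: "fdsub D" and pos: "1 \<le> min (dim E) (dim D)"
    and sing: "\<And>M. M \<in> aff A V \<Longrightarrow> rk M E D < min (dim E) (dim D)"
    and c: "min (dim E) (dim D) = 1 \<or> dim E * dim D + 1 \<le> rd V E D + 2 * max (dim E) (dim D)"
    and ne: "dim E = 3 \<Longrightarrow> dim D = 3 \<Longrightarrow> rd V E D \<noteq> 4"
  obtains F Y where "subspace F" "F \<subseteq> E" "subspace Y" "Y \<subseteq> D" "dim F + dim Y = max (dim E) (dim D) + 1"
    "\<And>M. M \<in> aff A V \<Longrightarrow> vanish M F Y"
proof -
  let ?m = "max (dim E) (dim D)" and ?\<mu> = "min (dim E) (dim D)"
  obtain j where j: "?\<mu> = Suc j" using pos by (metis Suc_le_D One_nat_def)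
  have p: "?m * ?\<mu> = dim E * dim D" by (simp add: max_def min_def)
  have "?m * j + ?\<mu> \<le> rd V E D + ?m + j"
  proof (cases "?\<mu> = 1")
    case False
    then have "?m * Suc j + 1 \<le> rd V E D + 2 * ?m" using c p j by simp
    then show ?thesis using j by simp
  qed (use j pos in simp)
  then have "compressed (aff A V) j E D \<or> exceptional A V j E D"
    using IH k V E D sing j unfolding classified_def by (metis (no_types, lifting) Suc_leD less_Suc_eq_le order_refl)
  moreover have "\<not> exceptional A V j E D" using ne by (auto simp: exceptional_def)
  ultimately obtain F Y where "subspace F" "F \<subseteq> E" "subspace Y" "Y \<subseteq> D" "dim F + dim Y + j = dim E + dim D"
    "\<forall>M\<in>aff A V. vanish M F Y" unfolding compressed_def by blast
  moreover have "dim E + dim D = ?m + Suc j" using j by linarith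
  ultimately show ?thesis using that[of F Y] by simp
qed

lemma rk_add_vanish: "vanish N E D \<Longrightarrow> rk (M + N) E D = rk M E D"
  by (simp add: rk_def rad_def form_simps vanish_def cong: conj_cong)

text \<open>A member that is nonsingular on the first block stays so when forms vanishing there are added, so by the
  induction hypothesis it vanishes on a rectangle \<open>F \<times> Y\<close> of the second block, which by uniqueness
  does not depend on the member. The members that do not vanish at a fixed point of \<open>F \<times> Y\<close> are then
  singular on the first block, and the same argument applies to them with the roles exchanged.\<close>

lemma singular_pair_clash:
  assumes IH: "classified k" and V: "fdsub V"
    and P1: "fdsub P1" and R1: "fdsub R1" and P2: "fdsub P2" and R2: "fdsub R2"
    and k1: "dim P1 + dim R1 < k" and k2: "dim P2 + dim R2 < k"
    and pos1: "1 \<le> min (dim P1) (dim R1)" and pos2: "1 \<le> min (dim P2) (dim R2)"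
    and sing: "\<And>M. M \<in> aff A V \<Longrightarrow> rk M P1 R1 < min (dim P1) (dim R1) \<or> rk M P2 R2 < min (dim P2) (dim R2)"
    and M1: "M1 \<in> aff A V" "\<not> rk M1 P1 R1 < min (dim P1) (dim R1)"
    and M2: "M2 \<in> aff A V" "\<not> rk M2 P2 R2 < min (dim P2) (dim R2)"
    and c2: "min (dim P2) (dim R2) = 1 \<or> dim P2 * dim R2 + 2 \<le> rd (ann V P1 R1) P2 R2 + 2 * max (dim P2) (dim R2)"
    and c1: "rd (ann V P1 R1) P2 R2 + max (dim P2) (dim R2) \<le> dim P2 * dim R2 \<Longrightarrow>
       min (dim P1) (dim R1) = 1 \<or> dim P1 * dim R1 + 3 \<le> rd V P1 R1 + 2 * max (dim P1) (dim R1)"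
  shows False
proof -
  have sV: "subspace V" using V fdsub_subspace by blast
  let ?W = "ann V P1 R1"
  have fW: "fdsub ?W" and sW: "subspace ?W" using fdsub_ann[OF V] fdsub_subspace by auto
  have ex: "\<exists>F Y. subspace F \<and> F \<subseteq> P2 \<and> subspace Y \<and> Y \<subseteq> R2 \<and> dim F + dim Y = max (dim P2) (dim R2) + 1 \<and>
       (\<forall>L\<in>aff M ?W. vanish L F Y)" if M: "M \<in> aff A V" "\<not> rk M P1 R1 < min (dim P1) (dim R1)" for M
  proof -
    have s: "rk L P2 R2 < min (dim P2) (dim R2)" if L: "L \<in> aff M ?W" for L
    proof -
      obtain N where N: "N \<in> ?W" "L = M + N" using L by (auto simp: aff_def)
      then have "rk L P1 R1 = rk M P1 R1" using rk_add_vanish by (auto simp: ann_def)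
      moreover have "L \<in> aff A V" using aff_subset[OF sV M(1) ann_subset] L by blast
      ultimately show ?thesis using sing M(2) by fastforce
    qed
    have c: "min (dim P2) (dim R2) = 1 \<or> dim P2 * dim R2 + 1 \<le> rd ?W P2 R2 + 2 * max (dim P2) (dim R2)"
      "dim P2 = 3 \<Longrightarrow> dim R2 = 3 \<Longrightarrow> rd ?W P2 R2 \<noteq> 4" using c2 by auto
    show ?thesis
      by (rule classified_singular[OF IH k2 fW P2 R2 pos2 s c]) blast+
  qed
  obtain F Y where FY: "subspace F" "F \<subseteq> P2" "subspace Y" "Y \<subseteq> R2" "dim F + dim Y = max (dim P2) (dim R2) + 1"
    "\<forall>L\<in>aff M1 ?W. vanish L F Y" using ex[OF M1] by blast
  have WFY: "vanish N F Y" if "N \<in> ?W" for N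
    by (rule vanish_aff_direction[OF sW _ that]) (use FY(6) in blast)
  have C1: "vanish M F Y" if M: "M \<in> aff A V" "\<not> rk M P1 R1 < min (dim P1) (dim R1)" for M
  proof -
    obtain F' Y' where FY': "subspace F'" "F' \<subseteq> P2" "subspace Y'" "Y' \<subseteq> R2" "dim F' + dim Y' = max (dim P2) (dim R2) + 1"
      "\<forall>L\<in>aff M ?W. vanish L F' Y'" using ex[OF M] by blast
    have v': "vanish N F' Y'" if "N \<in> ?W" for N
      by (rule vanish_aff_direction[OF sW _ that]) (use FY'(6) in blast)
    have "F' = F \<and> Y' = Y"
      by (rule vanishing_rectangle_unique[OF fW P2 R2 FY'(1,2) FY(1,2) FY'(3,4) FY(3,4) v' WFY FY'(5) FY(5) c2])
    then show ?thesis using FY'(6) aff_base[OF sW] by blast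
  qed
  have "\<not> vanish M2 F Y"
    using rk_le_vanish[OF P2 R2 FY(1-4), of M2] M2(2) FY(5) by linarith
  then obtain x y where xy: "x \<in> F" "y \<in> Y" "b M2 x y \<noteq> 0" by (auto simp: vanish_def)
  \<comment> \<open>A rectangle of half-perimeter \<open>max + 1\<close> has area at least
    \<open>max\<close>, so \<open>?W\<close> misses that many dimensions on the second block. This
    is the premise of \<open>c1\<close>.\<close>
  have "max (dim P2) (dim R2) \<le> dim F * dim Y"
  proof (rule product_ge_sum[OF FY(5)])
    have "dim F \<le> dim P2" "dim Y \<le> dim R2" using fdsub_dim_mono P2 R2 FY by blast+
    then show "1 \<le> dim F" "1 \<le> dim Y" using FY(5) by linarith+
  qed
  then have "rd ?W P2 R2 + max (dim P2) (dim R2) \<le> dim P2 * dim R2"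
    using rd_vanish[OF fW P2 R2 FY(1-4) WFY] by linarith
  note c1' = c1[OF this]
  \<comment> \<open>Translation along \<open>V0\<close> preserves the nonzero value at
    \<open>(x, y)\<close>. The dimension lost here is why \<open>c1\<close> asks for
    \<open>3\<close> where uniqueness asks for \<open>2\<close>.\<close>
  define V0 where "V0 = {N \<in> V. b N x y = 0}"
  have sV0: "subspace V0" unfolding V0_def by (rule lin_on_kernel[OF sV lin_form])
  have V0V: "V0 \<subseteq> V" by (auto simp: V0_def)
  have fV0: "fdsub V0" by (rule fdsub_subset[OF V sV0 V0V])
  have rd0: "rd V P1 R1 \<le> rd V0 P1 R1 + 1" unfolding V0_def by (rule rd_kernel_functional[OF V lin_form])
  have ex': "\<exists>F Y. subspace F \<and> F \<subseteq> P1 \<and> subspace Y \<and> Y \<subseteq> R1 \<and> dim F + dim Y = max (dim P1) (dim R1) + 1 \<and>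
       (\<forall>L\<in>aff M V0. vanish L F Y)" if M: "M \<in> aff A V" "b M x y \<noteq> 0" for M
  proof -
    have s: "rk L P1 R1 < min (dim P1) (dim R1)" if L: "L \<in> aff M V0" for L
    proof -
      obtain N where N: "N \<in> V0" "L = M + N" using L by (auto simp: aff_def)
      then have "b L x y \<noteq> 0" using M(2) by (simp add: V0_def form_simps)
      then have "\<not> vanish L F Y" using xy by (auto simp: vanish_def)
      moreover have "L \<in> aff A V" using aff_subset[OF sV M(1) V0V] L by blast
      ultimately show ?thesis using C1 by blast
    qed
    have c: "min (dim P1) (dim R1) = 1 \<or> dim P1 * dim R1 + 1 \<le> rd V0 P1 R1 + 2 * max (dim P1) (dim R1)"
      "dim P1 = 3 \<Longrightarrow> dim R1 = 3 \<Longrightarrow> rd V0 P1 R1 \<noteq> 4" using c1' rd0 by auto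
    show ?thesis
      by (rule classified_singular[OF IH k1 fV0 P1 R1 pos1 s c]) blast+
  qed
  obtain F3 Y3 where F3: "subspace F3" "F3 \<subseteq> P1" "subspace Y3" "Y3 \<subseteq> R1" "dim F3 + dim Y3 = max (dim P1) (dim R1) + 1"
    "\<forall>L\<in>aff M2 V0. vanish L F3 Y3" using ex'[OF M2(1) xy(3)] by blast
  have v3: "vanish N F3 Y3" if "N \<in> V0" for N
    by (rule vanish_aff_direction[OF sV0 _ that]) (use F3(6) in blast)
  have "vanish M {x} {y} \<or> vanish M F3 Y3" if M: "M \<in> aff A V" for M
  proof (cases "b M x y = 0")
    case False
    obtain F' Y' where FY': "subspace F'" "F' \<subseteq> P1" "subspace Y'" "Y' \<subseteq> R1" "dim F' + dim Y' = max (dim P1) (dim R1) + 1"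
      "\<forall>L\<in>aff M V0. vanish L F' Y'" using ex'[OF M False] by blast
    have v': "vanish N F' Y'" if "N \<in> V0" for N
      by (rule vanish_aff_direction[OF sV0 _ that]) (use FY'(6) in blast)
    have c: "min (dim P1) (dim R1) = 1 \<or> dim P1 * dim R1 + 2 \<le> rd V0 P1 R1 + 2 * max (dim P1) (dim R1)"
      using c1' rd0 by linarith
    have "F' = F3 \<and> Y' = Y3"
      by (rule vanishing_rectangle_unique[OF fV0 P1 R1 FY'(1,2) F3(1,2) FY'(3,4) F3(3,4) v' v3 FY'(5) F3(5) c])
    then show ?thesis using FY'(6) aff_base[OF sV0] by blast
  qed (simp add: vanish_def)
  then have "(\<forall>M\<in>aff A V. vanish M {x} {y}) \<or> (\<forall>M\<in>aff A V. vanish M F3 Y3)" by (rule aff_union[OF sV])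
  then show False
  proof
    assume "\<forall>M\<in>aff A V. vanish M {x} {y}"
    then show False using M2(1) xy(3) by (auto simp: vanish_def)
  next
    assume "\<forall>M\<in>aff A V. vanish M F3 Y3"
    then have "vanish M1 F3 Y3" using M1(1) by blast
    then show False using rk_le_vanish[OF P1 R1 F3(1-4), of M1] M1(2) F3(5) by linarith
  qed
qed

section \<open>Families of rank at most one, and common radicals of rank-one forms\<close>

lemma rk_le_1_minor:
  assumes E: "fdsub E" and r: "rk M E D \<le> 1" and x: "x \<in> E" "x' \<in> E" and y: "y \<in> D" "y' \<in> D"
  shows "b M x y * b M x' y' = b M x y' * b M x' y"
proof (cases "x \<in> rad M E D")
  case True
  then show ?thesis using y by (simp add: rad_def)
next
  case False
  then have "rk M E D \<noteq> 0" using rk_0_iff[OF E] x(1) by (auto simp: vanish_def rad_def)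
  then have d: "dim (rad M E D) + 1 = dim E" using r rk_rad[OF E, of M D] by linarith
  obtain h c where "h \<in> rad M E D" "x' = h + scale c x"
    by (rule hyperplane_decomp[OF E subspace_rad[OF fdsub_subspace[OF E]] rad_subset d x(1) False x(2)])
  then show ?thesis using y by (simp add: rad_def form_simps)
qed

lemma right_rad:
  assumes E: "fdsub E" and D: "fdsub D"
  shows "subspace {y \<in> D. \<forall>x\<in>E. b M x y = 0}" "dim {y \<in> D. \<forall>x\<in>E. b M x y = 0} + rk M E D = dim D"
proof -
  interpret fl: form_space scale "\<lambda>N x y. b N y x" by (rule flip_form_space)
  show "subspace {y \<in> D. \<forall>x\<in>E. b M x y = 0}"
    using fl.subspace_rad[OF fdsub_subspace[OF D], of M E] by (simp add: fl.rad_def)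
  show "dim {y \<in> D. \<forall>x\<in>E. b M x y = 0} + rk M E D = dim D"
    using fl.rk_rad[OF D, of M E] rk_flip[OF E D, of M] by (simp add: fl.rad_def)
qed

text \<open>Every member is compared with one \<open>M1\<close> of rank one, whose radicals are
  \<open>K\<close> and \<open>L\<close>. If \<open>M\<close> vanished neither on \<open>K\<close>
  times \<open>D\<close> nor on \<open>E\<close> times \<open>L\<close>, then at the point with
  parameter \<open>c\<close> on the line through \<open>M1\<close> and \<open>M\<close> some
  \<open>2 \<times> 2\<close> minor would be \<open>c * (1 - c)\<close> times a nonzero
  scalar.\<close>

lemma compressed_rank_one:
  assumes V: "fdsub V" and E: "fdsub E" and D: "fdsub D" and r: "\<And>M. M \<in> aff A V \<Longrightarrow> rk M E D \<le> 1"
    and pos: "1 \<le> dim E"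
  shows "compressed (aff A V) 1 E D"
proof -
  have sV: "subspace V" and sE: "subspace E" and sD: "subspace D" using V E D fdsub_subspace by auto
  show ?thesis
  proof (cases "\<forall>M\<in>aff A V. vanish M E D")
    case True
    \<comment> \<open>The count in \<open>compressed\<close> is an equality, so \<open>E\<close> is
      cut down to a hyperplane.\<close>
    have "{0} \<subseteq> E" using subspace_0[OF sE] by blast
    then obtain Z where "subspace Z" "{0} \<subseteq> Z" "Z \<subseteq> E" "dim Z = dim E - 1"
      by (rule subspace_between[OF E subspace_single_0, of "dim E - 1"]) (use fdsub_zero in auto)
    then show ?thesis unfolding compressed_def using True sD pos vanish_mono
      by (intro exI[of _ Z] exI[of _ D]) (auto simp: vanish_def)
  next
    case False
    then obtain M1 where M1: "M1 \<in> aff A V" "\<not> vanish M1 E D" by blast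
    then obtain x1 y1 where xy1: "x1 \<in> E" "y1 \<in> D" "b M1 x1 y1 \<noteq> 0" by (auto simp: vanish_def)
    have r1: "rk M1 E D = 1" using r[OF M1(1)] M1(2) rk_0_iff[OF E, of M1 D] by linarith
    define K where "K = rad M1 E D"
    define L where "L = {y \<in> D. \<forall>x\<in>E. b M1 x y = 0}"
    have un: "vanish M K D \<or> vanish M E L" if M: "M \<in> aff A V" for M
    proof (rule ccontr)
      assume "\<not> ?thesis"
      then obtain x y x' y' where xy: "x \<in> K" "y \<in> D" "b M x y \<noteq> 0" "x' \<in> E" "y' \<in> L" "b M x' y' \<noteq> 0"
        by (auto simp: vanish_def)
      have xE: "x \<in> E" "y' \<in> D" using xy by (auto simp: K_def L_def rad_def)
      obtain c :: 'a where c: "c \<noteq> 0" "c \<noteq> 1" using third_scalar by blast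
      let ?M = "M1 + scale c (M - M1)"
      have M3: "?M \<in> aff A V" using aff_translate[OF sV M1(1)] aff_diff[OF sV M1(1) M] sV subspace_scale by blast
      note minor = rk_le_1_minor[OF E r[OF M]]
      \<comment> \<open>The minor of \<open>M\<close> on \<open>x\<close>, \<open>x'\<close> and
        \<open>y\<close>, \<open>y'\<close> equates the nonzero product
        \<open>b M x y * b M x' y'\<close> with one that contains \<open>b M x y'\<close>.\<close>
      have nz: "b M x y' \<noteq> 0" using minor[OF xE(1) xy(4) xy(2) xE(2)] xy by auto
      have "b M1 x y' = 0" "b M1 x y1 = 0" "b M1 x1 y' = 0"
        using xy xE xy1 by (auto simp: K_def L_def rad_def)
      then have v: "b ?M x y' = c * b M x y'" "b ?M x y1 = c * b M x y1" "b ?M x1 y' = c * b M x1 y'"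
         "b ?M x1 y1 = (1 - c) * b M1 x1 y1 + c * b M x1 y1"
        by (simp_all add: form_simps algebra_simps)
      have "b ?M x y' * b ?M x1 y1 = b ?M x y1 * b ?M x1 y'"
        by (rule rk_le_1_minor[OF E r[OF M3] xE(1) xy1(1) xE(2) xy1(2)])
      then have "c * b M x y' * ((1 - c) * b M1 x1 y1) + c * c * (b M x y' * b M x1 y1) = c * c * (b M x y1 * b M x1 y')"
        unfolding v by (simp add: algebra_simps)
      moreover have "b M x y' * b M x1 y1 = b M x y1 * b M x1 y'"
        by (rule minor[OF xE(1) xy1(1) xE(2) xy1(2)])
      ultimately have "c * b M x y' * ((1 - c) * b M1 x1 y1) = 0" by simp
      then show False using c nz xy1 by simp
    qed
    have "(\<forall>M\<in>aff A V. vanish M K D) \<or> (\<forall>M\<in>aff A V. vanish M E L)" by (rule aff_union[OF sV un])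
    then show ?thesis
    proof
      assume "\<forall>M\<in>aff A V. vanish M K D"
      moreover have "subspace K" "K \<subseteq> E" "dim K + 1 = dim E"
        using subspace_rad[OF sE] rad_subset rk_rad[OF E, of M1 D] r1 by (auto simp: K_def)
      ultimately show ?thesis unfolding compressed_def using sD by (intro exI[of _ K] exI[of _ D]) auto
    next
      assume "\<forall>M\<in>aff A V. vanish M E L"
      moreover have "subspace L" "L \<subseteq> D" "dim L + 1 = dim D"
        using right_rad[OF E D, of M1] r1 by (auto simp: L_def)
      ultimately show ?thesis unfolding compressed_def using sE by (intro exI[of _ E] exI[of _ L]) auto
    qed
  qed
qed

text \<open>When \<open>H\<close> is a hyperplane of \<open>D\<close>, the members of
  \<open>V\<close> that vanish on \<open>E\<close> times \<open>H\<close> have rank at most one on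
  \<open>E\<close> times \<open>D\<close>; this is their common radical.\<close>

definition crad :: "'b set \<Rightarrow> 'b set \<Rightarrow> 'b set \<Rightarrow> 'b set \<Rightarrow> 'b set" where
  "crad V E D H = {x \<in> E. \<forall>N\<in>ann V E H. \<forall>y\<in>D. b N x y = 0}"

lemma hyperplane_vanish:
  assumes D: "fdsub D" and H: "subspace H" "H \<subseteq> D" "dim H + 1 = dim D" and y: "y \<in> D" "y \<notin> H"
    and N: "\<And>z. z \<in> H \<Longrightarrow> b N x z = 0" "b N x y = 0" and z: "z \<in> D"
  shows "b N x z = 0"
  by (rule hyperplane_decomp[OF D H y z]) (use N in \<open>auto simp: form_simps\<close>)

lemma crad_eq:
  assumes D: "fdsub D" and H: "subspace H" "H \<subseteq> D" "dim H + 1 = dim D" and y: "y \<in> D" "y \<notin> H"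
  shows "crad V E D H = {x \<in> E. \<forall>N\<in>ann V E H. b N x y = 0}"
proof safe
  fix x assume x: "x \<in> E" "\<forall>N\<in>ann V E H. b N x y = 0"
  have "b N x z = 0" if "N \<in> ann V E H" "z \<in> D" for N z
    by (rule hyperplane_vanish[OF D H y _ _ that(2)]) (use x that in \<open>auto simp: ann_def vanish_def\<close>)
  then show "x \<in> crad V E D H" using x by (auto simp: crad_def)
qed (use y in \<open>auto simp: crad_def\<close>)

lemma subspace_crad: "subspace E \<Longrightarrow> subspace (crad V E D H)"
  by (auto simp: crad_def subspace_def form_simps)

text \<open>Evaluation at a vector \<open>y\<close> outside \<open>H\<close> pairs these forms with
  \<open>E\<close>. One radical of the pairing consists of the forms vanishing on \<open>E\<close>
  times \<open>D\<close>, the other is \<open>crad\<close>; hence the codimension of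
  \<open>crad\<close> equals the drop in dimension.\<close>

lemma dim_crad:
  assumes V: "fdsub V" and E: "fdsub E" and D: "fdsub D" and H: "subspace H" "H \<subseteq> D" "dim H + 1 = dim D"
  shows "dim (crad V E D H) + rd V E D = dim E + rd V E H"
proof -
  have "H \<noteq> D" using H by auto
  then obtain y where y: "y \<in> D" "y \<notin> H" using H by blast
  have "dim (ann V E H) + dim {x \<in> E. \<forall>N\<in>ann V E H. b N x y = 0} = dim E + dim {N \<in> ann V E H. \<forall>x\<in>E. b N x y = 0}"
    by (rule dim_pairing[OF fdsub_ann[OF V] E]) (auto simp: lin_form lin_left)
  moreover have e: "{N \<in> ann V E H. \<forall>x\<in>E. b N x y = 0} = ann V E D"
  proof safe
    fix N assume N: "N \<in> ann V E H" "\<forall>x\<in>E. b N x y = 0"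
    have "b N x z = 0" if "x \<in> E" "z \<in> D" for x z
      by (rule hyperplane_vanish[OF D H y _ _ that(2)]) (use N that in \<open>auto simp: ann_def vanish_def\<close>)
    then show "N \<in> ann V E D" using N by (auto simp: ann_def vanish_def)
  qed (use y H in \<open>auto simp: ann_def vanish_def\<close>)
  ultimately show ?thesis unfolding crad_eq[OF D H y] e
    using rd_ann[OF V, of E H] rd_ann[OF V, of E D] by linarith
qed

text \<open>Adding to a form of maximal rank a rank-one form that vanishes on \<open>E \<times> H\<close> cannot increase the rank, so its
  radical is the common radical of these rank-one forms. Two forms of maximal rank are compared through
  a hyperplane \<open>H\<close> suitable for both.\<close>

lemma compressed_of_large_drops:
  assumes V: "fdsub V" and E: "fdsub E" and D: "fdsub D" and r: "r < dim D"
    and rk: "\<And>M. M \<in> aff A V \<Longrightarrow> rk M E D \<le> r"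
    and drop: "\<And>H. subspace H \<Longrightarrow> H \<subseteq> D \<Longrightarrow> dim H + 1 = dim D \<Longrightarrow> rd V E H + r \<le> rd V E D"
  shows "compressed (aff A V) r E D"
proof -
  have sV: "subspace V" and sE: "subspace E" and sD: "subspace D" using V E D fdsub_subspace by auto
  define Y where "Y M = {y \<in> D. \<forall>x\<in>E. b M x y = 0}" for M
  \<comment> \<open>Maximality is required only under adding forms that vanish on \<open>E\<close>
    times \<open>H\<close>, so this serves both for the global maximum \<open>M0\<close> and for the
    maximum \<open>M3\<close> of a subfamily. The drop bounds \<open>crad\<close> from above and the
    rank bounds the radical from below by the same number, which makes the inclusion an
    equality.\<close>
  have ker: "rad M E D = crad V E D H \<and> dim (rad M E D) + r = dim E"
    if M: "M \<in> aff A V" and H: "subspace H" "H \<subseteq> D" "dim H + 1 = dim D" and y: "y \<in> Y M" "y \<notin> H"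
      and mx: "\<And>N. N \<in> ann V E H \<Longrightarrow> rk (M + N) E D \<le> rk M E D" for M H y
  proof -
    have sub: "rad M E D \<subseteq> crad V E D H"
    proof
      fix x assume x: "x \<in> rad M E D"
      have "b N x y = 0" if N: "N \<in> ann V E H" for N
      proof (rule ccontr)
        assume nz: "b N x y \<noteq> 0"
        have "rk M E D < rk (M + N) E D"
          by (rule rk_add_rank_one[OF E D H _ _ _ x nz]) (use N y in \<open>auto simp: ann_def Y_def\<close>)
        then show False using mx[OF N] by simp
      qed
      then show "x \<in> crad V E D H"
        using x y by (subst crad_eq[OF D H, of y]) (auto simp: Y_def rad_def)
    qed
    have "dim (crad V E D H) + r \<le> dim E" using dim_crad[OF V E D H] drop[OF H] by linarith
    moreover have "dim E \<le> dim (rad M E D) + r" using rk[OF M] rk_rad[OF E, of M D] by linarith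
    moreover have fc: "fdsub (crad V E D H)" by (rule fdsub_subset[OF E subspace_crad[OF sE]]) (auto simp: crad_def)
    ultimately show ?thesis
      using fdsub_dim_eq[OF fc subspace_rad[OF sE] sub] fdsub_dim_mono[OF fc subspace_rad[OF sE] sub] by linarith
  qed
  have Yex: "\<exists>y. y \<in> Y M \<and> y \<noteq> 0" if M: "M \<in> aff A V" for M
  proof -
    have "fdsub (Y M)" unfolding Y_def by (rule fdsub_subset[OF D right_rad(1)[OF E D]]) auto
    moreover have "0 < dim (Y M)" using right_rad(2)[OF E D, of M] rk[OF M] r unfolding Y_def by linarith
    ultimately show ?thesis using exists_nonzero by metis
  qed
  have "\<exists>M0. M0 \<in> aff A V \<and> (\<forall>M. M \<in> aff A V \<longrightarrow> rk M E D \<le> rk M0 E D)"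
    by (rule ex_has_greatest_nat[of _ A _ "r + 1"]) (use aff_base[OF sV] rk in \<open>auto simp: less_Suc_eq_le\<close>)
  then obtain M0 where M0: "M0 \<in> aff A V" "\<And>M. M \<in> aff A V \<Longrightarrow> rk M E D \<le> rk M0 E D" by blast
  obtain y0 where y0: "y0 \<in> Y M0" "y0 \<noteq> 0" using Yex[OF M0(1)] by blast
  define F where "F = rad M0 E D"
  have van: "vanish M F D" if M: "M \<in> aff A V" for M
  proof -
    \<comment> \<open>\<open>M\<close> is changed only by forms vanishing on \<open>F\<close> times
      \<open>D\<close>, so that vanishing of the maximiser \<open>M3\<close> carries back to
      \<open>M\<close>.\<close>
    let ?P = "\<lambda>L. \<exists>N. N \<in> ann V F D \<and> L = M + N"
    have P: "L \<in> aff A V" if "?P L" for L using that aff_translate[OF sV M] by (auto simp: ann_def)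
    have "?P M" using subspace_0[OF subspace_ann[OF sV]] by (intro exI[of _ 0]) auto
    then have "\<exists>M3. ?P M3 \<and> (\<forall>L. ?P L \<longrightarrow> rk L E D \<le> rk M3 E D)"
      by (rule ex_has_greatest_nat[of ?P M "\<lambda>L. rk L E D" "r + 1"]) (use P rk in \<open>blast intro: le_less_trans less_add_one\<close>)
    then obtain M3 where M3: "?P M3" "\<And>L. ?P L \<Longrightarrow> rk L E D \<le> rk M3 E D" by blast
    have M3a: "M3 \<in> aff A V" using P[OF M3(1)] .
    obtain y3 where y3: "y3 \<in> Y M3" "y3 \<noteq> 0" using Yex[OF M3a] by blast
    have "y0 \<in> D" "y3 \<in> D" using y0 y3 by (auto simp: Y_def)
    then obtain H where H: "subspace H" "H \<subseteq> D" "y0 \<notin> H" "y3 \<notin> H" "dim H + 1 = dim D"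
      using hyperplane_avoiding_two[OF D _ y0(2) _ y3(2)] by metis
    have "rad M0 E D = crad V E D H \<and> dim (rad M0 E D) + r = dim E"
      by (rule ker[OF M0(1) H(1,2,5) y0(1) H(3)]) (use M0(2) aff_translate[OF sV M0(1)] in \<open>auto simp: ann_def\<close>)
    then have F: "F = crad V E D H" by (simp add: F_def)
    have vF: "N \<in> ann V F D" if "N \<in> ann V E H" for N
      using that unfolding F by (auto simp: ann_def crad_def vanish_def)
    have "rad M3 E D = crad V E D H \<and> dim (rad M3 E D) + r = dim E"
    proof (rule ker[OF M3a H(1,2,5) y3(1) H(4)])
      fix N assume "N \<in> ann V E H"
      then have N: "N \<in> ann V F D" by (rule vF)
      obtain N' where N': "N' \<in> ann V F D" "M3 = M + N'" using M3(1) by blast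
      have "N' + N \<in> ann V F D" using N N' subspace_add[OF subspace_ann[OF sV]] by blast
      then have "?P (M3 + N)" using N'(2) by (intro exI[of _ "N' + N"]) (simp add: add.assoc)
      then show "rk (M3 + N) E D \<le> rk M3 E D" by (rule M3(2))
    qed
    then have "vanish M3 F D" unfolding F by (auto simp: rad_def vanish_def)
    moreover obtain N' where "N' \<in> ann V F D" "M3 = M + N'" using M3(1) by blast
    ultimately show ?thesis using vanish_diff[of M3 F D N'] by (auto simp: ann_def)
  qed
  have "\<exists>H. subspace H \<and> H \<subseteq> D \<and> y0 \<notin> H \<and> dim H + 1 = dim D"
  proof -
    have "y0 \<in> D" using y0 by (auto simp: Y_def)
    then show ?thesis using hyperplane_avoiding_two[OF D _ y0(2) _ y0(2)] by metis
  qed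
  then obtain H where H: "subspace H" "H \<subseteq> D" "dim H + 1 = dim D" "y0 \<notin> H" by blast
  have "rad M0 E D = crad V E D H \<and> dim (rad M0 E D) + r = dim E"
    by (rule ker[OF M0(1) H(1-3) y0(1) H(4)]) (use M0(2) aff_translate[OF sV M0(1)] in \<open>auto simp: ann_def\<close>)
  then have "subspace F" "F \<subseteq> E" "dim F + r = dim E" using subspace_rad[OF sE] rad_subset unfolding F_def by blast+
  then show ?thesis unfolding compressed_def using van sD by (intro exI[of _ F] exI[of _ D]) auto
qed

section \<open>The case of a rectangle of total size one too small\<close>

text \<open>By \<open>compressed_rank_one\<close> the family vanishes on a rectangle, hence so do
  its directions, and a direction that is nonzero on this square has rank exactly one there.
  \<open>K\<close> and \<open>L\<close> are its radicals; the last clause is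
  \<open>rk_extract\<close>.\<close>

lemma rank_one_direction:
  assumes W: "fdsub W" and P: "fdsub P" "dim P = 2" and R: "fdsub R" "dim R = 2"
    and pos: "rd W P R \<noteq> 0" and r: "\<And>L. L \<in> aff M W \<Longrightarrow> rk L P R \<le> 1"
  obtains N K L where "N \<in> W" "\<not> vanish N P R" "subspace K" "K \<subseteq> P" "dim K = 1" "subspace L" "L \<subseteq> R" "dim L = 1"
    "vanish N K R" "vanish N P L" "\<forall>M'. rk M' P R \<le> 1 \<longrightarrow> rk (M' + N) P R \<le> 1 \<longrightarrow> vanish M' K L"
proof -
  have sW: "subspace W" and sP: "subspace P" using W P fdsub_subspace by auto
  have "compressed (aff M W) 1 P R" by (rule compressed_rank_one[OF W P(1) R(1) r]) (use P in auto)
  then obtain F Y where FY: "subspace F" "F \<subseteq> P" "subspace Y" "Y \<subseteq> R" "dim F + dim Y + 1 = dim P + dim R"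
    "\<forall>L\<in>aff M W. vanish L F Y" unfolding compressed_def by blast
  have "ann W P R \<noteq> W" using pos by (auto simp: rd_def)
  then obtain N where N: "N \<in> W" "\<not> vanish N P R" by (auto simp: ann_def)
  have "vanish N F Y" by (rule vanish_aff_direction[OF sW _ N(1)]) (use FY(6) in blast)
  then have "rk N P R \<le> 1" using rk_le_vanish[OF P(1) R(1) FY(1-4), of N] FY(5) by linarith
  then have r1: "rk N P R = 1" using N(2) rk_0_iff[OF P(1), of N R] by linarith
  define K where "K = rad N P R"
  define L where "L = {y \<in> R. \<forall>x\<in>P. b N x y = 0}"
  have K: "subspace K" "K \<subseteq> P" "dim K + 1 = dim P" "vanish N K R"
    using subspace_rad[OF sP] rk_rad[OF P(1), of N R] r1 by (auto simp: K_def rad_def vanish_def)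
  have L: "subspace L" "L \<subseteq> R" "dim L = 1" "vanish N P L"
    using right_rad[OF P(1) R(1), of N] r1 R(2) by (auto simp: L_def vanish_def)
  have "vanish M' K L" if "rk M' P R \<le> 1" "rk (M' + N) P R \<le> 1" for M'
  proof -
    have "rk M' K L < 1" by (rule rk_extract[OF P(1) R(1) K(1-3) L(1,2) K(4) L(4) N(2) that])
    then show ?thesis using rk_0_iff[OF fdsub_subset[OF P(1) K(1,2)]] by simp
  qed
  then show ?thesis using that[OF N K(1,2) _ L(1-3) K(4) L(4)] K(3) P(2) by auto
qed

text \<open>The direction \<open>N2\<close> is invisible on the first square and \<open>N1\<close>
  on the second. If \<open>M\<close> or \<open>M + N2\<close> is nonsingular on the second square,
  then \<open>M\<close> vanishes on \<open>K1\<close> times \<open>L1\<close>; otherwise it vanishes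
  on \<open>K2\<close> times \<open>L2\<close>. One alternative must hold throughout the family,
  although each square carries all \<open>4\<close> dimensions.\<close>

lemma double_square_clash:
  assumes V: "fdsub V"
    and P1: "fdsub P1" "dim P1 = 2" and R1: "fdsub R1" "dim R1 = 2"
    and P2: "fdsub P2" "dim P2 = 2" and R2: "fdsub R2" "dim R2 = 2"
    and sing: "\<And>M. M \<in> aff A V \<Longrightarrow> rk M P1 R1 \<le> 1 \<or> rk M P2 R2 \<le> 1"
    and M1: "M1 \<in> aff A V" "\<not> rk M1 P1 R1 \<le> 1" and M2: "M2 \<in> aff A V" "\<not> rk M2 P2 R2 \<le> 1"
    and pos: "rd (ann V P1 R1) P2 R2 \<noteq> 0" "rd (ann V P2 R2) P1 R1 \<noteq> 0"
    and full: "rd V P1 R1 = 4" "rd V P2 R2 = 4"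
  shows False
proof -
  have sV: "subspace V" using V fdsub_subspace by blast
  have r2: "rk L P2 R2 \<le> 1" if "M \<in> aff A V" "\<not> rk M P1 R1 \<le> 1" "L \<in> aff M (ann V P1 R1)" for M L
  proof -
    have "rk L P1 R1 = rk M P1 R1" using that(3) rk_add_vanish by (auto simp: aff_def ann_def)
    moreover have "L \<in> aff A V" using aff_subset[OF sV that(1) ann_subset] that(3) by blast
    ultimately show ?thesis using sing that(2) by fastforce
  qed
  have r1: "rk L P1 R1 \<le> 1" if "M \<in> aff A V" "\<not> rk M P2 R2 \<le> 1" "L \<in> aff M (ann V P2 R2)" for M L
  proof -
    have "rk L P2 R2 = rk M P2 R2" using that(3) rk_add_vanish by (auto simp: aff_def ann_def)
    moreover have "L \<in> aff A V" using aff_subset[OF sV that(1) ann_subset] that(3) by blast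
    ultimately show ?thesis using sing that(2) by fastforce
  qed
  obtain N2 K2 L2 where 2: "N2 \<in> ann V P1 R1" "\<not> vanish N2 P2 R2" "subspace K2" "K2 \<subseteq> P2" "dim K2 = 1" "subspace L2" "L2 \<subseteq> R2" "dim L2 = 1"
    "vanish N2 K2 R2" "vanish N2 P2 L2" "\<forall>M'. rk M' P2 R2 \<le> 1 \<longrightarrow> rk (M' + N2) P2 R2 \<le> 1 \<longrightarrow> vanish M' K2 L2"
    by (rule rank_one_direction[OF fdsub_ann[OF V] P2 R2 pos(1) r2[OF M1]])
  obtain N1 K1 L1 where 1: "N1 \<in> ann V P2 R2" "\<not> vanish N1 P1 R1" "subspace K1" "K1 \<subseteq> P1" "dim K1 = 1" "subspace L1" "L1 \<subseteq> R1" "dim L1 = 1"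
    "vanish N1 K1 R1" "vanish N1 P1 L1" "\<forall>M'. rk M' P1 R1 \<le> 1 \<longrightarrow> rk (M' + N1) P1 R1 \<le> 1 \<longrightarrow> vanish M' K1 L1"
    by (rule rank_one_direction[OF fdsub_ann[OF V] P1 R1 pos(2) r1[OF M2]])
  have v1: "vanish M K1 L1" if M: "M \<in> aff A V" "\<not> rk M P2 R2 \<le> 1" for M
  proof (rule 1(11)[rule_format])
    have s: "subspace (ann V P2 R2)" by (rule subspace_ann[OF sV])
    show "rk M P1 R1 \<le> 1" by (rule r1[OF M aff_base[OF s]])
    show "rk (M + N1) P1 R1 \<le> 1" by (rule r1[OF M aff_translate[OF s aff_base[OF s] 1(1)]])
  qed
  have "vanish M K2 L2 \<or> vanish M K1 L1" if M: "M \<in> aff A V" for M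
  proof (cases "rk M P2 R2 \<le> 1 \<and> rk (M + N2) P2 R2 \<le> 1")
    case True
    then show ?thesis using 2(11) by blast
  next
    case False
    have N: "N2 \<in> V" "vanish N2 K1 L1" using 2(1) 1(4,7) by (auto simp: ann_def vanish_def)
    have "vanish M K1 L1 \<or> vanish (M + N2) K1 L1"
      using v1 M aff_translate[OF sV M N(1)] False by blast
    then show ?thesis using N(2) vanish_diff[of "M + N2" K1 L1 N2] by auto
  qed
  then have "(\<forall>M\<in>aff A V. vanish M K2 L2) \<or> (\<forall>M\<in>aff A V. vanish M K1 L1)" by (rule aff_union[OF sV])
  then show False
  proof
    assume a: "\<forall>M\<in>aff A V. vanish M K2 L2"
    have "vanish N K2 L2" if "N \<in> V" for N
      by (rule vanish_aff_direction[OF sV _ that]) (use a in blast)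
    then show False using rd_vanish[OF V P2(1) R2(1) 2(3,4,6,7)] 2(5,8) P2(2) R2(2) full(2) by simp
  next
    assume a: "\<forall>M\<in>aff A V. vanish M K1 L1"
    have "vanish N K1 L1" if "N \<in> V" for N
      by (rule vanish_aff_direction[OF sV _ that]) (use a in blast)
    then show False using rd_vanish[OF V P1(1) R1(1) 1(3,4,6,7)] 1(5,8) P1(2) R1(2) full(1) by simp
  qed
qed

lemma span_insert_hyperplane:
  assumes W: "fdsub W" and H: "subspace H" "H \<subseteq> W" "dim H + 1 = dim W" and y: "y \<in> W" "y \<notin> H" and S: "span S = H"
  shows "span (insert y S) = W"
proof
  show "span (insert y S) \<subseteq> W"
    using y(1) S H(2) span_superset[of S] by (intro span_minimal fdsub_subspace[OF W]) blast
  show "W \<subseteq> span (insert y S)"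
  proof
    fix w assume w: "w \<in> W"
    obtain h c where h: "h \<in> H" "w = h + scale c y" by (rule hyperplane_decomp[OF W H y w])
    have "h \<in> span (insert y S)" using h(1) S span_mono[of S "insert y S"] by blast
    moreover have "scale c y \<in> span (insert y S)" by (intro span_scale span_base) simp
    ultimately show "w \<in> span (insert y S)" unfolding h(2) by (rule span_add)
  qed
qed

lemma line_span:
  assumes "fdsub L" "dim L = 1" "x \<in> L" "x \<noteq> 0"
  shows "span {x} = L"
proof (rule fdsub_dim_eq[OF assms(1)])
  show "span {x} \<subseteq> L" using assms by (intro span_minimal fdsub_subspace) auto
qed (use assms dim_span_singleton in auto)

end

section \<open>Three scalars and the triangular pattern of size three\<close>

lemma three_element_field:
  fixes u v :: "'a :: field"
  assumes "UNIV = {0, u, v}" "u \<noteq> 0" "v \<noteq> 0" "u \<noteq> v"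
  shows "v = - u" "u * u = 1" "u + u = v" "(1 :: 'a) + 1 = - 1"
proof -
  have U: "x = 0 \<or> x = u \<or> x = v" for x using assms(1) by blast
  show vu: "v = - u"
  proof (rule ccontr)
    assume n: "v \<noteq> - u"
    then have "- u = u" using U[of "- u"] assms by auto
    then have uu: "u + u = 0" by (metis add.left_inverse)
    have "u + v = 0 \<or> u + v = u \<or> u + v = v" by (rule U)
    then show False using assms n by (auto simp: add_eq_0_iff)
  qed
  show u2: "u + u = v"
  proof -
    have "u + u = 0 \<or> u + u = u \<or> u + u = v" by (rule U)
    moreover have "u + u \<noteq> 0" using assms(4) vu by (metis minus_unique)
    moreover have "u + u \<noteq> u" using assms(2) by (metis add_cancel_left_left)
    ultimately show ?thesis by blast
  qed
  show "u * u = 1"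
  proof -
    have "(1 :: 'a) = u \<or> (1 :: 'a) = v" using U[of 1] by simp
    then show ?thesis using vu by (metis minus_mult_minus mult_1)
  qed
  have "(1 :: 'a) = u \<or> (1 :: 'a) = v" using U[of 1] by simp
  then show "(1 :: 'a) + 1 = - 1"
  proof
    assume 1: "(1 :: 'a) = u"
    have "u + u = - u" using u2 vu by simp
    then show ?thesis using 1 by metis
  next
    assume 1: "(1 :: 'a) = v"
    have "v + v = - (u + u)" using vu by simp
    then have "v + v = - v" using u2 by simp
    then show ?thesis using 1 by metis
  qed
qed

text \<open>An affine function that is nonzero at \<open>0\<close> has at most one root, and the
  roots of the two functions exhaust the nonzero scalars. As there is a scalar other than
  \<open>0\<close> and \<open>1\<close>, exactly two nonzero scalars exist; the roots are
  \<open>- \<sigma>\<close> and \<open>\<sigma>\<close>.\<close>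

lemma affine_functions_three:
  fixes B0 B1 C0 C1 :: "'a :: field"
  assumes c: "c \<noteq> 0" "c \<noteq> (1 :: 'a)" and nz: "B0 \<noteq> 0" "C0 \<noteq> 0"
    and pr: "\<And>\<tau>. \<tau> \<noteq> 0 \<Longrightarrow> (B0 + \<tau> * B1) * (C0 + \<tau> * C1) = 0"
  obtains \<sigma> where "card (UNIV :: 'a set) = 3" "\<sigma> * \<sigma> = 1" "(1 :: 'a) + 1 = - 1" "B1 \<noteq> 0" "C1 \<noteq> 0"
    "B0 = \<sigma> * B1" "C0 = - \<sigma> * C1"
proof -
  have const: "B1' \<noteq> 0" if "B0' \<noteq> 0" "C0' \<noteq> 0" "\<And>\<tau>. \<tau> \<noteq> 0 \<Longrightarrow> (B0' + \<tau> * B1') * (C0' + \<tau> * C1') = 0" for B0' B1' C0' C1' :: 'a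
  proof
    assume "B1' = 0"
    then have z: "C0' + \<tau> * C1' = 0" if "\<tau> \<noteq> 0" for \<tau> using \<open>\<And>\<tau>. \<tau> \<noteq> 0 \<Longrightarrow> (B0' + \<tau> * B1') * (C0' + \<tau> * C1') = 0\<close>[OF that] \<open>B0' \<noteq> 0\<close> by simp
    have "C0' + C1' = 0" "C0' + c * C1' = 0" using z[of 1] z[of c] c by auto
    then have "C0' = - C1'" "C0' + c * C1' = 0" by (simp_all add: eq_neg_iff_add_eq_0)
    then have "(c - 1) * C1' = 0" by (simp add: algebra_simps)
    then have "C1' = 0" using c by simp
    then show False using z[of 1] \<open>C0' \<noteq> 0\<close> by simp
  qed
  have B1: "B1 \<noteq> 0" using const[OF nz pr] .
  have C1: "C1 \<noteq> 0" using const[OF nz(2,1), of C1 B1] pr by (simp add: mult.commute)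
  define u v where "u = - B0 / B1" and "v = - C0 / C1"
  have u: "u \<noteq> 0" and v: "v \<noteq> 0" using nz B1 C1 by (auto simp: u_def v_def)
  have "\<tau> = 0 \<or> \<tau> = u \<or> \<tau> = v" for \<tau>
  proof (cases "\<tau> = 0")
    case False
    then have "B0 + \<tau> * B1 = 0 \<or> C0 + \<tau> * C1 = 0" using pr by simp
    then have "\<tau> * B1 = - B0 \<or> \<tau> * C1 = - C0" by (metis add.commute eq_neg_iff_add_eq_0)
    then show ?thesis using nonzero_eq_divide_eq[OF B1, of \<tau> "- B0"] nonzero_eq_divide_eq[OF C1, of \<tau> "- C0"]
      unfolding u_def v_def by blast
  qed simp
  then have U: "UNIV = {0, u, v}" by blast
  have uv: "u \<noteq> v"
  proof
    assume "u = v"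
    then have "x = 0 \<or> x = u" for x using U by blast
    from this[of c] this[of 1] have "c = u" "1 = u" using c(1) by auto
    then show False using c by simp
  qed
  have "card (UNIV :: 'a set) = 3" unfolding U using u v uv by simp
  moreover note t = three_element_field[OF U u v uv]
  moreover have "(- u) * (- u) = 1" using t(2) by simp
  moreover have "B0 = (- u) * B1" using B1 by (simp add: u_def)
  moreover have "C0 = (- v) * C1" using C1 by (simp add: v_def)
  then have "C0 = - (- u) * C1" using t(1) by simp
  ultimately show ?thesis using that[of "- u"] B1 C1 by blast
qed

context form_space
begin

text \<open>Once the entry \<open>b M x1 y1\<close> is fixed, the block on \<open>F\<close> times
  \<open>D1\<close> varies in one direction only, and that direction has rank one; this produces a
  zero corner \<open>K\<close> times \<open>L\<close>. The family is then triangular, the diagonal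
  entries \<open>B\<close> and \<open>C\<close> are affine functions of the third one, and the
  product of all three vanishes identically.\<close>

lemma triangular_case:
  assumes V: "fdsub V" and E: "fdsub E" "dim E = 3" and D: "fdsub D" "dim D = 3"
    and F: "subspace F" "F \<subseteq> E" "dim F = 2" and E1: "subspace E1" "E1 \<subseteq> E" "dim E1 = 1" "F \<inter> E1 = {0}"
    and Y: "subspace Y" "Y \<subseteq> D" "dim Y = 1" and D1: "subspace D1" "D1 \<subseteq> D" "dim D1 = 2" "Y \<inter> D1 = {0}"
    and v: "\<And>M. M \<in> aff A V \<Longrightarrow> vanish M F Y"
    and sing: "\<And>M. M \<in> aff A V \<Longrightarrow> rk M F D1 \<le> 1 \<or> vanish M E1 Y"
    and M1: "M1 \<in> aff A V" "\<not> rk M1 F D1 \<le> 1" and M2: "M2 \<in> aff A V" "\<not> vanish M2 E1 Y"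
    and rd: "rd V F D1 = 2" "rd (ann V F D1) E1 Y = 0" "rd V E D = 4"
  shows "compressed (aff A V) 2 E D \<or> exceptional A V 2 E D"
proof -
  have sV: "subspace V" and sE: "subspace E" and sD: "subspace D" using V E D fdsub_subspace by auto
  have fF: "fdsub F" and fE1: "fdsub E1" using fdsub_subset[OF E(1)] F E1 by auto
  have fY: "fdsub Y" and fD1: "fdsub D1" using fdsub_subset[OF D(1)] Y D1 by auto
  have "dim E1 > 0" "dim Y > 0" using E1 Y by auto
  then obtain x1 y1 where x1: "x1 \<in> E1" "x1 \<noteq> 0" and y1: "y1 \<in> Y" "y1 \<noteq> 0"
    using exists_nonzero[OF fE1] exists_nonzero[OF fY] by metis
  have sx1: "span {x1} = E1" using line_span[OF fE1 E1(3) x1] .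
  have sy1: "span {y1} = Y" using line_span[OF fY Y(3) y1] .
  have vB: "vanish N E1 Y \<longleftrightarrow> b N x1 y1 = 0" for N
    using vanish_span[of N "{x1}" "{y1}"] x1 y1 sx1 sy1 by (auto simp: vanish_def)
  define V0 where "V0 = {N \<in> V. b N x1 y1 = 0}"
  have sV0: "subspace V0" unfolding V0_def by (rule lin_on_kernel[OF sV lin_form])
  have V0V: "V0 \<subseteq> V" by (auto simp: V0_def)
  have fV0: "fdsub V0" by (rule fdsub_subset[OF V sV0 V0V])
  let ?W = "ann V F D1"
  have bM1: "b M1 x1 y1 = 0" using sing[OF M1(1)] M1(2) vB by blast
  have bM2: "b M2 x1 y1 \<noteq> 0" using M2(2) vB by blast
  \<comment> \<open>Since \<open>rd (ann V F D1) E1 Y = 0\<close>, a direction that is invisible on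
    the square block does not change the last diagonal entry either.\<close>
  have W0: "?W \<subseteq> V0"
  proof
    fix N assume N: "N \<in> ?W"
    have "dim (ann ?W E1 Y) = dim ?W" using rd(2) rd_ann[OF fdsub_ann[OF V], of F D1 E1 Y] by simp
    then have "ann ?W E1 Y = ?W"
      using fdsub_dim_eq[OF fdsub_ann[OF V] subspace_ann[OF subspace_ann[OF sV]] ann_subset] by simp
    then have "vanish N E1 Y" using N by (auto simp: ann_def)
    then show "N \<in> V0" using N vB by (auto simp: V0_def ann_def)
  qed
  have aV0: "ann V0 F D1 = ?W" using W0 V0V by (auto simp: ann_def)
  have dV0: "dim V0 + 1 = dim V"
  proof -
    have "dim V \<le> dim V0 + 1" unfolding V0_def by (rule dim_kernel_functional[OF V lin_form])
    moreover have "M2 - M1 \<in> V" "M2 - M1 \<notin> V0"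
      using aff_diff[OF sV M1(1) M2(1)] bM1 bM2 by (auto simp: V0_def form_simps)
    then have "\<not> dim V \<le> dim V0" using fdsub_dim_eq[OF V sV0 V0V] by blast
    ultimately show ?thesis by linarith
  qed
  have rd0: "rd V0 F D1 = 1" using rd_ann[OF fV0, of F D1] rd_ann[OF V, of F D1] rd(1) dV0 unfolding aV0 by linarith
  have r0: "rk L F D1 \<le> 1" if M: "M \<in> aff A V" "b M x1 y1 \<noteq> 0" and L: "L \<in> aff M V0" for M L
  proof -
    have "b L x1 y1 \<noteq> 0" using L M(2) by (auto simp: aff_def V0_def form_simps)
    moreover have "L \<in> aff A V" using aff_subset[OF sV M(1) V0V] L by blast
    ultimately show ?thesis using sing vB by blast
  qed
  have "rd V0 F D1 \<noteq> 0" using rd0 by simp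
  then obtain N0 K L where N0: "N0 \<in> V0" "\<not> vanish N0 F D1" "subspace K" "K \<subseteq> F" "dim K = 1" "subspace L" "L \<subseteq> D1" "dim L = 1"
    "vanish N0 K D1" "vanish N0 F L" "\<forall>M'. rk M' F D1 \<le> 1 \<longrightarrow> rk (M' + N0) F D1 \<le> 1 \<longrightarrow> vanish M' K L"
    by (rule rank_one_direction[OF fV0 fF F(3) fD1 D1(3) _ r0[OF M2(1) bM2]])
  have "vanish M {x1} {y1} \<or> vanish M K L" if M: "M \<in> aff A V" for M
  proof (cases "b M x1 y1 = 0")
    case False
    have "vanish M K L"
      by (rule N0(11)[rule_format, OF r0[OF M False aff_base[OF sV0]] r0[OF M False aff_translate[OF sV0 aff_base[OF sV0] N0(1)]]])
    then show ?thesis by blast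
  qed (simp add: vanish_def)
  then have "(\<forall>M\<in>aff A V. vanish M {x1} {y1}) \<or> (\<forall>M\<in>aff A V. vanish M K L)" by (rule aff_union[OF sV])
  then have vKL: "vanish M K L" if "M \<in> aff A V" for M using M2(1) bM2 that by (auto simp: vanish_def)
  have fK: "fdsub K" and fL: "fdsub L" using fdsub_subset[OF fF N0(3,4)] fdsub_subset[OF fD1 N0(6,7)] by auto
  obtain x0 where x0: "x0 \<in> K" "x0 \<noteq> 0" using exists_nonzero[OF fK] N0(5) by auto
  obtain y0 where y0: "y0 \<in> L" "y0 \<noteq> 0" using exists_nonzero[OF fL] N0(8) by auto
  have "K \<noteq> F" "L \<noteq> D1" using N0(5,8) F(3) D1(3) by auto
  then obtain x' y' where x': "x' \<in> F" "x' \<notin> K" and y': "y' \<in> D1" "y' \<notin> L" using N0(4,7) by blast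
  have sK: "span {x0} = K" using line_span[OF fK N0(5) x0] .
  have sL: "span {y0} = L" using line_span[OF fL N0(8) y0] .
  have dK: "dim K + 1 = dim F" "dim L + 1 = dim D1" using N0(5,8) F(3) D1(3) by auto
  have sF: "span {x', x0} = F" using span_insert_hyperplane[OF fF N0(3,4) dK(1) x' sK] .
  have sD1: "span {y', y0} = D1" using span_insert_hyperplane[OF fD1 N0(6,7) dK(2) y' sL] .
  have x0F: "x0 \<in> F" and y0D: "y0 \<in> D1" using x0 y0 N0 by auto
  have dF: "dim F + 1 = dim E" "dim D1 + 1 = dim D" using F(3) E(2) D1(3) D(2) by auto
  have "x1 \<notin> F" "y1 \<notin> D1" using x1 y1 E1(4) D1(4) by auto
  moreover have "x1 \<in> E" "y1 \<in> D" using x1 y1 E1 Y by auto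
  ultimately have sE': "span {x1, x', x0} = E" and sD': "span {y1, y', y0} = D"
    using span_insert_hyperplane[OF E(1) F(1,2) dF(1) _ _ sF] span_insert_hyperplane[OF D(1) D1(1,2) dF(2) _ _ sD1] by auto
  define B where "B M = b M x0 y'" for M
  define C where "C M = b M x' y0" for M
  have z: "b M x0 y0 = 0" if "M \<in> aff A V" for M using vKL[OF that] x0 y0 by (auto simp: vanish_def)
  have zY: "b M x0 y1 = 0" "b M x' y1 = 0" if "M \<in> aff A V" for M
    using v[OF that] x0F x'(1) y1(1) by (auto simp: vanish_def)
  have BC: "B M * C M = 0" if M: "M \<in> aff A V" "b M x1 y1 \<noteq> 0" for M
    using rk_le_1_minor[OF fF r0[OF M aff_base[OF sV0]] x0F x'(1) y'(1) y0D] z[OF M(1)] by (simp add: B_def C_def)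
  have V0z: "B N = 0 \<and> C N = 0" if N: "N \<in> V0" for N
  proof -
    have "N0 \<notin> ann V0 F D1" using N0(2) by (auto simp: ann_def)
    moreover have "dim (ann V0 F D1) + 1 = dim V0" using rd_ann[OF fV0, of F D1] rd0 by simp
    ultimately obtain h c where h: "h \<in> ann V0 F D1" "N = h + scale c N0"
      using hyperplane_decomp[OF fV0 subspace_ann[OF sV0] ann_subset _ N0(1) _ N] by metis
    have "b h x0 y' = 0" "b h x' y0 = 0" using h(1) x0F y' x' y0D by (auto simp: ann_def vanish_def)
    moreover have "b N0 x0 y' = 0" "b N0 x' y0 = 0" using N0(9,10) x0 y' x' y0 by (auto simp: vanish_def)
    ultimately show ?thesis by (simp add: h(2) B_def C_def form_simps)
  qed
  \<comment> \<open>Normalised so that \<open>M1 + scale \<tau> N1\<close> has third diagonal entry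
    \<open>\<tau>\<close>.\<close>
  define N1 where "N1 = scale (1 / b M2 x1 y1) (M2 - M1)"
  have N1: "N1 \<in> V" "b N1 x1 y1 = 1"
    using aff_diff[OF sV M1(1) M2(1)] subspace_scale[OF sV] bM1 bM2 by (auto simp: N1_def form_simps)
  have BM: "B M = B M1 + b M x1 y1 * B N1" "C M = C M1 + b M x1 y1 * C N1" if M: "M \<in> aff A V" for M
  proof -
    let ?N = "M - M1 - scale (b M x1 y1) N1"
    have "?N \<in> V0" using aff_diff[OF sV M1(1) M] subspace_scale[OF sV N1(1)] subspace_diff[OF sV] bM1 N1
      by (auto simp: V0_def form_simps)
    then show "B M = B M1 + b M x1 y1 * B N1" "C M = C M1 + b M x1 y1 * C N1"
      using V0z[of ?N] by (auto simp: B_def C_def form_simps algebra_simps)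
  qed
  have sx0: "fdsub (span {x0})" "span {x0} \<subseteq> F" "fdsub (span {y0})" "span {y0} \<subseteq> D1"
    using fK sK fL sL N0 by auto
  have nzB: "B M1 \<noteq> 0"
  proof
    assume "B M1 = 0"
    then have "vanish M1 {x0} {y', y0}" using z[OF M1(1)] by (auto simp: B_def vanish_def)
    then have "vanish M1 K D1" using vanish_span[of M1 "{x0}" "{y', y0}"] sK sD1 by simp
    then show False using rk_le_vanish[OF fF fD1 N0(3,4) D1(1) subset_refl, of M1] M1(2) F(3) N0(5) by simp
  qed
  have nzC: "C M1 \<noteq> 0"
  proof
    assume "C M1 = 0"
    then have "vanish M1 {x', x0} {y0}" using z[OF M1(1)] by (auto simp: C_def vanish_def)
    then have "vanish M1 F L" using vanish_span[of M1 "{x', x0}" "{y0}"] sF sL by simp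
    then show False using rk_le_vanish[OF fF fD1 F(1) subset_refl N0(6,7), of M1] M1(2) D1(3) N0(8) by simp
  qed
  obtain c :: 'a where c: "c \<noteq> 0" "c \<noteq> 1" using third_scalar by blast
  have pr: "(B M1 + \<tau> * B N1) * (C M1 + \<tau> * C N1) = 0" if "\<tau> \<noteq> 0" for \<tau>
  proof -
    let ?M = "M1 + scale \<tau> N1"
    have M: "?M \<in> aff A V" by (rule aff_translate[OF sV M1(1) subspace_scale[OF sV N1(1)]])
    have t: "b ?M x1 y1 = \<tau>" using bM1 N1 by (simp add: form_simps)
    show ?thesis using BC[OF M] BM[OF M] that unfolding t by simp
  qed
  obtain \<sigma> where s: "card (UNIV :: 'a set) = 3" "\<sigma> * \<sigma> = 1" "(1 :: 'a) + 1 = - 1" "B N1 \<noteq> 0" "C N1 \<noteq> 0"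
    "B M1 = \<sigma> * B N1" "C M1 = - \<sigma> * C N1"
    by (rule affine_functions_three[OF c nzB nzC pr])
  have s0: "\<sigma> \<noteq> 0" using s(2) by auto
  \<comment> \<open>With \<open>t = b M x1 y1\<close> these factors make the diagonal
    \<open>1 + \<sigma> * t\<close>, \<open>\<sigma> * t - 1\<close>, \<open>\<sigma> * t\<close>.
    As \<open>1 + 1 = - 1\<close>, the second is the first plus \<open>1\<close>, and the third is
    the first minus \<open>1\<close>.\<close>
  let ?X0 = "scale (\<sigma> / B N1) x0" and ?X1 = "scale (\<sigma> / C N1) x'" and ?X2 = "scale \<sigma> x1"
  have spX: "span {?X0, ?X1, ?X2} = E"
  proof
    have in3: "x0 \<in> E" "x' \<in> E" "x1 \<in> E" using x0F x'(1) F(2) x1(1) E1(2) by auto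
    then show "span {?X0, ?X1, ?X2} \<subseteq> E" by (intro span_minimal sE) (auto intro: subspace_scale[OF sE])
    have un: "x \<in> span {?X0, ?X1, ?X2}" if "scale k x \<in> {?X0, ?X1, ?X2}" "k \<noteq> 0" for k x
    proof -
      have "scale (1 / k) (scale k x) \<in> span {?X0, ?X1, ?X2}" using span_base[OF that(1)] by (rule span_scale)
      then show ?thesis using that(2) by simp
    qed
    have "x0 \<in> span {?X0, ?X1, ?X2}" by (rule un[of "\<sigma> / B N1"]) (use s0 s(4) in auto)
    moreover have "x' \<in> span {?X0, ?X1, ?X2}" by (rule un[of "\<sigma> / C N1"]) (use s0 s(5) in auto)
    moreover have "x1 \<in> span {?X0, ?X1, ?X2}" by (rule un[of \<sigma>]) (use s0 in auto)
    ultimately have "span {x1, x', x0} \<subseteq> span {?X0, ?X1, ?X2}" by (intro span_minimal) auto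
    then show "E \<subseteq> span {?X0, ?X1, ?X2}" using sE' by simp
  qed
  have spY: "span {y', y0, y1} = D"
  proof -
    have "{y', y0, y1} = {y1, y', y0}" by blast
    then show ?thesis using sD' by simp
  qed
  have "b M ?X0 y0 = 0 \<and> b M ?X0 y1 = 0 \<and> b M ?X1 y1 = 0 \<and>
      b M ?X1 y0 = b M ?X0 y' + 1 \<and> b M ?X2 y1 = b M ?X0 y' - 1" if M: "M \<in> aff A V" for M
  proof -
    have 0: "b M ?X0 y' = 1 + \<sigma> * b M x1 y1"
    proof -
      have "b M ?X0 y' = (\<sigma> / B N1) * B M" by (simp add: form_simps B_def)
      also have "B M = B N1 * (\<sigma> + b M x1 y1)" using BM(1)[OF M] s(6) by (simp add: algebra_simps)
      also have "(\<sigma> / B N1) * (B N1 * (\<sigma> + b M x1 y1)) = \<sigma> * (\<sigma> + b M x1 y1)" using s(4) by simp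
      finally show ?thesis using s(2) by (simp add: algebra_simps)
    qed
    have 1: "b M ?X1 y0 = \<sigma> * b M x1 y1 - 1"
    proof -
      have "b M ?X1 y0 = (\<sigma> / C N1) * C M" by (simp add: form_simps C_def)
      also have "C M = C N1 * (b M x1 y1 - \<sigma>)" using BM(2)[OF M] s(7) by (simp add: algebra_simps)
      also have "(\<sigma> / C N1) * (C N1 * (b M x1 y1 - \<sigma>)) = \<sigma> * (b M x1 y1 - \<sigma>)" using s(5) by simp
      finally show ?thesis using s(2) by (simp add: algebra_simps)
    qed
    have 2: "b M ?X2 y1 = \<sigma> * b M x1 y1" by (simp add: form_simps)
    have "b M ?X1 y0 = b M ?X0 y' + 1"
    proof -
      have "b M ?X0 y' + 1 = \<sigma> * b M x1 y1 + (1 + 1)" unfolding 0 by simp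
      then show ?thesis unfolding 1 s(3) by simp
    qed
    then show ?thesis using z[OF M] zY[OF M] 0 2 by (simp add: form_simps)
  qed
  then have "exceptional A V 2 E D"
    unfolding exceptional_def using E(2) D(2) rd(3) s(1) spX spY by blast
  then show ?thesis ..
qed

section \<open>Transposition of the classification statements\<close>

lemma compressedI:
  assumes "subspace F" "F \<subseteq> E" "subspace Y" "Y \<subseteq> D" "dim F + dim Y + r = dim E + dim D" "\<And>M. M \<in> S \<Longrightarrow> vanish M F Y"
  shows "compressed S r E D"
  unfolding compressed_def using assms by blast

lemma compressedE:
  assumes "compressed S r E D"
  obtains F Y where "subspace F" "F \<subseteq> E" "subspace Y" "Y \<subseteq> D" "dim F + dim Y + r = dim E + dim D" "\<forall>M\<in>S. vanish M F Y"
  using assms unfolding compressed_def by blast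

lemma compressed_flip_imp:
  assumes "compressed S r E D"
  shows "form_space.compressed scale (\<lambda>N x y. b N y x) S r D E"
proof -
  interpret fl: form_space scale "\<lambda>N x y. b N y x" by (rule flip_form_space)
  obtain F Y where "subspace F" "F \<subseteq> E" "subspace Y" "Y \<subseteq> D" "dim F + dim Y + r = dim E + dim D" "\<forall>M\<in>S. vanish M F Y"
    by (rule compressedE[OF assms])
  then show ?thesis by (intro fl.compressedI[of Y D F E]) (auto simp: vanish_flip)
qed

lemma compressed_flip: "form_space.compressed scale (\<lambda>N x y. b N y x) S r D E \<longleftrightarrow> compressed S r E D"
  using compressed_flip_imp[of S r E D] form_space.compressed_flip_imp[OF flip_form_space, of S r D E] by blast

text \<open>Reversing both bases restores the triangular shape after transposition but leaves the
  diagonal \<open>x - 1\<close>, \<open>x + 1\<close>, \<open>x\<close>. Negating one basis repairs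
  this, because \<open>1 + 1 = - 1\<close> gives \<open>- (x + 1) = (1 - x) + 1\<close>, and
  \<open>- x = (1 - x) - 1\<close>.\<close>

lemma exceptional_flip_imp:
  assumes ex: "exceptional A V r E D"
  shows "form_space.exceptional scale (\<lambda>N x y. b N y x) A V r D E"
proof -
  interpret fl: form_space scale "\<lambda>N x y. b N y x" by (rule flip_form_space)
  from ex obtain x0 x1 x2 y0 y1 y2 where c: "r = 2" "dim E = 3" "dim D = 3" "rd V E D = 4" "card (UNIV :: 'a set) = 3"
    and sp: "span {x0, x1, x2} = E" "span {y0, y1, y2} = D"
    and m: "\<And>M. M \<in> aff A V \<Longrightarrow> b M x0 y1 = 0 \<and> b M x0 y2 = 0 \<and> b M x1 y2 = 0 \<and>
          b M x1 y1 = b M x0 y0 + 1 \<and> b M x2 y2 = b M x0 y0 - 1"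
    unfolding exceptional_def by blast
  have "\<exists>u v :: 'a. UNIV = {0, u, v} \<and> u \<noteq> 0 \<and> v \<noteq> 0 \<and> u \<noteq> v"
  proof -
    have "card (UNIV - {0 :: 'a}) = 2" using c(5) by (simp add: card_Diff_singleton)
    then obtain u v where "UNIV - {0 :: 'a} = {u, v}" "u \<noteq> v" unfolding card_2_iff by blast
    moreover have "UNIV = insert 0 (UNIV - {0 :: 'a})" by blast
    ultimately have "UNIV = {0, u, v}" "u \<noteq> 0" "v \<noteq> 0" by auto
    then show ?thesis using \<open>u \<noteq> v\<close> by blast
  qed
  then obtain u v :: 'a where "UNIV = {0, u, v}" "u \<noteq> 0" "v \<noteq> 0" "u \<noteq> v" by blast
  note three = three_element_field(4)[OF this]
  have sp': "span {- y2, - y1, - y0} = D" "span {x2, x1, x0} = E"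
  proof -
    have "{x2, x1, x0} = {x0, x1, x2}" by blast
    then show "span {x2, x1, x0} = E" using sp by simp
    have "span {- y2, - y1, - y0} \<subseteq> span {y0, y1, y2}"
      by (rule span_minimal) (auto intro: span_neg span_base)
    moreover have "y \<in> span {- y2, - y1, - y0}" if "- y \<in> {- y2, - y1, - y0}" for y
      using span_neg[OF span_base[OF that]] by simp
    then have "span {y0, y1, y2} \<subseteq> span {- y2, - y1, - y0}" by (intro span_minimal) auto
    ultimately show "span {- y2, - y1, - y0} = D" using sp by simp
  qed
  have "b M x1 (- y2) = 0 \<and> b M x0 (- y2) = 0 \<and> b M x0 (- y1) = 0 \<and>
       b M x1 (- y1) = b M x2 (- y2) + 1 \<and> b M x0 (- y0) = b M x2 (- y2) - 1" if "M \<in> aff A V" for M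
  proof -
    have "b M x2 (- y2) + 1 = - b M x0 y0 + (1 + 1)" using m[OF that] by (simp add: form_simps)
    then show ?thesis using m[OF that] unfolding three by (simp add: form_simps)
  qed
  then have "\<exists>y0 y1 y2 x0 x1 x2. span {y0, y1, y2} = D \<and> span {x0, x1, x2} = E \<and>
       (\<forall>M\<in>aff A V. b M x1 y0 = 0 \<and> b M x2 y0 = 0 \<and> b M x2 y1 = 0 \<and>
          b M x1 y1 = b M x0 y0 + 1 \<and> b M x2 y2 = b M x0 y0 - 1)"
    using sp' by blast
  then show ?thesis unfolding fl.exceptional_def rd_flip using c by simp
qed

lemma exceptional_flip: "form_space.exceptional scale (\<lambda>N x y. b N y x) A V r D E \<longleftrightarrow> exceptional A V r E D"
  using exceptional_flip_imp[of A V r E D] form_space.exceptional_flip_imp[OF flip_form_space, of A V r D E] by blast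

lemma classified_flip_imp:
  assumes "classified k"
  shows "form_space.classified scale (\<lambda>N x y. b N y x) k"
proof -
  interpret fl: form_space scale "\<lambda>N x y. b N y x" by (rule flip_form_space)
  show ?thesis unfolding fl.classified_def
    by (intro allI impI) (use assms in \<open>simp add: classified_def rk_flip rd_flip compressed_flip exceptional_flip add.commute max.commute min.commute\<close>)
qed

text \<open>The rectangle \<open>F\<close> times \<open>Y\<close> contributes nothing and
  \<open>E1\<close> times \<open>D1\<close> at most its area. The two diagonal blocks are counted
  one after the other, the second on the kernel of restriction to the first, in either
  order.\<close>

lemma rd_split_blocks:
  assumes V: "fdsub V" and E: "fdsub E" and D: "fdsub D"
    and F: "subspace F" "F \<subseteq> E" and E1: "subspace E1" "E1 \<subseteq> E" "ssum F E1 = E"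
    and Y: "subspace Y" "Y \<subseteq> D" and D1: "subspace D1" "D1 \<subseteq> D" "ssum Y D1 = D"
    and v: "\<And>N. N \<in> V \<Longrightarrow> vanish N F Y"
  shows "rd V E D \<le> rd V F D1 + rd (ann V F D1) E1 Y + dim E1 * dim D1"
    and "rd V E D \<le> rd V E1 Y + rd (ann V E1 Y) F D1 + dim E1 * dim D1"
proof -
  note fE1 = fdsub_subset[OF E E1(1,2)] and fD1 = fdsub_subset[OF D D1(1,2)]
  have "rd U E D \<le> rd U F D1 + rd U E1 Y + dim E1 * dim D1" if U: "fdsub U" "U \<subseteq> V" for U
  proof -
    have "rd U E D \<le> rd U F D + rd U E1 D" using rd_ssum_left[OF U(1) F(1) E1(1), of D] E1(3) by simp
    moreover have "rd U F D \<le> rd U F Y + rd U F D1" using rd_ssum_right[OF U(1) Y(1) D1(1), of F] D1(3) by simp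
    moreover have "rd U E1 D \<le> rd U E1 Y + rd U E1 D1" using rd_ssum_right[OF U(1) Y(1) D1(1), of E1] D1(3) by simp
    moreover have "ann U F Y = U" using v U(2) by (auto simp: ann_def)
    then have "rd U F Y = 0" by (simp add: rd_def)
    moreover have "rd U E1 D1 \<le> dim E1 * dim D1" by (rule rd_le_product[OF U(1) fE1 fD1])
    ultimately show ?thesis by linarith
  qed
  note split = this[OF fdsub_ann[OF V] ann_subset]
  have z: "rd (ann V P R) P R = 0" for P R by (simp add: rd_def ann_ann)
  show "rd V E D \<le> rd V F D1 + rd (ann V F D1) E1 Y + dim E1 * dim D1"
    using split[of F D1] rd_restrict[OF V F(2) D1(2)] z[of F D1] by linarith
  show "rd V E D \<le> rd V E1 Y + rd (ann V E1 Y) F D1 + dim E1 * dim D1"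
    using split[of E1 Y] rd_restrict[OF V E1(2) Y(2)] z[of E1 Y] by linarith
qed

text \<open>The defects of the two diagonal blocks add up to at most the defect of the space among all forms
  vanishing on the given rectangle; \<open>s\<close>, \<open>t\<close>, \<open>u\<close>, \<open>w\<close> are the block sizes, with \<open>e = s + t + u\<close>
  and \<open>d = w + s\<close>.\<close>

lemma block_defect_identity:
  fixes s t u w g h :: int
  assumes "(w + s) * (s + t - 1) + (s + t + u) \<le> g + h + t * s + (w + s) + (s + t - 1)"
  shows "((s + u) * s - g) + (t * w - h) \<le> (s - 1) * (u + 2 - w) + w + 1"
  using assms by (simp add: algebra_simps)

text \<open>These estimate the product in the defect bound. In the application
  \<open>t + u \<le> w\<close>, so its factor \<open>u + 2 - w\<close> is positive only if
  \<open>t \<le> 1\<close>.\<close>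

lemma block_defect_bounds:
  fixes s u w :: int
  assumes s: "1 \<le> s"
  shows "u + 2 \<le> w \<Longrightarrow> (s - 1) * (u + 2 - w) \<le> 0"
    and "u + 2 \<le> w \<Longrightarrow> 2 \<le> s \<Longrightarrow> (s - 1) * (u + 2 - w) \<le> u + 2 - w"
    and "w = u + 1 \<Longrightarrow> (s - 1) * (u + 2 - w) = s - 1"
    and "w = u \<Longrightarrow> (s - 1) * (u + 2 - w) = 2 * (s - 1)"
proof -
  assume w: "u + 2 \<le> w"
  then show "(s - 1) * (u + 2 - w) \<le> 0" using s by (intro mult_nonneg_nonpos) auto
  assume s2: "2 \<le> s"
  have "(s - 2) * (u + 2 - w) \<le> 0" using s2 w by (intro mult_nonneg_nonpos) auto
  then show "(s - 1) * (u + 2 - w) \<le> u + 2 - w" by (simp add: algebra_simps)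
qed auto

text \<open>The blocks on \<open>F\<close> times \<open>D1\<close> and \<open>E1\<close> times
  \<open>Y\<close> have sizes \<open>s + u\<close> by \<open>s\<close> and \<open>t\<close> by
  \<open>w\<close> with \<open>s + t = r + 1\<close>, so by \<open>rk_blocks\<close> each member is
  deficient on one of them. If the same block is deficient for all members, the rectangle found
  inside it is joined to \<open>Y\<close> or to \<open>F\<close> and gains the missing unit.
  Otherwise the blocks clash, except in the triangular pattern of size three.\<close>

lemma compressed_or_exceptional_of_next:
  assumes IH: "classified k" and k: "dim E + dim D \<le> k"
    and V: "fdsub V" and E: "fdsub E" and D: "fdsub D" and ed: "dim E \<le> dim D" "r < dim E" "2 \<le> r"
    and rk: "\<And>M. M \<in> aff A V \<Longrightarrow> rk M E D \<le> r"
    and large: "dim D * r + dim E \<le> rd V E D + dim D + r"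
    and F: "subspace F" "F \<subseteq> E" and Y: "subspace Y" "Y \<subseteq> D"
    and pos: "1 \<le> dim F" "1 \<le> dim Y" "dim Y < dim D" and dims: "dim F + dim Y + r + 1 = dim E + dim D"
    and v: "\<And>M. M \<in> aff A V \<Longrightarrow> vanish M F Y"
  shows "compressed (aff A V) r E D \<or> exceptional A V r E D"
proof -
  have sV: "subspace V" and sE: "subspace E" and sD: "subspace D" using V E D fdsub_subspace by auto
  obtain E1 where E1: "subspace E1" "E1 \<subseteq> E" "F \<inter> E1 = {0}" "ssum F E1 = E" "dim F + dim E1 = dim E"
    by (rule complement_exists[OF E F])
  obtain D1 where D1: "subspace D1" "D1 \<subseteq> D" "Y \<inter> D1 = {0}" "ssum Y D1 = D" "dim Y + dim D1 = dim D"
    by (rule complement_exists[OF D Y])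
  note fF = fdsub_subset[OF E F] and fY = fdsub_subset[OF D Y]
    and fE1 = fdsub_subset[OF E E1(1,2)] and fD1 = fdsub_subset[OF D D1(1,2)]
  have vN: "vanish N F Y" if "N \<in> V" for N by (rule vanish_aff_direction[OF sV v that])
  define s t w where "s = dim D1" and "t = dim E1" and "w = dim Y"
  define u where "u = dim E - r - 1"
  have e: "dim E = s + t + u" "dim D = w + s" "r + 1 = s + t" "dim F = s + u" and s1: "1 \<le> s" and w1: "1 \<le> w"
    using E1(5) D1(5) dims pos ed by (auto simp: s_def t_def w_def u_def)
  have sz: "dim D1 = s" "dim E1 = t" "dim Y = w" by (simp_all add: s_def t_def w_def)
  have wt: "t + u \<le> w" using e ed(1) by linarith
  let ?W = "ann V F D1" and ?W' = "ann V E1 Y"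
  \<comment> \<open>\<open>gC\<close> and \<open>bB\<close> count the first block and then what is
    left on the second, \<open>eB\<close> and \<open>cC\<close> the second block and then the first.
    Compared with the areas \<open>Q\<close> and \<open>TW\<close> they give the defects.\<close>
  define gC bB eB cC where "gC = rd V F D1" and "bB = rd ?W E1 Y" and "eB = rd V E1 Y" and "cC = rd ?W' F D1"
  define X where "X = (int s - 1) * (int u + 2 - int w)"
  have mm: "max (dim F) (dim D1) = s + u" "min (dim F) (dim D1) = s" using e sz by simp_all
  have mmB: "max (dim E1) (dim Y) = w" "min (dim E1) (dim Y) = t" using wt sz by simp_all
  have split1: "rd V E D \<le> gC + bB + t * s" and split2: "rd V E D \<le> eB + cC + t * s"
    using rd_split_blocks[OF V E D F E1(1,2,4) Y D1(1,2,4) vN] by (auto simp: gC_def bB_def eB_def cC_def s_def t_def)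
  have lg: "(int w + int s) * (int s + int t - 1) + (int s + int t + int u) \<le> int (rd V E D) + (int w + int s) + (int s + int t - 1)"
  proof -
    have "int (dim D * r + dim E) \<le> int (rd V E D + dim D + r)" using large by (rule zle_int[THEN iffD2])
    moreover have "int r = int s + int t - 1" using e by linarith
    ultimately show ?thesis using e by simp
  qed
  define Q where "Q = (int s + int u) * int s"
  define TW where "TW = int t * int w"
  have def1: "(Q - int gC) + (TW - int bB) \<le> X + int w + 1"
    unfolding X_def Q_def TW_def
  proof (rule block_defect_identity)
    have "int (rd V E D) \<le> int (gC + bB + t * s)" using split1 by (rule zle_int[THEN iffD2])
    then show "(int w + int s) * (int s + int t - 1) + (int s + int t + int u)
      \<le> int gC + int bB + int t * int s + (int w + int s) + (int s + int t - 1)" using lg by simp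
  qed
  have def2: "(Q - int cC) + (TW - int eB) \<le> X + int w + 1"
    unfolding X_def Q_def TW_def
  proof (rule block_defect_identity)
    have "int (rd V E D) \<le> int (eB + cC + t * s)" using split2 by (rule zle_int[THEN iffD2])
    then show "(int w + int s) * (int s + int t - 1) + (int s + int t + int u)
      \<le> int cC + int eB + int t * int s + (int w + int s) + (int s + int t - 1)" using lg by simp
  qed
  have gCle: "int gC \<le> Q" "int cC \<le> Q"
  proof -
    have "gC \<le> (s + u) * s" "cC \<le> (s + u) * s"
      using rd_le_product[OF V fF fD1] rd_le_product[OF fdsub_ann[OF V] fF fD1] e by (auto simp: gC_def cC_def s_def)
    then have "int gC \<le> int ((s + u) * s)" "int cC \<le> int ((s + u) * s)" using zle_int by blast+
    then show "int gC \<le> Q" "int cC \<le> Q" by (simp_all add: Q_def)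
  qed
  have bBle: "int bB \<le> TW" "int eB \<le> TW"
  proof -
    have "bB \<le> t * w" "eB \<le> t * w"
      using rd_le_product[OF fdsub_ann[OF V] fE1 fY] rd_le_product[OF V fE1 fY] by (auto simp: bB_def eB_def t_def w_def)
    then have "int bB \<le> int (t * w)" "int eB \<le> int (t * w)" using zle_int by blast+
    then show "int bB \<le> TW" "int eB \<le> TW" by (simp_all add: TW_def)
  qed
  have s1': "1 \<le> int s" using s1 by simp
  note Xb = block_defect_bounds[OF s1', where u = "int u" and w = "int w", folded X_def]
  have X0: "u + 2 \<le> w \<Longrightarrow> X \<le> 0" and X1: "u + 2 \<le> w \<Longrightarrow> 2 \<le> s \<Longrightarrow> X \<le> int u + 2 - int w"
    and X2: "w = u + 1 \<Longrightarrow> X = int s - 1" and X3: "w = u \<Longrightarrow> X = 2 * (int s - 1)"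
    using Xb by auto
  have fullC: "dim F * dim D1 = (s + u) * s" and fullB: "dim E1 * dim Y = t * w"
    using e sz by simp_all
  have toC: "dim F * dim D1 + a \<le> n + 2 * max (dim F) (dim D1)" if "Q + int a \<le> int n + 2 * (int s + int u)" for a n
  proof -
    have "int ((s + u) * s + a) \<le> int (n + 2 * (s + u))" using that by (simp add: Q_def)
    then show ?thesis unfolding fullC mm using zle_int by blast
  qed
  have toB: "dim E1 * dim Y + a \<le> n + 2 * max (dim E1) (dim Y)" if "TW + int a \<le> int n + 2 * int w" for a n
  proof -
    have "int (t * w + a) \<le> int (n + 2 * w)" using that by (simp add: TW_def)
    then show ?thesis unfolding fullB mmB using zle_int by blast
  qed
  have kC: "dim F + dim D1 < k" and kB: "dim E1 + dim Y < k"
    using k e s1 w1 wt pos(1) sz by linarith+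
  show ?thesis
  proof (cases "\<forall>M\<in>aff A V. rk M F D1 < s")
    case True
    have "min (dim F) (dim D1) = 1 \<or> dim F * dim D1 + 1 \<le> gC + 2 * max (dim F) (dim D1)"
    proof (cases "s = 1")
      case False
      then have s2: "2 \<le> s" using s1 by linarith
      have "Q + int 1 \<le> int gC + 2 * (int s + int u)"
      proof -
        consider "u + 2 \<le> w" | "w = u + 1" | "w = u" using wt by linarith
        then show ?thesis
        proof cases
          case 1 then show ?thesis using X1[OF 1 s2] def1 bBle(1) s2 by presburger
        next
          case 2 then show ?thesis using X2[OF 2] def1 bBle(1) s2 by presburger
        next
          case 3 then show ?thesis using X3[OF 3] def1 bBle(1) s2 w1 by presburger
        qed
      qed
      then show ?thesis using toC by blast
    qed (use mm in simp)
    moreover have "gC \<noteq> 4" if "dim F = 3" "dim D1 = 3"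
    proof -
      have su: "s = 3" "u = 0" using that e sz by linarith+
      consider "u + 2 \<le> w" | "w = u + 1" using wt w1 su by linarith
      then have "Q - int gC \<le> 4"
      proof cases
        case 1 then show ?thesis using X1[OF 1] def1 bBle(1) su by presburger
      next
        case 2 then show ?thesis using X2[OF 2] def1 bBle(1) su by presburger
      qed
      then show ?thesis using su by (simp add: Q_def)
    qed
    moreover have "1 \<le> min (dim F) (dim D1)" using mm s1 by simp
    moreover have "rk M F D1 < min (dim F) (dim D1)" if "M \<in> aff A V" for M using True mm that by simp
    ultimately obtain F' Y' where FY: "subspace F'" "F' \<subseteq> F" "subspace Y'" "Y' \<subseteq> D1" "dim F' + dim Y' = max (dim F) (dim D1) + 1"
      "\<And>M. M \<in> aff A V \<Longrightarrow> vanish M F' Y'"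
      using classified_singular[OF IH kC V fF fD1, of A] unfolding gC_def by blast
    have fY': "fdsub Y'" using fdsub_subset[OF fD1 FY(3,4)] .
    have "Y' \<inter> Y = {0}" using FY(4) D1(3) subspace_0[OF FY(3)] subspace_0[OF Y(1)] by blast
    then have d: "dim (ssum Y' Y) = dim Y' + dim Y" using dim_ssum[OF fY' fY] fdsub_zero by simp
    have "compressed (aff A V) r E D"
    proof (rule compressedI[OF FY(1) _ subspace_ssum[OF FY(3) Y(1)]])
      show "F' \<subseteq> E" using FY(2) F(2) by blast
      show "ssum Y' Y \<subseteq> D" using ssum_least[OF sD _ Y(2), of Y'] FY(4) D1(2) by blast
      show "dim F' + dim (ssum Y' Y) + r = dim E + dim D" using d FY(5) mm e sz by linarith
      show "vanish M F' (ssum Y' Y)" if M: "M \<in> aff A V" for M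
        by (rule vanish_ssum_right[OF FY(6)[OF M] vanish_mono[OF v[OF M] FY(2) subset_refl]])
    qed
    then show ?thesis ..
  next
    case False
    then obtain M1 where M1: "M1 \<in> aff A V" "\<not> rk M1 F D1 < s" by blast
    have sing: "rk M F D1 < s \<or> rk M E1 Y < t" if M: "M \<in> aff A V" for M
      using rk_blocks[OF E sD F Y(2) v[OF M] E1(1,2) D1(2)] rk[OF M] e(3) by linarith
    have t1: "1 \<le> t" using sing[OF M1(1)] M1(2) by linarith
    show ?thesis
    proof (cases "\<forall>M\<in>aff A V. rk M E1 Y < t")
      case True
      have w2: "u + 2 \<le> w" if "t \<noteq> 1" using that t1 wt by linarith
      have "min (dim E1) (dim Y) = 1 \<or> dim E1 * dim Y + 1 \<le> eB + 2 * max (dim E1) (dim Y)"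
      proof (cases "t = 1")
        case False
        have "TW + int 1 \<le> int eB + 2 * int w"
          using w2[OF False] X0[OF w2[OF False]] def2 gCle(2) t1 False wt by presburger
        then show ?thesis using toB by blast
      qed (use mmB in simp)
      moreover have "eB \<noteq> 4" if "dim E1 = 3" "dim Y = 3"
      proof -
        have tw: "t = 3" "w = 3" using that sz by simp_all
        have "TW - int eB \<le> 4" using X0[OF w2] tw def2 gCle(2) by presburger
        then show ?thesis using tw by (simp add: TW_def)
      qed
      moreover have "1 \<le> min (dim E1) (dim Y)" using mmB t1 by simp
      moreover have "rk M E1 Y < min (dim E1) (dim Y)" if "M \<in> aff A V" for M using True mmB that by simp
      ultimately obtain F' Y' where FY: "subspace F'" "F' \<subseteq> E1" "subspace Y'" "Y' \<subseteq> Y" "dim F' + dim Y' = max (dim E1) (dim Y) + 1"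
        "\<And>M. M \<in> aff A V \<Longrightarrow> vanish M F' Y'"
        using classified_singular[OF IH kB V fE1 fY, of A] unfolding eB_def by blast
      have fF': "fdsub F'" using fdsub_subset[OF fE1 FY(1,2)] .
      have "F' \<inter> F = {0}" using FY(2) E1(3) subspace_0[OF FY(1)] subspace_0[OF F(1)] by blast
      then have d: "dim (ssum F' F) = dim F' + dim F" using dim_ssum[OF fF' fF] fdsub_zero by simp
      have "compressed (aff A V) r E D"
      proof (rule compressedI[OF subspace_ssum[OF FY(1) F(1)] _ FY(3)])
        show "Y' \<subseteq> D" using FY(4) Y(2) by blast
        show "ssum F' F \<subseteq> E" using ssum_least[OF sE _ F(2), of F'] FY(2) E1(2) by blast
        show "dim (ssum F' F) + dim Y' + r = dim E + dim D" using d FY(5) mmB e sz by linarith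
        show "vanish M (ssum F' F) Y'" if M: "M \<in> aff A V" for M
          by (rule vanish_ssum_left[OF FY(6)[OF M] vanish_mono[OF v[OF M] subset_refl FY(4)]])
      qed
      then show ?thesis ..
    next
      case False
      then obtain M2 where M2: "M2 \<in> aff A V" "\<not> rk M2 E1 Y < t" by blast
      have p1: "1 \<le> min (dim F) (dim D1)" and p2: "1 \<le> min (dim E1) (dim Y)" using mm mmB s1 t1 by auto
      have clash1: False
        if c2: "t = 1 \<or> TW + 2 \<le> int bB + 2 * int w"
          and c1: "int bB + int w \<le> TW \<Longrightarrow> s = 1 \<or> Q + 3 \<le> int gC + 2 * (int s + int u)"
      proof (rule singular_pair_clash[OF IH V fF fD1 fE1 fY kC kB p1 p2 _ M1(1) _ M2(1)])
        show "rk M F D1 < min (dim F) (dim D1) \<or> rk M E1 Y < min (dim E1) (dim Y)" if "M \<in> aff A V" for M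
          using sing[OF that] mm mmB by simp
        show "\<not> rk M1 F D1 < min (dim F) (dim D1)" "\<not> rk M2 E1 Y < min (dim E1) (dim Y)" using M1(2) M2(2) mm mmB by auto
        show "min (dim E1) (dim Y) = 1 \<or> dim E1 * dim Y + 2 \<le> rd ?W E1 Y + 2 * max (dim E1) (dim Y)"
          using c2 toB[of 2 bB] mmB by (auto simp: bB_def)
        assume "rd ?W E1 Y + max (dim E1) (dim Y) \<le> dim E1 * dim Y"
        then have "bB + w \<le> t * w" unfolding fullB mmB bB_def .
        then have "int (bB + w) \<le> int (t * w)" by (rule zle_int[THEN iffD2])
        then have "s = 1 \<or> Q + 3 \<le> int gC + 2 * (int s + int u)" using c1 by (simp add: TW_def)
        then show "min (dim F) (dim D1) = 1 \<or> dim F * dim D1 + 3 \<le> rd V F D1 + 2 * max (dim F) (dim D1)"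
          using toC[of 3 gC] mm by (auto simp: gC_def)
      qed
      have clash2: False
        if c2: "s = 1 \<or> Q + 2 \<le> int cC + 2 * (int s + int u)"
          and c1: "int cC + (int s + int u) \<le> Q \<Longrightarrow> t = 1 \<or> TW + 3 \<le> int eB + 2 * int w"
      proof (rule singular_pair_clash[OF IH V fE1 fY fF fD1 kB kC p2 p1 _ M2(1) _ M1(1)])
        show "rk M E1 Y < min (dim E1) (dim Y) \<or> rk M F D1 < min (dim F) (dim D1)" if "M \<in> aff A V" for M
          using sing[OF that] mm mmB by auto
        show "\<not> rk M1 F D1 < min (dim F) (dim D1)" "\<not> rk M2 E1 Y < min (dim E1) (dim Y)" using M1(2) M2(2) mm mmB by auto
        show "min (dim F) (dim D1) = 1 \<or> dim F * dim D1 + 2 \<le> rd ?W' F D1 + 2 * max (dim F) (dim D1)"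
          using c2 toC[of 2 cC] mm by (auto simp: cC_def)
        assume "rd ?W' F D1 + max (dim F) (dim D1) \<le> dim F * dim D1"
        then have "cC + (s + u) \<le> (s + u) * s" unfolding fullC mm cC_def .
        then have "int (cC + (s + u)) \<le> int ((s + u) * s)" by (rule zle_int[THEN iffD2])
        then have "t = 1 \<or> TW + 3 \<le> int eB + 2 * int w" using c1 by (simp add: Q_def)
        then show "min (dim E1) (dim Y) = 1 \<or> dim E1 * dim Y + 3 \<le> rd V E1 Y + 2 * max (dim E1) (dim Y)"
          using toB[of 3 eB] mmB by (auto simp: eB_def)
      qed
      have st: "3 \<le> s + t" using e ed by linarith
      \<comment> \<open>In \<open>big\<close> and \<open>one\<close> the count suffices for the
        clash with the first block held fixed, in \<open>swap\<close> with the second. In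
        \<open>square\<close> one of the two orders works unless each block carries all
        \<open>4\<close> dimensions and each kernel contributes just one. \<open>tri\<close> and its
        transpose \<open>tri'\<close> are the patterns that may be exceptional.\<close>
      consider (big) "2 \<le> t" "3 \<le> w" | (swap) "t = 2" "w = 2" "u = 0" "3 \<le> s" | (square) "t = 2" "w = 2" "u = 0" "s = 2"
        | (tri') "t = 2" "w = 2" "u = 0" "s = 1" | (one) "t = 1" "2 \<le> s" "u + 2 \<le> w \<or> 3 \<le> s + 2 * u" | (tri) "t = 1" "s = 2" "u = 0" "w = 1"
      proof (cases "t = 1")
        case True
        then have "2 \<le> s" using st by linarith
        show ?thesis
        proof (cases "u + 2 \<le> w \<or> 3 \<le> s + 2 * u")
          case False
          then have "s = 2" "u = 0" "w = 1" using True \<open>2 \<le> s\<close> wt by linarith+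
          then show ?thesis using tri True by blast
        qed (use one True \<open>2 \<le> s\<close> in blast)
      next
        case False
        then have t2: "2 \<le> t" using t1 by linarith
        show ?thesis
        proof (cases "3 \<le> w")
          case False
          then have "t = 2" "w = 2" "u = 0" using t2 wt by linarith+
          moreover have "s = 1 \<or> s = 2 \<or> 3 \<le> s" using s1 by linarith
          ultimately show ?thesis using swap square tri' by blast
        qed (use big t2 in blast)
      qed
      then show ?thesis
      proof cases
        case big
        then have w2: "u + 2 \<le> w" using wt by linarith
        have False
        proof (rule clash1)
          show "t = 1 \<or> TW + 2 \<le> int bB + 2 * int w" using X0[OF w2] def1 gCle(1) big by presburger
          assume "int bB + int w \<le> TW"
          then show "s = 1 \<or> Q + 3 \<le> int gC + 2 * (int s + int u)" using X0[OF w2] def1 s1 by presburger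
        qed
        then show ?thesis ..
      next
        case swap
        have False
        proof (rule clash2)
          show "s = 1 \<or> Q + 2 \<le> int cC + 2 * (int s + int u)" using X0 swap def2 bBle(2) by (auto simp: TW_def Q_def)
          assume "int cC + (int s + int u) \<le> Q"
          then show "t = 1 \<or> TW + 3 \<le> int eB + 2 * int w" using X0 swap def2 by (auto simp: TW_def Q_def)
        qed
        then show ?thesis ..
      next
        case one
        have False
        proof (rule clash1)
          show "t = 1 \<or> TW + 2 \<le> int bB + 2 * int w" using one by blast
          assume b: "int bB + int w \<le> TW"
          show "s = 1 \<or> Q + 3 \<le> int gC + 2 * (int s + int u)"
          proof (cases "u + 2 \<le> w")
            case True then show ?thesis using X0[OF True] def1 b one by presburger
          next
            case False
            then have w: "w = u + 1" using wt one by linarith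
            have "3 \<le> s + 2 * u" using one False by blast
            then show ?thesis using X2[OF w] def1 b one w by presburger
          qed
        qed
        then show ?thesis ..
      next
        case square
        have X0': "X \<le> 0" using X0 square by simp
        have gb: "int gC + int bB \<ge> 5" and ec: "int eB + int cC \<ge> 5" using def1 def2 X0' square by (auto simp: TW_def Q_def)
        have le4: "gC \<le> 4" "bB \<le> 4" "eB \<le> 4" "cC \<le> 4" using gCle bBle square by (auto simp: TW_def Q_def)
        have "bB \<le> 1"
        proof (rule ccontr)
          assume "\<not> bB \<le> 1"
          show False by (rule clash1) (use \<open>\<not> bB \<le> 1\<close> gb square in \<open>auto simp: TW_def Q_def\<close>)
        qed
        moreover have "cC \<le> 1"
        proof (rule ccontr)
          assume "\<not> cC \<le> 1"
          show False by (rule clash2) (use \<open>\<not> cC \<le> 1\<close> ec square in \<open>auto simp: TW_def Q_def\<close>)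
        qed
        ultimately have c: "bB = 1" "gC = 4" "cC = 1" "eB = 4" using gb ec le4 by auto
        have False
        proof (rule double_square_clash[OF V fF _ fD1 _ fE1 _ fY _ _ M1(1) _ M2(1)])
          show "dim F = 2" "dim D1 = 2" "dim E1 = 2" "dim Y = 2" using square e sz by simp_all
          show "rk M F D1 \<le> 1 \<or> rk M E1 Y \<le> 1" if "M \<in> aff A V" for M using sing[OF that] square by auto
          show "\<not> rk M1 F D1 \<le> 1" "\<not> rk M2 E1 Y \<le> 1" using M1(2) M2(2) square by auto
          show "rd ?W E1 Y \<noteq> 0" "rd ?W' F D1 \<noteq> 0" "rd V F D1 = 4" "rd V E1 Y = 4"
            using c by (auto simp: bB_def cC_def gC_def eB_def)
        qed
        then show ?thesis ..
      next
        case tri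
        have X1': "X = 1" using X2 tri by simp
        have gb: "int gC + int bB \<ge> 2" using def1 X1' tri by (simp add: TW_def Q_def)
        have "bB = 0"
        proof (rule ccontr)
          assume "bB \<noteq> 0"
          show False by (rule clash1) (use \<open>bB \<noteq> 0\<close> tri in \<open>auto simp: TW_def Q_def\<close>)
        qed
        moreover have "gC \<le> 2"
        proof (rule ccontr)
          assume "\<not> gC \<le> 2"
          show False by (rule clash1) (use \<open>\<not> gC \<le> 2\<close> tri in \<open>auto simp: TW_def Q_def\<close>)
        qed
        ultimately have c: "bB = 0" "gC = 2" using gb by auto
        have rd4: "rd V E D = 4" using split1 c tri large e by simp
        have dd: "dim E = 3" "dim D = 3" "r = 2" "dim F = 2" "dim E1 = 1" "dim Y = 1" "dim D1 = 2"
          using tri e sz by simp_all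
        have sing': "rk M F D1 \<le> 1 \<or> vanish M E1 Y" if "M \<in> aff A V" for M
          using sing[OF that] tri rk_0_iff[OF fE1, of M Y] by auto
        have M12: "\<not> rk M1 F D1 \<le> 1" "\<not> vanish M2 E1 Y" using M1(2) M2(2) tri rk_0_iff[OF fE1, of M2 Y] by auto
        show ?thesis unfolding dd(3)
          by (rule triangular_case[OF V E dd(1) D dd(2) F dd(4) E1(1,2) dd(5) E1(3) Y dd(6) D1(1,2) dd(7) D1(3) v sing' M1(1) M12(1) M2(1) M12(2)])
            (use c rd4 in \<open>auto simp: bB_def gC_def\<close>)
      next
        case tri'
        interpret fl: form_space scale "\<lambda>N x y. b N y x" by (rule flip_form_space)
        have X0': "X = 0" using tri' by (simp add: X_def)
        have ec: "int eB + int cC \<ge> 2" using def2 X0' tri' by (simp add: TW_def Q_def)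
        have "cC = 0"
        proof (rule ccontr)
          assume "cC \<noteq> 0"
          show False by (rule clash2) (use \<open>cC \<noteq> 0\<close> tri' in \<open>auto simp: TW_def Q_def\<close>)
        qed
        moreover have "eB \<le> 2"
        proof (rule ccontr)
          assume "\<not> eB \<le> 2"
          show False by (rule clash2) (use \<open>\<not> eB \<le> 2\<close> tri' in \<open>auto simp: TW_def Q_def\<close>)
        qed
        ultimately have c: "cC = 0" "eB = 2" using ec by auto
        have rd4: "rd V E D = 4" using split2 c tri' large e by simp
        have dd: "dim E = 3" "dim D = 3" "r = 2" "dim F = 1" "dim E1 = 2" "dim Y = 2" "dim D1 = 1"
          using tri' e sz by simp_all
        have sing': "fl.rk M Y E1 \<le> 1 \<or> fl.vanish M D1 F" if "M \<in> aff A V" for M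
          using sing[OF that] tri' rk_0_iff[OF fF, of M D1] unfolding rk_flip[OF fE1 fY] vanish_flip by auto
        have M12: "\<not> fl.vanish M1 D1 F" "\<not> fl.rk M2 Y E1 \<le> 1"
          using M1(2) M2(2) tri' rk_0_iff[OF fF, of M1 D1] unfolding rk_flip[OF fE1 fY] vanish_flip by auto
        have v': "fl.vanish M Y F" if "M \<in> aff A V" for M using v[OF that] by (simp add: vanish_flip)
        have "fl.compressed (aff A V) 2 D E \<or> fl.exceptional A V 2 D E"
          by (rule fl.triangular_case[OF V D dd(2) E dd(1) Y dd(6) D1(1,2) dd(7) D1(3) F dd(4) E1(1,2) dd(5) E1(3) v' sing' M2(1) M12(2) M1(1) M12(1)])
            (use c rd4 in \<open>auto simp: cC_def eB_def rd_flip ann_flip\<close>)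
        then show ?thesis unfolding dd(3) compressed_flip exceptional_flip .
      qed
    qed
  qed
qed

section \<open>Restriction to hyperplanes\<close>

text \<open>The annihilator of the sum is the intersection of the annihilators, while that of the
  intersection contains their sum.\<close>

lemma rd_submodular:
  assumes V: "fdsub V" and P: "subspace P" and Q: "subspace Q"
  shows "rd V (P \<inter> Q) R + rd V (ssum P Q) R \<le> rd V P R + rd V Q R"
proof -
  have sV: "subspace V" using V fdsub_subspace by blast
  have e: "ann V P R \<inter> ann V Q R = ann V (ssum P Q) R"
    using ssum_upper[OF P Q] vanish_ssum_left vanish_mono by (fastforce simp: ann_def)
  have "dim (ann V P R) + dim (ann V Q R) \<le> dim (ann V (P \<inter> Q) R) + dim (ann V P R \<inter> ann V Q R)"
    by (rule dim_add_le[OF fdsub_ann[OF V] subspace_ann[OF sV] _ subspace_ann[OF sV]]) (auto intro: ann_mono[THEN subsetD])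
  then show ?thesis unfolding e
    using rd_ann[OF V, of P R] rd_ann[OF V, of Q R] rd_ann[OF V, of "P \<inter> Q" R] rd_ann[OF V, of "ssum P Q" R] by linarith
qed

lemma rd_hyperplane_left:
  assumes V: "fdsub V" and E: "fdsub E" and D: "fdsub D" and H: "subspace H" "H \<subseteq> E" "dim H + 1 = dim E"
  shows "rd V E D \<le> rd V H D + dim D"
proof -
  obtain C where C: "subspace C" "C \<subseteq> E" "H \<inter> C = {0}" "ssum H C = E" "dim H + dim C = dim E"
    by (rule complement_exists[OF E H(1,2)])
  have "rd V C D \<le> dim C * dim D" by (rule rd_le_product[OF V fdsub_subset[OF E C(1,2)] D])
  moreover have "dim C = 1" using C(5) H(3) by simp
  ultimately show ?thesis using rd_ssum_left[OF V H(1) C(1), of D] C(4) by simp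
qed

text \<open>A direction vanishing on \<open>H\<close> times \<open>D\<close> has rank at most one.
  Directions of the exceptional family are triangular with constant diagonal, so a
  \<open>2 \<times> 2\<close> minor makes the diagonal zero and the direction kills
  \<open>y2\<close>. On a complement of \<open>H\<close> only the two dimensions of \<open>D\<close>
  modulo \<open>y2\<close> remain.\<close>

lemma exceptional_drop:
  assumes V: "fdsub V" and E: "fdsub E" and D: "fdsub D" and ex: "exceptional A V r E D"
    and H: "subspace H" "H \<subseteq> E" "dim H + 1 = dim E"
  shows "rd V E D \<le> rd V H D + 2"
proof -
  have sV: "subspace V" using V fdsub_subspace by blast
  obtain x0 x1 x2 y0 y1 y2 where c: "dim E = 3" "dim D = 3"
    and sp: "span {x0, x1, x2} = E" "span {y0, y1, y2} = D"
    and m: "\<forall>M\<in>aff A V. b M x0 y1 = 0 \<and> b M x0 y2 = 0 \<and> b M x1 y2 = 0 \<and>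
          b M x1 y1 = b M x0 y0 + 1 \<and> b M x2 y2 = b M x0 y0 - 1"
    using ex unfolding exceptional_def by blast
  have sx: "{x0, x1, x2} \<subseteq> E" and sy: "{y0, y1, y2} \<subseteq> D" 
    using span_superset[of "{x0, x1, x2}"] span_superset[of "{y0, y1, y2}"] unfolding sp by auto
  have y2: "y2 \<noteq> 0"
  proof
    assume "y2 = 0"
    then have "D \<subseteq> span {y0, y1}" using sp(2) span_insert_0[of "{y0, y1}"] by (simp add: insert_commute)
    then have "dim D \<le> card {y0, y1}" by (rule dim_le_card) simp
    also have "\<dots> \<le> 2" by (simp add: card_insert_if)
    finally show False using c by simp
  qed
  obtain C where C: "subspace C" "C \<subseteq> E" "H \<inter> C = {0}" "ssum H C = E" "dim H + dim C = dim E"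
    by (rule complement_exists[OF E H(1,2)])
  have dC: "dim C = 1" using C(5) H(3) by simp
  let ?U = "ann V H D"
  have v: "vanish N E (span {y2})" if N: "N \<in> ?U" for N
  proof -
    have NV: "N \<in> V" and vH: "vanish N H D" using N by (auto simp: ann_def)
    have "b (A + N) x0 y1 = 0 \<and> b (A + N) x0 y2 = 0 \<and> b (A + N) x1 y2 = 0 \<and>
        b (A + N) x1 y1 = b (A + N) x0 y0 + 1 \<and> b (A + N) x2 y2 = b (A + N) x0 y0 - 1"
      and "b A x0 y1 = 0 \<and> b A x0 y2 = 0 \<and> b A x1 y2 = 0 \<and> b A x1 y1 = b A x0 y0 + 1 \<and> b A x2 y2 = b A x0 y0 - 1"
      using m aff_base[OF sV] aff_translate[OF sV aff_base[OF sV] NV] by blast+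
    then have n: "b N x0 y1 = 0" "b N x0 y2 = 0" "b N x1 y2 = 0" "b N x1 y1 = b N x0 y0" "b N x2 y2 = b N x0 y0"
      by (auto simp: form_simps)
    have "H \<subseteq> rad N E D" using vH H(2) by (auto simp: rad_def vanish_def)
    then have "dim H \<le> dim (rad N E D)" by (rule fdsub_dim_mono[OF fdsub_rad[OF E] H(1)])
    then have r: "rk N E D \<le> 1" using rk_rad[OF E, of N D] H(3) by linarith
    have "b N x0 y0 * b N x1 y1 = b N x0 y1 * b N x1 y0" by (rule rk_le_1_minor[OF E r]) (use sx sy in auto)
    then have "b N x0 y0 = 0" using n by simp
    then have "vanish N {x0, x1, x2} {y2}" using n by (auto simp: vanish_def)
    then show ?thesis using vanish_span sp(1) by metis
  qed
  have fC: "fdsub C" by (rule fdsub_subset[OF E C(1,2)])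
  have "span {y2} \<subseteq> D" using sy by (intro span_minimal fdsub_subspace[OF D]) auto
  then have "rd ?U C D \<le> dim C * (dim D - dim (span {y2}))"
    by (intro rd_le_quotient[OF fdsub_ann[OF V] fC D]) (use v vanish_mono C(2) in blast)+
  then have "rd ?U C D \<le> 2" using dC c(2) dim_span_singleton[OF y2] by simp
  moreover have "rd ?U H D = 0" by (simp add: rd_def ann_ann)
  moreover have "rd ?U E D \<le> rd ?U H D + rd ?U C D" using rd_ssum_left[OF fdsub_ann[OF V] H(1) C(1), of H D D] C(4) by simp
  ultimately show ?thesis using rd_restrict[OF V H(2) subset_refl, of D] by linarith
qed

text \<open>On the two kernels of the rank-one form \<open>N\<close> the rank bound falls by one, by
  \<open>rk_extract\<close>. Passing from \<open>D\<close> to \<open>H\<close> costs at most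
  \<open>r - 1\<close> dimensions and from \<open>E\<close> to \<open>rad N E D\<close> at most
  \<open>dim H\<close>, exactly the difference of the thresholds. The exceptional outcome for the
  smaller pair is left to \<open>intermediate_drop\<close>.\<close>

lemma next_step_after_extraction:
  assumes IH: "classified k" and k: "dim E + dim D \<le> k"
    and V: "fdsub V" and E: "fdsub E" and D: "fdsub D" and ed: "dim E \<le> dim D" "r < dim E" "2 \<le> r"
    and rk: "\<And>M. M \<in> aff A V \<Longrightarrow> rk M E D \<le> r"
    and large: "dim D * r + dim E \<le> rd V E D + dim D + r"
    and H: "subspace H" "H \<subseteq> D" "dim H + 1 = dim D" and drop: "rd V E D < rd V E H + r"
    and N: "N \<in> ann V E H" "\<not> vanish N E D"
  shows "compressed (aff A V) r E D \<or> exceptional A V r E D \<or> exceptional A V (r - 1) (rad N E D) H"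
proof -
  have sV: "subspace V" and sE: "subspace E" using V E fdsub_subspace by auto
  let ?E = "rad N E D"
  have NV: "N \<in> V" "vanish N E H" using N by (auto simp: ann_def)
  have E': "subspace ?E" "?E \<subseteq> E" "dim ?E + 1 = dim E" "vanish N ?E D"
    using subspace_rad[OF sE] rank_one_radical[OF E D H NV(2) N(2)] by (auto simp: rad_def vanish_def)
  have fE': "fdsub ?E" and fH: "fdsub H" using fdsub_subset[OF E E'(1,2)] fdsub_subset[OF D H(1,2)] by auto
  obtain r' where r': "r = Suc r'" using ed(3) by (cases r) auto
  have rk': "rk M ?E H \<le> r'" if M: "M \<in> aff A V" for M
  proof -
    have "rk M ?E H < r"
      by (rule rk_extract[OF E D E'(1-3) H(1,2) E'(4) NV(2) N(2) rk[OF M] rk[OF aff_translate[OF sV M NV(1)]]])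
    then show ?thesis using r' by simp
  qed
  have rdH: "rd V E H \<le> rd V ?E H + dim H" by (rule rd_hyperplane_left[OF V E fH E'(1-3)])
  have mm: "max (dim ?E) (dim H) = dim H" "min (dim ?E) (dim H) = dim ?E" using E'(3) H(3) ed(1) by auto
  have "max (dim ?E) (dim H) * r' + min (dim ?E) (dim H) \<le> rd V ?E H + max (dim ?E) (dim H) + r'"
  proof -
    have "(dim H + 1) * (r' + 1) + (dim ?E + 1) \<le> rd V E D + (dim H + 1) + (r' + 1)" using large H(3) E'(3) r' by simp
    then have "dim H * r' + dim ?E \<le> rd V E D" by simp
    then show ?thesis unfolding mm using rdH drop r' by linarith
  qed
  moreover have "dim ?E + dim H < k" using E'(3) H(3) k by linarith
  moreover have "r' \<le> min (dim ?E) (dim H)" unfolding mm using ed E'(3) r' by linarith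
  ultimately have "compressed (aff A V) r' ?E H \<or> exceptional A V r' ?E H"
    using IH V fE' fH rk' unfolding classified_def by blast
  then show ?thesis
  proof
    assume "compressed (aff A V) r' ?E H"
    then obtain F Y where FY: "subspace F" "F \<subseteq> ?E" "subspace Y" "Y \<subseteq> H" "dim F + dim Y + r' = dim ?E + dim H"
      "\<forall>M\<in>aff A V. vanish M F Y" by (rule compressedE)
    have le: "dim F \<le> dim ?E" "dim Y \<le> dim H" using fdsub_dim_mono[OF fE' FY(1,2)] fdsub_dim_mono[OF fH FY(3,4)] by auto
    have "compressed (aff A V) r E D \<or> exceptional A V r E D"
    proof (rule compressed_or_exceptional_of_next[OF IH k V E D ed rk large FY(1) _ FY(3)])
      show "F \<subseteq> E" "Y \<subseteq> D" using FY(2,4) E'(2) H(2) by auto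
      show "1 \<le> dim F" "1 \<le> dim Y" "dim Y < dim D" "dim F + dim Y + r + 1 = dim E + dim D"
        using le FY(5) E'(3) H(3) r' ed by linarith+
    qed (use FY(6) in auto)
    then show ?thesis by blast
  qed (use r' in simp)
qed

text \<open>An exceptional space after the extraction forces \<open>r = 3\<close>, size four,
  \<open>rd V E H = 7\<close> and \<open>rd V E D = 9\<close>. The common radical then has dimension
  \<open>2\<close>, so two rank-one forms have different kernels of dimension \<open>3\<close>.
  Submodularity leaves at most \<open>1\<close> dimension on the intersection of these kernels,
  whereas \<open>exceptional_drop\<close> demands at least \<open>2\<close>.\<close>

lemma intermediate_drop:
  assumes IH: "classified k" and k: "dim E + dim D \<le> k"
    and V: "fdsub V" and E: "fdsub E" and D: "fdsub D" and ed: "dim E \<le> dim D" "r < dim E" "2 \<le> r"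
    and rk: "\<And>M. M \<in> aff A V \<Longrightarrow> rk M E D \<le> r"
    and large: "dim D * r + dim E \<le> rd V E D + dim D + r"
    and H: "subspace H" "H \<subseteq> D" "dim H + 1 = dim D" and drop: "rd V E D < rd V E H + r" "rd V E H < rd V E D"
  shows "compressed (aff A V) r E D \<or> exceptional A V r E D"
proof (rule ccontr)
  assume no: "\<not> ?thesis"
  have sV: "subspace V" and sE: "subspace E" using V E fdsub_subspace by auto
  have ex: "exceptional A V (r - 1) (rad N E D) H" if "N \<in> ann V E H" "\<not> vanish N E D" for N
    using next_step_after_extraction[OF IH k V E D ed rk large H drop(1) that] no by blast
  have sub: "ann V E D \<subseteq> ann V E H" using H(2) by (rule ann_mono[OF subset_refl])
  have "ann V E D \<noteq> ann V E H" using rd_ann[OF V, of E D] rd_ann[OF V, of E H] drop(2) by auto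
  then obtain N1 where N1: "N1 \<in> ann V E H" "\<not> vanish N1 E D" using sub by (auto simp: ann_def)
  let ?E1 = "rad N1 E D"
  have fH: "fdsub H" by (rule fdsub_subset[OF D H(1,2)])
  have hyp: "subspace (rad N E D)" "rad N E D \<subseteq> E" "dim (rad N E D) + 1 = dim E" if "N \<in> ann V E H" "\<not> vanish N E D" for N
    using subspace_rad[OF sE] rank_one_radical[OF E D H _ that(2)] that(1) by (auto simp: rad_def ann_def)
  have r3: "r = 3" "dim E = 4" "dim D = 4" "dim H = 3" and rd1: "rd V ?E1 H = 4"
    using ex[OF N1] hyp(3)[OF N1] H(3) unfolding exceptional_def by auto
  have "rd V E H \<le> rd V ?E1 H + dim H" by (rule rd_hyperplane_left[OF V E fH hyp[OF N1]])
  then have rds: "rd V E H = 7" "rd V E D = 9" using rd1 r3 large drop(1) by auto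
  have dc: "dim (crad V E D H) = 2" using dim_crad[OF V E D H] rds r3 by simp
  have "\<not> ?E1 \<subseteq> crad V E D H"
  proof
    assume a: "?E1 \<subseteq> crad V E D H"
    have "fdsub (crad V E D H)" by (rule fdsub_subset[OF E subspace_crad[OF sE]]) (auto simp: crad_def)
    then show False using fdsub_dim_mono[OF _ hyp(1)[OF N1] a] hyp(3)[OF N1] dc r3 by simp
  qed
  then obtain x where x: "x \<in> ?E1" "x \<notin> crad V E D H" by blast
  then have xE: "x \<in> E" by (simp add: rad_def)
  then obtain N2 y where N2: "N2 \<in> ann V E H" "y \<in> D" "b N2 x y \<noteq> 0" using x(2) by (auto simp: crad_def)
  have N2': "\<not> vanish N2 E D" using N2 xE by (auto simp: vanish_def)
  let ?E2 = "rad N2 E D"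
  have rd2: "rd V ?E2 H = 4" using ex[OF N2(1) N2'] unfolding exceptional_def by blast
  have f1: "fdsub ?E1" and f2: "fdsub ?E2" using fdsub_rad[OF E] by auto
  have sI: "subspace (?E1 \<inter> ?E2)" using hyp(1)[OF N1] hyp(1)[OF N2(1) N2'] by (rule subspace_inter)
  have xn: "x \<notin> ?E2" using N2 by (auto simp: rad_def)
  have dI: "dim (?E1 \<inter> ?E2) + 1 = dim ?E1"
  proof -
    have "\<not> dim ?E1 \<le> dim (?E1 \<inter> ?E2)" using fdsub_dim_eq[OF f1 sI] x(1) xn by blast
    moreover have "dim ?E1 + dim ?E2 \<le> dim E + dim (?E1 \<inter> ?E2)"
      by (rule dim_add_le[OF E hyp(1,2)[OF N1] hyp(1,2)[OF N2(1) N2']])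
    ultimately show ?thesis using hyp(3)[OF N1] hyp(3)[OF N2(1) N2'] by linarith
  qed
  have sE': "ssum ?E1 ?E2 = E"
  proof (rule fdsub_dim_eq[OF E subspace_ssum[OF hyp(1)[OF N1] hyp(1)[OF N2(1) N2']]])
    show "ssum ?E1 ?E2 \<subseteq> E" using ssum_least[OF sE hyp(2)[OF N1] hyp(2)[OF N2(1) N2']] .
    show "dim E \<le> dim (ssum ?E1 ?E2)" using dim_ssum[OF f1 f2] dI hyp(3)[OF N1] hyp(3)[OF N2(1) N2'] by linarith
  qed
  have "rd V ?E1 H \<le> rd V (?E1 \<inter> ?E2) H + 2"
    by (rule exceptional_drop[OF V f1 fH ex[OF N1] sI _ dI]) blast
  moreover have "rd V (?E1 \<inter> ?E2) H + rd V E H \<le> rd V ?E1 H + rd V ?E2 H"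
    using rd_submodular[OF V hyp(1)[OF N1] hyp(1)[OF N2(1) N2'], of H] sE' by simp
  ultimately show False using rd1 rd2 rds by linarith
qed

text \<open>A rectangle found in \<open>E\<close> times \<open>H\<close> is one unit short for
  \<open>E\<close> times \<open>D\<close>. In the case shut out by \<open>nsq\<close> the hyperplane
  \<open>H\<close> has dimension \<open>r\<close>, and the side \<open>Y\<close> could be
  zero.\<close>

lemma zero_drop_reduction:
  assumes IH: "classified k" and k: "dim E + dim D \<le> k"
    and V: "fdsub V" and E: "fdsub E" and D: "fdsub D" and ed: "dim E \<le> dim D" "r < dim E" "2 \<le> r"
    and rk: "\<And>M. M \<in> aff A V \<Longrightarrow> rk M E D \<le> r"
    and large: "dim D * r + dim E \<le> rd V E D + dim D + r"
    and H: "subspace H" "H \<subseteq> D" "dim H + 1 = dim D" and drop: "rd V E H = rd V E D"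
    and nsq: "dim E < dim D \<or> r + 1 < dim E"
  shows "compressed (aff A V) r E D \<or> exceptional A V r E D"
proof -
  have fH: "fdsub H" by (rule fdsub_subset[OF D H(1,2)])
  have "max (dim E) (dim H) * r + min (dim E) (dim H) \<le> rd V E H + max (dim E) (dim H) + r"
  proof (cases "dim E < dim D")
    case True
    then have mm: "max (dim E) (dim H) = dim H" "min (dim E) (dim H) = dim E" using H(3) by auto
    have "(dim H + 1) * r + dim E \<le> rd V E D + (dim H + 1) + r" using large H(3) by simp
    then show ?thesis unfolding mm drop using ed(3) by simp
  next
    case False
    then have mm: "max (dim E) (dim H) = dim E" "min (dim E) (dim H) = dim H" "dim E = dim D" using H(3) ed(1) by auto
    show ?thesis unfolding mm(1,2) drop using large H(3) mm(3) by simp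
  qed
  moreover have "dim E + dim H < k" using H(3) k by linarith
  moreover have "r \<le> min (dim E) (dim H)" using H(3) ed nsq by auto
  moreover have rk': "rk M E H \<le> r" if "M \<in> aff A V" for M
    using rk[OF that] rk_mono[OF E fdsub_subspace[OF E] subset_refl H(2), of M] by linarith
  ultimately have "compressed (aff A V) r E H \<or> exceptional A V r E H"
    using IH V E fH unfolding classified_def by blast
  then show ?thesis
  proof
    assume "compressed (aff A V) r E H"
    then obtain F Y where FY: "subspace F" "F \<subseteq> E" "subspace Y" "Y \<subseteq> H" "dim F + dim Y + r = dim E + dim H"
      "\<forall>M\<in>aff A V. vanish M F Y" by (rule compressedE)
    have le: "dim F \<le> dim E" "dim Y \<le> dim H" using fdsub_dim_mono[OF E FY(1,2)] fdsub_dim_mono[OF fH FY(3,4)] by auto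
    show ?thesis
    proof (rule compressed_or_exceptional_of_next[OF IH k V E D ed rk large FY(1,2,3)])
      show "Y \<subseteq> D" using FY(4) H(2) by auto
      show "1 \<le> dim F" "dim Y < dim D" "dim F + dim Y + r + 1 = dim E + dim D"
        using le FY(5) H(3) ed by linarith+
      show "1 \<le> dim Y" using le FY(5) H(3) ed nsq by linarith
    qed (use FY(6) in auto)
  next
    \<comment> \<open>Here \<open>dim D = 4\<close>, and the hypothesis asks for at least
      \<open>5\<close> dimensions, whereas the space has \<open>4\<close>.\<close>
    assume "exceptional A V r E H"
    then show ?thesis using large H(3) drop unfolding exceptional_def by auto
  qed
qed

text \<open>If no such form existed, restricting the evaluation pairing from \<open>E\<close> to
  \<open>K\<close> would not enlarge its radical among the forms, so \<open>crad\<close> would have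
  the same codimension in \<open>K\<close> as in \<open>E\<close>.\<close>

lemma linked_hyperplanes:
  assumes V: "fdsub V" and E: "fdsub E" and D: "fdsub D" and H: "subspace H" "H \<subseteq> D" "dim H + 1 = dim D"
    and K: "subspace K" "K \<subseteq> E" "dim K + 1 = dim E" and sub: "crad V E D H \<subseteq> K"
  obtains N where "N \<in> V" "vanish N E H" "vanish N K D" "\<not> vanish N E D"
proof -
  have "\<exists>N\<in>ann V E H. vanish N K D \<and> \<not> vanish N E D"
  proof (rule ccontr)
    assume a: "\<not> ?thesis"
    have "H \<noteq> D" using H by auto
    then obtain y where y: "y \<in> D" "y \<notin> H" using H by blast
    note fK = fdsub_subset[OF E K(1,2)]
    have "dim (ann V E H) + dim {x \<in> K. \<forall>N\<in>ann V E H. b N x y = 0} = dim K + dim {N \<in> ann V E H. \<forall>x\<in>K. b N x y = 0}"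
      by (rule dim_pairing[OF fdsub_ann[OF V] fK]) (auto simp: lin_form lin_left)
    moreover have e1: "{x \<in> K. \<forall>N\<in>ann V E H. b N x y = 0} = crad V E D H"
      using sub K(2) by (auto simp: crad_eq[OF D H y])
    moreover have e2: "{N \<in> ann V E H. \<forall>x\<in>K. b N x y = 0} = ann V E D"
    proof safe
      fix N assume N: "N \<in> ann V E H" "\<forall>x\<in>K. b N x y = 0"
      have "b N x z = 0" if "x \<in> K" "z \<in> D" for x z
        by (rule hyperplane_vanish[OF D H y _ _ that(2)]) (use N that K(2) in \<open>auto simp: ann_def vanish_def\<close>)
      then have "vanish N K D" by (auto simp: vanish_def)
      then have "vanish N E D" using a N(1) by blast
      then show "N \<in> ann V E D" using N(1) by (auto simp: ann_def)
    qed (use y H K(2) in \<open>auto simp: ann_def vanish_def\<close>)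
    ultimately have "dim (ann V E H) + dim (crad V E D H) = dim K + dim (ann V E D)" by simp
    then show False
      using dim_crad[OF V E D H] K(3) rd_ann[OF V, of E H] rd_ann[OF V, of E D] by linarith
  qed
  then show ?thesis using that by (auto simp: ann_def)
qed

lemma rd_less_of_form:
  assumes V: "fdsub V" and H: "H \<subseteq> D" and N: "N \<in> V" "vanish N E H" "\<not> vanish N E D"
  shows "rd V E H < rd V E D"
proof -
  have "ann V E D \<subseteq> ann V E H" using H by (rule ann_mono[OF subset_refl])
  moreover have "N \<in> ann V E H" "N \<notin> ann V E D" using N by (auto simp: ann_def)
  ultimately have "\<not> dim (ann V E H) \<le> dim (ann V E D)"
    using fdsub_dim_eq[OF fdsub_ann[OF V] subspace_ann[OF fdsub_subspace[OF V]], of E D E H] by blast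
  then show ?thesis using rd_ann[OF V, of E D] rd_ann[OF V, of E H] by linarith
qed

lemma rd_less_of_form_left:
  assumes "fdsub V" "K \<subseteq> E" "N \<in> V" "vanish N K D" "\<not> vanish N E D"
  shows "rd V K D < rd V E D"
  using form_space.rd_less_of_form[OF flip_form_space assms(1,2,3), of D] assms(4,5) by (simp add: rd_flip vanish_flip)

text \<open>The drop gives dimension at most one. If it were zero, \<open>linked_hyperplanes\<close>
  would yield a form vanishing on \<open>K\<close> times \<open>D\<close> but not on
  \<open>E\<close> times \<open>D\<close>, although restriction to \<open>K\<close> loses no
  dimension.\<close>

lemma dim_crad_eq_1:
  assumes V: "fdsub V" and E: "fdsub E" and D: "fdsub D" and n: "dim E = r + 1"
    and H: "subspace H" "H \<subseteq> D" "dim H + 1 = dim D" and drop: "rd V E H + r \<le> rd V E D"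
    and K: "subspace K" "K \<subseteq> E" "dim K + 1 = dim E" "rd V K D = rd V E D"
  shows "dim (crad V E D H) = 1" "subspace (crad V E D H)" "crad V E D H \<subseteq> E"
proof -
  show s: "subspace (crad V E D H)" "crad V E D H \<subseteq> E" using subspace_crad[OF fdsub_subspace[OF E]] by (auto simp: crad_def)
  have "dim (crad V E D H) \<noteq> 0"
  proof
    assume "dim (crad V E D H) = 0"
    then have "crad V E D H = {0}" using fdsub_dim_0[OF fdsub_subset[OF E s]] by blast
    then have "crad V E D H \<subseteq> K" using subspace_0[OF K(1)] by simp
    then obtain N where "N \<in> V" "vanish N E H" "vanish N K D" "\<not> vanish N E D" by (rule linked_hyperplanes[OF V E D H K(1-3)])
    then show False using rd_less_of_form_left[OF V K(2), of N D] K(4) by simp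
  qed
  then show "dim (crad V E D H) = 1" using dim_crad[OF V E D H] drop n by linarith
qed

section \<open>The square case of corank one\<close>

text \<open>All hyperplanes through some \<open>x\<^sub>0\<close> and some \<open>y\<^sub>0\<close> turn out to be the two kernels of a rank-one form in
  \<open>V\<close>. A form of maximal rank modulo these rank-one forms then has radical spanned by \<open>x\<^sub>0\<close> on the left or
  by \<open>y\<^sub>0\<close> on the right.\<close>

lemma rank_one_member_case:
  assumes V: "fdsub V" and E: "fdsub E" and D: "fdsub D" and n: "dim E = r + 1" "dim D = r + 1" "2 \<le> r"
    and rk: "\<And>M. M \<in> aff A V \<Longrightarrow> rk M E D \<le> r"
    and dropD: "\<And>H. subspace H \<Longrightarrow> H \<subseteq> D \<Longrightarrow> dim H + 1 = dim D \<Longrightarrow> rd V E H = rd V E D \<or> rd V E H + r \<le> rd V E D"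
    and dropE: "\<And>K. subspace K \<Longrightarrow> K \<subseteq> E \<Longrightarrow> dim K + 1 = dim E \<Longrightarrow> rd V K D = rd V E D \<or> rd V K D + r \<le> rd V E D"
    and H0: "subspace H0" "H0 \<subseteq> D" "dim H0 + 1 = dim D" "rd V E H0 = rd V E D"
    and K0: "subspace K0" "K0 \<subseteq> E" "dim K0 + 1 = dim E" "rd V K0 D = rd V E D"
    and one: "N1 \<in> V" "rk N1 E D = 1"
  shows "compressed (aff A V) r E D"
proof -
  interpret fl: form_space scale "\<lambda>N x y. b N y x" by (rule flip_form_space)
  have sV: "subspace V" and sE: "subspace E" and sD: "subspace D" using V E D fdsub_subspace by auto
  have crD: "dim (crad V E D H) = 1" "subspace (crad V E D H)" "crad V E D H \<subseteq> E"
    if H: "subspace H" "H \<subseteq> D" "dim H + 1 = dim D" and N: "N \<in> V" "vanish N E H" "\<not> vanish N E D" for H N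
  proof -
    have "rd V E H + r \<le> rd V E D" using dropD[OF H] rd_less_of_form[OF V H(2) N] by simp
    then show "dim (crad V E D H) = 1" "subspace (crad V E D H)" "crad V E D H \<subseteq> E"
      using dim_crad_eq_1[OF V E D n(1) H _ K0] by auto
  qed
  have crE: "dim (fl.crad V D E K) = 1" "subspace (fl.crad V D E K)" "fl.crad V D E K \<subseteq> D"
    if K: "subspace K" "K \<subseteq> E" "dim K + 1 = dim E" and N: "N \<in> V" "vanish N K D" "\<not> vanish N E D" for K N
  proof -
    have "rd V K D + r \<le> rd V E D" using dropE[OF K] rd_less_of_form_left[OF V K(2) N] by simp
    then show "dim (fl.crad V D E K) = 1" "subspace (fl.crad V D E K)" "fl.crad V D E K \<subseteq> D"
      using fl.dim_crad_eq_1[OF V D E n(2) K _ H0(1-3)] H0(4) by (auto simp: rd_flip)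
  qed
  have linkE: "\<exists>N. N \<in> V \<and> vanish N K D \<and> vanish N E H \<and> \<not> vanish N E D"
    if K: "subspace K" "K \<subseteq> E" "dim K + 1 = dim E" and H: "subspace H" "H \<subseteq> D" "dim H + 1 = dim D"
      and s: "fl.crad V D E K \<subseteq> H" for K H
    by (rule fl.linked_hyperplanes[OF V D E K H s]) (auto simp: vanish_flip)
  define H1 where "H1 = {y \<in> D. \<forall>x\<in>E. b N1 x y = 0}"
  have H1: "subspace H1" "H1 \<subseteq> D" "dim H1 + 1 = dim D" "vanish N1 E H1"
    using right_rad[OF E D, of N1] one(2) by (auto simp: H1_def vanish_def)
  have N1: "\<not> vanish N1 E D" using one(2) rk_0_iff[OF E, of N1 D] by simp
  note c1 = crD[OF H1(1-3) one(1) H1(4) N1]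
  note fc1 = fdsub_subset[OF E c1(2,3)]
  obtain x0 where x0: "x0 \<in> crad V E D H1" "x0 \<noteq> 0" using exists_nonzero[OF fc1] c1(1) by auto
  have sx0: "span {x0} = crad V E D H1" by (rule line_span[OF fc1 c1(1) x0])
  have x0E: "x0 \<in> E" using x0 c1(3) by blast
  have cK: "dim (fl.crad V D E K) = 1" "subspace (fl.crad V D E K)" "fl.crad V D E K \<subseteq> D"
    if K: "subspace K" "K \<subseteq> E" "dim K + 1 = dim E" and x: "x0 \<in> K" for K
  proof -
    have "crad V E D H1 \<subseteq> K" unfolding sx0[symmetric] using x K(1) by (intro span_minimal) auto
    then obtain N where "N \<in> V" "vanish N E H1" "vanish N K D" "\<not> vanish N E D"
      by (rule linked_hyperplanes[OF V E D H1(1-3) K])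
    then show "dim (fl.crad V D E K) = 1" "subspace (fl.crad V D E K)" "fl.crad V D E K \<subseteq> D"
      using crE[OF K] by auto
  qed
  have H0n: False if "N \<in> V" "vanish N E H0" "\<not> vanish N E D" for N
    using rd_less_of_form[OF V H0(2) that] H0(4) by simp
  have "dim (span {x0}) \<le> r" "r \<le> dim E" using dim_span_singleton[OF x0(2)] n by auto
  then obtain K1 where K1: "subspace K1" "span {x0} \<subseteq> K1" "K1 \<subseteq> E" "dim K1 = r"
    by (rule subspace_between[OF E, rotated 2]) (use c1(2,3) sx0 in auto)
  have x0K1: "x0 \<in> K1" using K1(2) span_base by blast
  have dK1: "dim K1 + 1 = dim E" using K1(4) n by simp
  note cK1 = cK[OF K1(1,3) dK1 x0K1]
  note fcK1 = fdsub_subset[OF D cK1(2,3)]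
  obtain y0 where y0: "y0 \<in> fl.crad V D E K1" "y0 \<noteq> 0" using exists_nonzero[OF fcK1] cK1(1) by auto
  have sy0: "span {y0} = fl.crad V D E K1" by (rule line_span[OF fcK1 cK1(1) y0])
  have y0D: "y0 \<in> D" using y0 cK1(3) by blast
  \<comment> \<open>Two different lines here would lead to a rank-one form vanishing on
    \<open>E\<close> times \<open>H0\<close>, although restriction to \<open>H0\<close> loses no
    dimension.\<close>
  have common: "fl.crad V D E K \<subseteq> span {y0}" if K: "subspace K" "K \<subseteq> E" "dim K + 1 = dim E" and x: "x0 \<in> K" for K
  proof (rule ccontr)
    assume no: "\<not> ?thesis"
    note c2 = cK[OF K x]
    note fc2 = fdsub_subset[OF D c2(2,3)]
    obtain y2 where y2: "y2 \<in> fl.crad V D E K" "y2 \<notin> span {y0}" using no by blast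
    have y20: "y2 \<noteq> 0" using y2(2) span_zero by blast
    have sy2: "span {y2} = fl.crad V D E K" by (rule line_span[OF fc2 c2(1) y2(1) y20])
    have y2D: "y2 \<in> D" using y2 c2(3) by blast
    have nH0: "y \<notin> H0" if K': "subspace K'" "K' \<subseteq> E" "dim K' + 1 = dim E" and s: "span {y} = fl.crad V D E K'" for y K'
    proof
      assume "y \<in> H0"
      then have "fl.crad V D E K' \<subseteq> H0" unfolding s[symmetric] using H0(1) by (intro span_minimal) auto
      then show False using linkE[OF K' H0(1-3)] H0n by blast
    qed
    have y0H: "y0 \<notin> H0" by (rule nH0[OF K1(1,3) dK1 sy0])
    have y2H: "y2 \<notin> H0" by (rule nH0[OF K sy2])
    obtain z c where z: "z \<in> H0" "y0 = z + scale c y2" by (rule hyperplane_decomp[OF D H0(1-3) y2D y2H y0D])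
    have fH0: "fdsub H0" by (rule fdsub_subset[OF D H0(1,2)])
    have z0: "z \<noteq> 0"
    proof
      assume "z = 0"
      then have y0c: "y0 = scale c y2" using z(2) by simp
      then have "c \<noteq> 0" using y0(2) by auto
      then have "y2 = scale (1 / c) y0" using y0c by simp
      then have "y2 \<in> span {y0}" by (metis span_base span_scale singletonI)
      then show False using y2(2) by simp
    qed
    \<comment> \<open>\<open>H0\<close> is \<open>G\<close> enlarged by \<open>z\<close>, while
      \<open>B y0\<close> and \<open>B y2\<close> are \<open>G\<close> enlarged by \<open>y0\<close>
      and by \<open>y2\<close>; neither of the latter contains \<open>z\<close>.\<close>
    obtain G where G: "subspace G" "{0} \<subseteq> G" "G \<subseteq> H0" "z \<notin> G" "dim G + 1 = dim H0"
      by (rule subspace_avoiding[OF fH0 subspace_single_0 _ z(1)]) (use z0 subspace_0[OF H0(1)] in auto)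
    note fG = fdsub_subset[OF fH0 G(1,3)]
    define B where "B y = ssum G (span {y})" for y
    have B: "subspace (B y)" "B y \<subseteq> D" "dim (B y) + 1 = dim D" "G \<subseteq> B y" "y \<in> B y" "z \<notin> B y" if y: "y \<in> D" "y \<notin> H0" for y
    proof -
      show sB: "subspace (B y)" unfolding B_def by (rule subspace_ssum[OF G(1)]) simp
      show "B y \<subseteq> D" unfolding B_def using G(3) H0(2) y sD by (intro ssum_least) (auto intro: span_minimal[THEN subsetD])
      have up: "G \<subseteq> B y \<and> span {y} \<subseteq> B y" unfolding B_def by (rule ssum_upper[OF G(1)]) simp
      then show "G \<subseteq> B y" "y \<in> B y" using span_base by blast+
      have "y \<notin> G" "y \<noteq> 0" using y(2) G(3) subspace_0[OF H0(1)] by auto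
      then show "dim (B y) + 1 = dim D"
        using dim_ssum[OF fG fdsub_span[of "{y}"]] Int_span_singleton[OF G(1), of y] dim_span_singleton[of y] fdsub_zero G(5) H0(3)
        by (simp add: B_def)
      show "z \<notin> B y"
      proof
        assume "z \<in> B y"
        then obtain g k where g: "g \<in> G" "z = g + scale k y" unfolding B_def by (auto elim!: ssumE simp: span_singleton)
        then have "scale k y = z - g" by simp
        then have "scale k y \<in> H0" using z(1) g(1) G(3) subspace_diff[OF H0(1)] by auto
        moreover have "scale k y \<in> span {y}" by (intro span_scale span_base) simp
        ultimately have "scale k y = 0" using Int_span_singleton[OF H0(1) y(2)] by blast
        then have "z = g" using g(2) by (simp only: add_0_right)
        then show False using g(1) G(4) by simp
      qed
    qed
    have cB: "dim (crad V E D (B y)) = 1" "subspace (crad V E D (B y))" "crad V E D (B y) \<subseteq> E"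
      if y: "y \<in> D" "y \<notin> H0" and K': "subspace K'" "K' \<subseteq> E" "dim K' + 1 = dim E" and s: "span {y} = fl.crad V D E K'" for y K'
    proof -
      note By = B[OF y]
      have "fl.crad V D E K' \<subseteq> B y" unfolding s[symmetric] using By(1,5) by (intro span_minimal) auto
      then obtain N where "N \<in> V" "vanish N K' D" "vanish N E (B y)" "\<not> vanish N E D"
        using linkE[OF K' By(1-3)] by blast
      then show "dim (crad V E D (B y)) = 1" "subspace (crad V E D (B y))" "crad V E D (B y) \<subseteq> E"
        using crD[OF By(1-3)] by auto
    qed
    note cB0 = cB[OF y0D y0H K1(1,3) dK1 sy0] and cB2 = cB[OF y2D y2H K sy2]
    \<comment> \<open>Both radicals are lines and \<open>2 \<le> r\<close>, so they fit into one
      hyperplane \<open>K3\<close>. The rank-one forms with right kernels \<open>B y0\<close> and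
      \<open>B y2\<close> can thus be chosen with the same left kernel.\<close>
    define P where "P = ssum (crad V E D (B y0)) (crad V E D (B y2))"
    have P: "subspace P" "P \<subseteq> E" "crad V E D (B y0) \<subseteq> P" "crad V E D (B y2) \<subseteq> P" "dim P \<le> r"
    proof -
      show "subspace P" unfolding P_def by (rule subspace_ssum[OF cB0(2) cB2(2)])
      show "P \<subseteq> E" unfolding P_def by (rule ssum_least[OF sE cB0(3) cB2(3)])
      show "crad V E D (B y0) \<subseteq> P" "crad V E D (B y2) \<subseteq> P" using ssum_upper[OF cB0(2) cB2(2)] by (auto simp: P_def)
      show "dim P \<le> r"
        using dim_ssum_le[OF fdsub_subset[OF E cB0(2,3)] fdsub_subset[OF E cB2(2,3)]] cB0(1) cB2(1) n(3) by (simp add: P_def)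
    qed
    have "r \<le> dim E" using n by simp
    then obtain K3 where K3: "subspace K3" "P \<subseteq> K3" "K3 \<subseteq> E" "dim K3 = r"
      by (rule subspace_between[OF E P(1,2,5)])
    have dK3: "dim K3 + 1 = dim E" using K3(4) n by simp
    have "K3 \<noteq> E" using dK3 by auto
    then obtain x3 where x3: "x3 \<in> E" "x3 \<notin> K3" using K3(3) by blast
    have ex: "\<exists>N. N \<in> V \<and> vanish N E (B y) \<and> vanish N K3 D \<and> (\<forall>w\<in>D. w \<notin> B y \<longrightarrow> b N x3 w \<noteq> 0)"
      if y: "y \<in> D" "y \<notin> H0" and s: "crad V E D (B y) \<subseteq> K3" for y
    proof -
      note By = B[OF y]
      obtain N where N: "N \<in> V" "vanish N E (B y)" "vanish N K3 D" "\<not> vanish N E D"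
        by (rule linked_hyperplanes[OF V E D By(1-3) K3(1,3) dK3 s])
      have "b N x3 w \<noteq> 0" if w: "w \<in> D" "w \<notin> B y" for w
      proof
        assume w0: "b N x3 w = 0"
        have x3v: "b N x3 u = 0" if "u \<in> D" for u
          by (rule hyperplane_vanish[OF D By(1-3) w _ w0 that]) (use N(2) x3(1) in \<open>auto simp: vanish_def\<close>)
        have "b N x u = 0" if "x \<in> E" "u \<in> D" for x u
          by (rule hyperplane_decomp[OF E K3(1,3) dK3 x3 that(1)]) (use N(3) x3v[OF that(2)] that in \<open>auto simp: form_simps vanish_def\<close>)
        then show False using N(4) by (auto simp: vanish_def)
      qed
      then show ?thesis using N by blast
    qed
    obtain N0 where N0: "N0 \<in> V" "vanish N0 E (B y0)" "vanish N0 K3 D" "\<forall>w\<in>D. w \<notin> B y0 \<longrightarrow> b N0 x3 w \<noteq> 0"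
      using ex[OF y0D y0H] P(3) K3(2) by blast
    obtain N2 where N2: "N2 \<in> V" "vanish N2 E (B y2)" "vanish N2 K3 D" "\<forall>w\<in>D. w \<notin> B y2 \<longrightarrow> b N2 x3 w \<noteq> 0"
      using ex[OF y2D y2H] P(4) K3(2) by blast
    note B0 = B[OF y0D y0H] and B2 = B[OF y2D y2H]
    \<comment> \<open>The coefficients cancel the value at \<open>(x3, z)\<close>; as both forms
      vanish on \<open>G\<close>, the combination vanishes on all of \<open>H0\<close>.\<close>
    define N where "N = scale (b N2 x3 z) N0 - scale (b N0 x3 z) N2"
    have NV: "N \<in> V" unfolding N_def using N0(1) N2(1) subspace_scale[OF sV] subspace_diff[OF sV] by blast
    have zD: "z \<in> D" using z(1) H0(2) by blast
    have Nx3: "b N x3 h = 0" if "h \<in> H0" for h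
    proof (rule hyperplane_vanish[OF fH0 G(1,3,5) z(1) G(4) _ _ that])
      show "b N x3 z = 0" by (simp add: N_def form_simps)
      fix g assume "g \<in> G"
      then have "g \<in> B y0" "g \<in> B y2" using B0(4) B2(4) by auto
      then have "b N0 x3 g = 0" "b N2 x3 g = 0" using vanishD[OF N0(2) x3(1)] vanishD[OF N2(2) x3(1)] by auto
      then show "b N x3 g = 0" by (simp add: N_def form_simps)
    qed
    have "b N x h = 0" if "x \<in> E" "h \<in> H0" for x h
      by (rule hyperplane_decomp[OF E K3(1,3) dK3 x3 that(1)])
        (use N0(3) N2(3) Nx3[OF that(2)] that H0(2) in \<open>auto simp: form_simps vanish_def N_def\<close>)
    then have v: "vanish N E H0" by (auto simp: vanish_def)
    have y0B2: "y0 \<notin> B y2"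
    proof
      assume "y0 \<in> B y2"
      then have "y0 - scale c y2 \<in> B y2" by (rule subspace_diff[OF B2(1) _ subspace_scale[OF B2(1,5)]])
      then show False using B2(6) z(2) by simp
    qed
    have "b N0 x3 y0 = 0" by (rule vanishD[OF N0(2) x3(1) B0(5)])
    then have "b N x3 y0 = - (b N0 x3 z * b N2 x3 y0)" by (simp add: N_def form_simps)
    moreover have "b N0 x3 z \<noteq> 0" "b N2 x3 y0 \<noteq> 0" using N0(4) N2(4) zD B0(6) y0D y0B2 by auto
    ultimately have "b N x3 y0 \<noteq> 0" by simp
    then have "\<not> vanish N E D" using x3(1) y0D by (auto simp: vanish_def)
    then show False using H0n[OF NV v] by blast
  qed
  have spx: "span {x0} \<subseteq> E" and spy: "span {y0} \<subseteq> D" using x0E y0D sE sD by (simp_all add: span_minimal)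
  \<comment> \<open>Moving \<open>M\<close> along directions that vanish on \<open>x0\<close> and on
    \<open>y0\<close> affects neither alternative of \<open>un\<close>.\<close>
  define U where "U = ann V {x0} D \<inter> ann V E {y0}"
  have sU: "subspace U" and UV: "U \<subseteq> V" 
    unfolding U_def using subspace_inter[OF subspace_ann[OF sV] subspace_ann[OF sV]] ann_subset by blast+
  have un: "vanish M {x0} D \<or> vanish M E {y0}" if M: "M \<in> aff A V" for M
  proof -
    let ?P = "\<lambda>L. \<exists>N. N \<in> U \<and> L = M + N"
    have P: "L \<in> aff A V" if "?P L" for L using that aff_translate[OF sV M] UV by blast
    have "?P M" using subspace_0[OF sU] by (intro exI[of _ 0]) auto
    then have "\<exists>M'. ?P M' \<and> (\<forall>L. ?P L \<longrightarrow> rk L E D \<le> rk M' E D)"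
      by (rule ex_has_greatest_nat[of ?P M "\<lambda>L. rk L E D" "r + 1"]) (use P rk in \<open>blast intro: le_less_trans less_add_one\<close>)
    then obtain M' where M': "?P M'" "\<And>L. ?P L \<Longrightarrow> rk L E D \<le> rk M' E D" by blast
    obtain N' where N': "N' \<in> U" "M' = M + N'" using M'(1) by blast
    have rM: "rk M' E D \<le> r" using rk[OF P[OF M'(1)]] .
    define Y where "Y = {y \<in> D. \<forall>x\<in>E. b M' x y = 0}"
    have sY: "subspace Y" "Y \<subseteq> D" "dim Y + rk M' E D = dim D"
      using right_rad[OF E D, of M'] by (auto simp: Y_def)
    \<comment> \<open>Otherwise a hyperplane through \<open>x0\<close> missing \<open>x\<close> and
      one through \<open>y0\<close> missing \<open>y\<close> are linked by a rank-one form in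
      \<open>U\<close>, and adding it to \<open>M'\<close> raises the rank.\<close>
    have "rad M' E D \<subseteq> span {x0} \<or> Y \<subseteq> span {y0}"
    proof (rule ccontr)
      assume "\<not> ?thesis"
      then obtain x y where xy: "x \<in> rad M' E D" "x \<notin> span {x0}" "y \<in> Y" "y \<notin> span {y0}" by blast
      have xE: "x \<in> E" and yD: "y \<in> D" using xy sY(2) by (auto simp: rad_def)
      obtain K where K: "subspace K" "span {x0} \<subseteq> K" "K \<subseteq> E" "x \<notin> K" "dim K + 1 = dim E"
        by (rule subspace_avoiding[OF E subspace_span spx xE xy(2)])
      obtain H where H: "subspace H" "span {y0} \<subseteq> H" "H \<subseteq> D" "y \<notin> H" "dim H + 1 = dim D"
        by (rule subspace_avoiding[OF D subspace_span spy yD xy(4)])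
      have x0K: "x0 \<in> K" using K(2) span_base by blast
      have "fl.crad V D E K \<subseteq> H" using common[OF K(1,3,5) x0K] H(2) by blast
      then obtain N where N: "N \<in> V" "vanish N K D" "vanish N E H" "\<not> vanish N E D"
        using linkE[OF K(1,3,5) H(1,3,5)] by blast
      have y0H: "y0 \<in> H" using H(2) span_base by blast
      have NU: "N \<in> U" using N x0K y0H by (auto simp: U_def ann_def vanish_def)
      have nz: "b N x y \<noteq> 0"
      proof
        assume 0: "b N x y = 0"
        have xv: "b N x u = 0" if "u \<in> D" for u
          by (rule hyperplane_vanish[OF D H(1,3,5) yD H(4) _ 0 that]) (use N(3) xE in \<open>auto simp: vanish_def\<close>)
        have "b N w u = 0" if "w \<in> E" "u \<in> D" for w u
          by (rule hyperplane_decomp[OF E K(1,3,5) xE K(4) that(1)]) (use N(2) xv[OF that(2)] that in \<open>auto simp: form_simps vanish_def\<close>)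
        then show False using N(4) by (auto simp: vanish_def)
      qed
      have "rk M' E D < rk (M' + N) E D"
        by (rule rk_add_rank_one[OF E D H(1,3,5) N(3) yD _ xy(1) nz]) (use xy(3) in \<open>auto simp: Y_def\<close>)
      moreover have "?P (M' + N)" using N'(2) subspace_add[OF sU N'(1) NU] by (intro exI[of _ "N' + N"]) (simp add: add.assoc)
      ultimately show False using M'(2) by fastforce
    qed
    then have "vanish M' {x0} D \<or> vanish M' E {y0}"
    proof
      assume s: "rad M' E D \<subseteq> span {x0}"
      have "dim (rad M' E D) \<ge> 1" using rk_rad[OF E, of M' D] rM n by linarith
      then have "rad M' E D = span {x0}"
        using fdsub_dim_eq[OF fdsub_span subspace_rad[OF sE] s] dim_span_singleton[OF x0(2)] by simp
      then have "x0 \<in> rad M' E D" using span_base by blast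
      then show ?thesis by (auto simp: rad_def vanish_def)
    next
      assume s: "Y \<subseteq> span {y0}"
      have "dim Y \<ge> 1" using sY(3) rM n by linarith
      then have "Y = span {y0}"
        using fdsub_dim_eq[OF fdsub_span sY(1) s] dim_span_singleton[OF y0(2)] by simp
      then have "y0 \<in> Y" using span_base by blast
      then show ?thesis by (auto simp: Y_def vanish_def)
    qed
    moreover have "vanish N' {x0} D" "vanish N' E {y0}" using N'(1) by (auto simp: U_def ann_def)
    ultimately show ?thesis unfolding N'(2) using vanish_diff[of "M + N'" _ _ N'] by auto
  qed
  have "(\<forall>M\<in>aff A V. vanish M {x0} D) \<or> (\<forall>M\<in>aff A V. vanish M E {y0})" by (rule aff_union[OF sV un])
  then show ?thesis
  proof
    assume a: "\<forall>M\<in>aff A V. vanish M {x0} D"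
    have "vanish M (span {x0}) D" if "M \<in> aff A V" for M
      using vanish_span[of M "{x0}" D] a that span_of_subspace[OF sD] by auto
    then show ?thesis using dim_span_singleton[OF x0(2)] n
      by (intro compressedI[OF subspace_span spx sD subset_refl]) auto
  next
    assume a: "\<forall>M\<in>aff A V. vanish M E {y0}"
    have "vanish M E (span {y0})" if "M \<in> aff A V" for M
      using vanish_span[of M E "{y0}"] a that span_of_subspace[OF sE] by auto
    then show ?thesis using dim_span_singleton[OF y0(2)] n
      by (intro compressedI[OF sE subset_refl subspace_span spy]) auto
  qed
qed

text \<open>A member vanishing on \<open>E\<close> times \<open>H\<close> has rank at most one,
  hence rank zero by \<open>free\<close>.\<close>

lemma rd_free_right:
  assumes E: "fdsub E" and D: "fdsub D" and H: "subspace H" "H \<subseteq> D" "dim H + 1 = dim D"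
    and free: "\<And>N. N \<in> U \<Longrightarrow> rk N E D \<noteq> 1"
  shows "rd U E H = rd U E D"
proof -
  have "ann U E H \<subseteq> ann U E D"
  proof
    fix N assume N: "N \<in> ann U E H"
    then have "rk N E D + dim E + dim H \<le> dim E + dim D"
      by (intro rk_le_vanish[OF E D fdsub_subspace[OF E] subset_refl H(1,2)]) (auto simp: ann_def)
    then have "rk N E D \<le> 1" using H(3) by linarith
    moreover have "rk N E D \<noteq> 1" using free N by (auto simp: ann_def)
    ultimately have "vanish N E D" using rk_0_iff[OF E, of N D] by linarith
    then show "N \<in> ann U E D" using N by (auto simp: ann_def)
  qed
  then have "ann U E H = ann U E D" using ann_mono[OF subset_refl H(2)] by blast
  then show ?thesis by (simp add: rd_def)
qed

lemma rd_free_left: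
  assumes E: "fdsub E" and D: "fdsub D" and K: "subspace K" "K \<subseteq> E" "dim K + 1 = dim E"
    and free: "\<And>N. N \<in> U \<Longrightarrow> rk N E D \<noteq> 1"
  shows "rd U K D = rd U E D"
  using form_space.rd_free_right[OF flip_form_space D E K, of U] free by (simp add: rk_flip[OF E D] rd_flip)

text \<open>By \<open>k\<close> the functional of \<open>N\<close> at \<open>x'\<close> is a
  multiple of that of \<open>M\<close> at \<open>x\<close>, and its zero at \<open>w\<close> makes
  the multiple zero.\<close>

lemma kernel_vanish:
  assumes k: "\<And>y. y \<in> D \<Longrightarrow> b M x y = 0 \<Longrightarrow> b N x' y = 0" and D: "subspace D"
    and w: "w \<in> D" "b M x w \<noteq> 0" "b N x' w = 0" and y: "y \<in> D"
  shows "b N x' y = 0"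
proof -
  let ?u = "y - scale (b M x y / b M x w) w"
  have "?u \<in> D" by (rule subspace_diff[OF D y subspace_scale[OF D w(1)]])
  moreover have "b M x ?u = 0" using w(2) by (simp add: form_simps)
  ultimately have "b N x' ?u = 0" by (rule k)
  then show ?thesis using w(3) by (simp add: form_simps)
qed

lemma dim_kernel_form:
  assumes D: "fdsub D"
  shows "subspace {y \<in> D. b M x y = 0}" "dim D \<le> dim {y \<in> D. b M x y = 0} + 1"
  using lin_on_kernel[OF fdsub_subspace[OF D] lin_right] dim_kernel_functional[OF D lin_right] by blast+

text \<open>Without forms of rank one, restriction to a hyperplane loses no dimension. This makes the forms
  annihilating a fixed vector \<open>x\<close> numerous enough for the induction hypothesis on a complement of \<open>x\<close> and
  the kernel of \<open>M(x, \<cdot>)\<close>, and too numerous for most vanishing rectangles.\<close>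

lemma rank_one_free_case:
  assumes IH: "classified k" and k: "dim E + dim D \<le> k"
    and V: "fdsub V" and E: "fdsub E" and D: "fdsub D" and n: "dim E = r + 1" "dim D = r + 1" "2 \<le> r"
    and rk: "\<And>M. M \<in> aff A V \<Longrightarrow> rk M E D \<le> r"
    and large: "r * r \<le> rd V E D"
    and free: "\<And>N. N \<in> V \<Longrightarrow> rk N E D \<noteq> 1"
  shows "compressed (aff A V) r E D"
proof -
  have sV: "subspace V" and sE: "subspace E" and sD: "subspace D" using V E D fdsub_subspace by auto
  obtain x where x: "x \<in> E" "x \<noteq> 0" by (rule exists_nonzero[OF E]) (use n in auto)
  define L where "L = span {x}"
  have L: "subspace L" "L \<subseteq> E" "dim L = 1" "x \<in> L"
    using x dim_span_singleton[OF x(2)] span_base[of x "{x}"] sE unfolding L_def by (simp_all add: span_minimal)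
  have fL: "fdsub L" by (rule fdsub_subset[OF E L(1,2)])
  have vL: "vanish N L Y \<longleftrightarrow> (\<forall>y\<in>Y. b N x y = 0)" for N Y
  proof
    assume "\<forall>y\<in>Y. b N x y = 0"
    then have "vanish N {x} Y" by (auto simp: vanish_def)
    then have "vanish N L (span Y)" using vanish_span by (simp add: L_def)
    then show "vanish N L Y" using vanish_mono span_superset by blast
  qed (use L(4) in \<open>auto simp: vanish_def\<close>)
  \<comment> \<open>Translation along \<open>U\<close> leaves the functional of a member at
    \<open>x\<close> unchanged, and at most \<open>r + 1\<close> dimensions are lost.\<close>
  define U where "U = ann V L D"
  have sU: "subspace U" and UV: "U \<subseteq> V" and fU: "fdsub U" using subspace_ann[OF sV] fdsub_ann[OF V] by (auto simp: U_def ann_def)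
  have UL: "vanish N L D" if "N \<in> U" for N using that by (auto simp: U_def ann_def)
  define nx where "nx = rd U E D"
  have split: "rd V E D = rd V L D + nx" unfolding nx_def U_def by (rule rd_restrict[OF V L(2) subset_refl])
  have "rd V L D \<le> r + 1" using rd_le_product[OF V fL D] L(3) n by simp
  then have nx: "r * r \<le> nx + r + 1" using split large by linarith
  have freeU: "rk N E D \<noteq> 1" if "N \<in> U" for N using free that UV by blast
  have nxR: "rd U E H = nx" if "subspace H" "H \<subseteq> D" "dim H + 1 = dim D" for H
    unfolding nx_def by (rule rd_free_right[OF E D that freeU])
  have nxL: "rd U K D = nx" if "subspace K" "K \<subseteq> E" "dim K + 1 = dim E" for K
    unfolding nx_def by (rule rd_free_left[OF E D that freeU])
  \<comment> \<open>\<open>L\<close> and \<open>F2\<close> fit into a hyperplane of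
    \<open>E\<close>, to which \<open>U\<close> restricts without loss; there \<open>L\<close> times
    \<open>D\<close> and \<open>F2\<close> times \<open>Y2\<close> are both zero.\<close>
  have count: "nx + (r + 1) + dim F2 * dim Y2 \<le> r * (r + 1)"
    if F2: "subspace F2" "F2 \<subseteq> E" "L \<inter> F2 = {0}" "dim F2 + 1 \<le> r" and Y2: "subspace Y2" "Y2 \<subseteq> D"
      and v: "\<And>N. N \<in> U \<Longrightarrow> vanish N F2 Y2" for F2 Y2
  proof -
    have "dim (ssum L F2) \<le> r" using dim_ssum[OF fL fdsub_subset[OF E F2(1,2)]] F2(3,4) L(3) fdsub_zero by simp
    moreover have "r \<le> dim E" using n by simp
    ultimately obtain K where K: "subspace K" "ssum L F2 \<subseteq> K" "K \<subseteq> E" "dim K = r"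
      by (rule subspace_between[OF E subspace_ssum[OF L(1) F2(1)] ssum_least[OF sE L(2) F2(2)]])
    have s: "L \<subseteq> K" "F2 \<subseteq> K" using ssum_upper[OF L(1) F2(1)] K(2) by auto
    have "rd U K D + dim L * dim D + dim F2 * dim Y2 \<le> dim K * dim D + dim (L \<inter> F2) * dim (D \<inter> Y2)"
      by (rule rd_vanish_two[OF fU fdsub_subset[OF E K(1,3)] D L(1) s(1) F2(1) s(2) sD subset_refl Y2 UL v])
    moreover have "rd U K D = nx" by (rule nxL[OF K(1,3)]) (use K n in simp)
    ultimately show ?thesis using L(3) K(4) n F2(3) fdsub_zero by simp
  qed
  have line: "L \<inter> span {z} = {0}" if "z \<notin> L" for z by (rule Int_span_singleton[OF L(1) that])
  have NV: "\<exists>N\<in>U. \<exists>y\<in>D. b N z y \<noteq> 0" if z: "z \<in> E" "z \<notin> L" for z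
  proof (rule ccontr)
    assume "\<not> ?thesis"
    then have zz: "b N z y = 0" if "N \<in> U" "y \<in> D" for N y using that by blast
    have v: "vanish N (span {z}) D" if "N \<in> U" for N
      by (rule vanish_span_left[OF sD]) (use zz[OF that] in \<open>auto simp: vanish_def\<close>)
    have "z \<noteq> 0" using z(2) subspace_0[OF L(1)] by blast
    then have d: "dim (span {z}) = 1" by (rule dim_span_singleton)
    have "nx + (r + 1) + dim (span {z}) * dim D \<le> r * (r + 1)"
      by (rule count[OF subspace_span _ line[OF z(2)] _ sD subset_refl v]) (use z sE d n in \<open>simp_all add: span_minimal\<close>)
    then show False using d n nx by simp
  qed
  \<comment> \<open>In \<open>?T1\<close> every form of \<open>U\<close> has at \<open>z\<close> a
    functional proportional to that of \<open>M\<close> at \<open>x\<close>. In \<open>?T2\<close>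
    the vector \<open>h\<close> is in the right radical of \<open>M\<close> and of all of
    \<open>U\<close>.\<close>
  let ?T1 = "\<lambda>M z. z \<in> E \<and> z \<notin> L \<and> (\<forall>N\<in>U. \<forall>y\<in>D. b M x y = 0 \<longrightarrow> b N z y = 0)"
  let ?T2 = "\<lambda>M h. h \<in> D \<and> h \<noteq> 0 \<and> vanish M E {h} \<and> (\<forall>N\<in>U. vanish N E {h})"
  \<comment> \<open>On \<open>aff M U\<close> the functional at \<open>x\<close> is fixed, so the
    block of \<open>E1\<close> against its kernel \<open>H\<close> is always singular. The induction
    hypothesis gives a rectangle of half-perimeter \<open>r + 1\<close> in it, and
    \<open>count\<close> admits only the two extreme shapes.\<close>
  have dich: "(\<exists>h. ?T2 M h) \<or> (\<exists>z. ?T1 M z)" if M: "M \<in> aff A V" and w: "w \<in> D" "b M x w \<noteq> 0" for M w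
  proof -
    define H where "H = {y \<in> D. b M x y = 0}"
    have H: "subspace H" "H \<subseteq> D" using dim_kernel_form(1)[OF D] by (auto simp: H_def)
    have "H \<noteq> D" using w by (auto simp: H_def)
    then have "\<not> dim D \<le> dim H" using fdsub_dim_eq[OF D H] by blast
    then have dH: "dim H + 1 = dim D" using dim_kernel_form(2)[OF D, of M x] unfolding H_def by linarith
    obtain E1 where E1: "subspace E1" "E1 \<subseteq> E" "L \<inter> E1 = {0}" "ssum L E1 = E" "dim L + dim E1 = dim E"
      by (rule complement_exists[OF E L(1,2)])
    have dE1: "dim E1 = r" "dim H = r" using E1(5) L(3) n dH by auto
    note fE1 = fdsub_subset[OF E E1(1,2)] and fH = fdsub_subset[OF D H]
    have mm: "max (dim E1) (dim H) = r" "min (dim E1) (dim H) = r" using dE1 by auto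
    have sing: "rk M' E1 H < min (dim E1) (dim H)" if M': "M' \<in> aff M U" for M'
    proof -
      obtain N where N: "N \<in> U" "M' = M + N" using M' by (auto simp: aff_def)
      then have bx: "b M' x y = b M x y" if "y \<in> D" for y using vanishD[OF UL[OF N(1)] L(4) that] by (simp add: form_simps)
      have "vanish M' L H" unfolding vL using bx H(2) by (auto simp: H_def)
      then have "rk M' L D + rk M' E1 H \<le> rk M' E D"
        by (rule rk_blocks[OF E sD L(1,2) H(2) _ E1(1,2) subset_refl])
      moreover have "rk M' E D \<le> r" using rk aff_subset[OF sV M UV] M' by blast
      moreover have "\<not> vanish M' L D" unfolding vL using bx w by auto
      then have "rk M' L D \<noteq> 0" using rk_0_iff[OF fL] by blast
      ultimately show ?thesis unfolding mm by linarith
    qed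
    have rdE1: "rd U E1 H = nx"
    proof -
      have "rd U E H \<le> rd U L H + rd U E1 H" using rd_ssum_left[OF fU L(1) E1(1), of H] E1(4) by simp
      moreover have "ann U L H = U" using UL vanish_mono[OF _ subset_refl H(2)] by (auto simp: ann_def)
      then have "rd U L H = 0" by (simp add: rd_def)
      moreover have "rd U E1 H \<le> rd U E H" by (rule rd_mono[OF fU E1(2) subset_refl])
      ultimately show ?thesis using nxR[OF H dH] by linarith
    qed
    have "min (dim E1) (dim H) = 1 \<or> dim E1 * dim H + 1 \<le> rd U E1 H + 2 * max (dim E1) (dim H)"
      unfolding rdE1 mm dE1 using nx n by linarith
    moreover have "dim E1 = 3 \<Longrightarrow> dim H = 3 \<Longrightarrow> rd U E1 H \<noteq> 4" unfolding rdE1 using nx dE1 by auto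
    moreover have "dim E1 + dim H < k" using dE1 n k by simp
    moreover have "1 \<le> min (dim E1) (dim H)" unfolding mm using n by simp
    ultimately obtain F Y where FY: "subspace F" "F \<subseteq> E1" "subspace Y" "Y \<subseteq> H" "dim F + dim Y = max (dim E1) (dim H) + 1"
      "\<And>M'. M' \<in> aff M U \<Longrightarrow> vanish M' F Y"
      using classified_singular[OF IH _ fU fE1 fH _ sing] by blast
    have UFY: "vanish N F Y" if "N \<in> U" for N by (rule vanish_aff_direction[OF sU FY(6) that])
    have le: "dim F \<le> r" "dim Y \<le> r" using fdsub_dim_mono[OF fE1 FY(1,2)] fdsub_dim_mono[OF fH FY(3,4)] dE1 by auto
    have s: "dim F + dim Y = r + 1" using FY(5) mm by simp
    have LF: "L \<inter> F = {0}" using FY(2) E1(3) subspace_0[OF L(1)] subspace_0[OF FY(1)] by blast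
    have FE: "F \<subseteq> E" and YD: "Y \<subseteq> D" using FY(2,4) E1(2) H(2) by auto
    have "dim F = r \<or> dim F = 1"
    proof (rule ccontr)
      assume a: "\<not> ?thesis"
      then have "dim F + 1 \<le> r" "2 \<le> dim F" "2 \<le> dim Y" using le s by linarith+
      then have "nx + (r + 1) + dim F * dim Y \<le> r * (r + 1)" using count[OF FY(1) FE LF _ FY(3) YD UFY] by blast
      then have "dim F * dim Y \<le> r" using nx by simp
      moreover obtain f y where fy: "dim F = f + 2" "dim Y = y + 2" using le_Suc_ex[OF \<open>2 \<le> dim F\<close>] le_Suc_ex[OF \<open>2 \<le> dim Y\<close>] by (auto simp: add.commute)
      moreover have "r = f + y + 3" using s fy by simp
      ultimately show False by (simp add: algebra_simps)
    qed
    then show ?thesis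
    proof
      assume f: "dim F = r"
      then have FE1: "F = E1" using fdsub_dim_eq[OF fE1 FY(1,2)] dE1 by simp
      have dY: "dim Y = 1" using f s by simp
      then obtain h where h: "h \<in> Y" "h \<noteq> 0" using exists_nonzero[OF fdsub_subset[OF fH FY(3,4)]] by auto
      have hD: "h \<in> D" "b M x h = 0" using h(1) FY(4) by (auto simp: H_def)
      have "vanish M E1 {h}" using FY(6)[OF aff_base[OF sU]] h(1) FE1 by (auto simp: vanish_def)
      moreover have "vanish M L {h}" unfolding vL using hD by simp
      ultimately have "vanish M E {h}" using vanish_ssum_left[of M L "{h}" E1] E1(4) by simp
      moreover have "vanish N E {h}" if N: "N \<in> U" for N
      proof -
        have "vanish N E1 {h}" using UFY[OF N] h(1) FE1 by (auto simp: vanish_def)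
        moreover have "vanish N L {h}" using UL[OF N] hD(1) by (auto simp: vanish_def)
        ultimately show ?thesis using vanish_ssum_left[of N L "{h}" E1] E1(4) by simp
      qed
      ultimately show ?thesis using hD h(2) by blast
    next
      assume f: "dim F = 1"
      then have "dim Y = dim H" using s dE1 by simp
      then have YH: "Y = H" using fdsub_dim_eq[OF fH FY(3,4)] by simp
      obtain z where z: "z \<in> F" "z \<noteq> 0" using exists_nonzero[OF fdsub_subset[OF E FY(1) FE]] f by auto
      have "z \<notin> L" using z LF by blast
      then show ?thesis using z(1) FE UFY YH unfolding H_def vanish_def by blast
    qed
  qed
  \<comment> \<open>Two independent vectors killed by \<open>U\<close>, together with
    \<open>L\<close>, would cost more dimensions on a hyperplane of \<open>D\<close> containing them
    than are missing.\<close>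
  have etaU: "h2 \<in> span {h1}" if h1: "h1 \<in> D" "h1 \<noteq> 0" "\<forall>N\<in>U. vanish N E {h1}" and h2: "h2 \<in> D" "\<forall>N\<in>U. vanish N E {h2}" for h1 h2
  proof (rule ccontr)
    assume no: "h2 \<notin> span {h1}"
    define P where "P = span {h1, h2}"
    have dP: "dim P = 2" using dim_span_pair[OF h1(2) no] by (simp add: P_def)
    have sP: "subspace P" "P \<subseteq> D" using h1(1) h2(1) sD unfolding P_def by (simp_all add: span_minimal)
    have "dim P \<le> r" "r \<le> dim D" using dP n by auto
    then obtain H where H: "subspace H" "P \<subseteq> H" "H \<subseteq> D" "dim H = r" by (rule subspace_between[OF D sP])
    have v: "vanish N E P" if "N \<in> U" for N
    proof -
      have "vanish N E {h1, h2}" using h1(3) h2(2) that by (auto simp: vanish_def)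
      then show ?thesis unfolding P_def by (rule vanish_span_right[OF sE])
    qed
    have vH: "vanish N L H" if "N \<in> U" for N using UL[OF that] H(3) vanish_mono by blast
    have "rd U E H + dim L * dim H + dim E * dim P \<le> dim E * dim H + dim (L \<inter> E) * dim (H \<inter> P)"
      by (rule rd_vanish_two[OF fU E fdsub_subset[OF D H(1,3)] L(1,2) sE subset_refl H(1) subset_refl sP(1) H(2) vH v])
    moreover have "L \<inter> E = L" "H \<inter> P = P" using L(2) H(2) by auto
    moreover have "rd U E H = nx" by (rule nxR[OF H(1,3)]) (use H n in simp)
    ultimately show False using L(3) dP H(4) n nx by simp
  qed
  have zeroL: ?thesis if a: "\<And>M. M \<in> aff A V \<Longrightarrow> vanish M L D"
    by (rule compressedI[OF L(1,2) sD subset_refl _ a]) (use L(3) n in auto)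
  show ?thesis
  proof (cases "\<forall>M\<in>aff A V. \<forall>w\<in>D. b M x w \<noteq> 0 \<longrightarrow> (\<exists>h. ?T2 M h)")
    case True
    show ?thesis
    proof (cases "\<forall>M\<in>aff A V. vanish M L D")
      case False
      then obtain M0 where "M0 \<in> aff A V" "\<not> vanish M0 L D" by blast
      then obtain h0 where h0: "?T2 M0 h0" using True unfolding vL by blast
      have un: "vanish M L D \<or> vanish M E (span {h0})" if M: "M \<in> aff A V" for M
      proof (cases "vanish M L D")
        case False
        then obtain h where h: "?T2 M h" using True M unfolding vL by blast
        then have "h0 \<in> span {h}" using etaU[of h h0] h0 by blast
        then have "span {h0} \<subseteq> span {h}" by (intro span_minimal) auto
        moreover have "vanish M E (span {h})" using vanish_span_right[OF sE, of M "{h}"] h by blast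
        ultimately show ?thesis using vanish_mono by blast
      qed simp
      have "(\<forall>M\<in>aff A V. vanish M L D) \<or> (\<forall>M\<in>aff A V. vanish M E (span {h0}))" by (rule aff_union[OF sV un])
      then show ?thesis
      proof
        assume a: "\<forall>M\<in>aff A V. vanish M E (span {h0})"
        have "span {h0} \<subseteq> D" using h0 sD by (intro span_minimal) auto
        moreover have "dim (span {h0}) = 1" using h0 dim_span_singleton by blast
        ultimately show ?thesis using a n by (intro compressedI[OF sE subset_refl subspace_span]) auto
      qed (use zeroL in blast)
    qed (use zeroL in blast)
  next
    case False
    then obtain M1 w1 where M1: "M1 \<in> aff A V" "w1 \<in> D" "b M1 x w1 \<noteq> 0" "\<not> (\<exists>h. ?T2 M1 h)" by blast
    then obtain z1 where z1: "?T1 M1 z1" using dich by blast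
    define D1 where "D1 = {y \<in> D. b M1 x y = 0}"
    have D1: "subspace D1" "D1 \<subseteq> D" "r \<le> dim D1" using dim_kernel_form[OF D, of M1 x] n by (auto simp: D1_def)
    have z10: "z1 \<noteq> 0" using z1 subspace_0[OF L(1)] by blast
    have v1: "vanish N (span {z1}) D1" if "N \<in> U" for N
      by (rule vanish_span_left[OF D1(1)]) (use that z1 in \<open>auto simp: vanish_def D1_def\<close>)
    have sz1: "span {z1} \<subseteq> E" using z1 sE by (intro span_minimal) auto
    have "nx + (r + 1) + dim (span {z1}) * dim D1 \<le> r * (r + 1)"
      by (rule count[OF subspace_span sz1 line _ D1(1,2) v1]) (use z1 dim_span_singleton[OF z10] n in auto)
    \<comment> \<open>The rectangle from \<open>?T1\<close> makes \<open>nx\<close> so small that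
      the directions realise all functionals at \<open>x\<close>.\<close>
    then have full: "r + 1 \<le> rd V L D" using D1(3) dim_span_singleton[OF z10] split large by simp
    have onto: "\<exists>M\<in>aff A V. b M x w \<noteq> 0" if w: "w \<in> D" "w \<noteq> 0" for w
    proof (rule ccontr)
      assume "\<not> ?thesis"
      then have a: "vanish M L {w}" if "M \<in> aff A V" for M unfolding vL using that by auto
      have sw: "span {w} \<subseteq> D" using w sD by (intro span_minimal) auto
      have "vanish N L (span {w})" if "N \<in> V" for N
        by (rule vanish_span_right[OF L(1) vanish_aff_direction[OF sV a that]])
      then have "rd V L D \<le> dim L * (dim D - dim (span {w}))" by (intro rd_le_quotient[OF V fL D subspace_span sw])
      then show False using full L(3) n dim_span_singleton[OF w(2)] by simp
    qed
    \<comment> \<open>A member \<open>M'\<close> that is nonzero at \<open>(x, h)\<close> fits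
      neither alternative: with \<open>?T2\<close> the vector \<open>h\<close> would lie in its
      right radical, and with \<open>?T1\<close> all of \<open>U\<close> would vanish at
      \<open>z\<close>.\<close>
    have noT2: "\<not> ?T2 M h" if M: "M \<in> aff A V" for M h
    proof
      assume h: "?T2 M h"
      then obtain M' where M': "M' \<in> aff A V" "b M' x h \<noteq> 0" using onto by blast
      have "(\<exists>h'. ?T2 M' h') \<or> (\<exists>z. ?T1 M' z)" using dich[OF M'(1)] h M'(2) by blast
      then show False
      proof
        assume "\<exists>h'. ?T2 M' h'"
        then obtain h' where h': "?T2 M' h'" by blast
        have "h \<in> span {h'}" using etaU[of h' h] h h' by blast
        moreover have "vanish M' E (span {h'})" using vanish_span_right[OF sE, of M' "{h'}"] h' by blast
        ultimately show False using M'(2) x(1) by (auto simp: vanish_def)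
      next
        assume "\<exists>z. ?T1 M' z"
        then obtain z where z: "?T1 M' z" by blast
        have "b N z y = 0" if N: "N \<in> U" and y: "y \<in> D" for N y
          by (rule kernel_vanish[of D M' x N z h]) (use z N y h M'(2) sD in \<open>auto simp: vanish_def\<close>)
        then show False using NV[of z] z by blast
      qed
    qed
    have T1: "\<exists>z. ?T1 M z" if "M \<in> aff A V" "w \<in> D" "b M x w \<noteq> 0" for M w
      using dich[OF that] noT2[OF that(1)] by blast
    have kv: "b M x w = 0 \<or> \<not> (\<forall>N\<in>U. b N z w = 0)" if "?T1 M z" "w \<in> D" for M z w
    proof (rule ccontr)
      assume a: "\<not> ?thesis"
      have "b N z y = 0" if "N \<in> U" "y \<in> D" for N y
        by (rule kernel_vanish[of D M x N z w]) (use \<open>?T1 M z\<close> \<open>w \<in> D\<close> a that sD in auto)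
      then show False using NV[of z] \<open>?T1 M z\<close> by blast
    qed
    \<comment> \<open>\<open>w1\<close>, \<open>y1\<close> and \<open>y2\<close> exhibit the
      functionals of \<open>M1\<close>, \<open>M2\<close> and \<open>M3\<close> at \<open>x\<close>
      as a triangular, hence independent, system.\<close>
    note fD1 = fdsub_subset[OF D D1(1,2)]
    have "0 < dim D1" using D1(3) n by linarith
    then obtain y1 where y1: "y1 \<in> D1" "y1 \<noteq> 0" by (rule exists_nonzero[OF fD1])
    have y1D: "y1 \<in> D" "b M1 x y1 = 0" using y1 by (auto simp: D1_def)
    obtain M2 where M2: "M2 \<in> aff A V" "b M2 x y1 \<noteq> 0" using onto[OF y1D(1) y1(2)] by blast
    obtain z2 where z2: "?T1 M2 z2" using T1[OF M2(1) y1D(1) M2(2)] by blast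
    define D12 where "D12 = {y \<in> D1. b M2 x y = 0}"
    have D12: "subspace D12" "D12 \<subseteq> D1" "r \<le> dim D12 + 1" using dim_kernel_form[OF fD1, of M2 x] D1(3) by (auto simp: D12_def)
    note fD12 = fdsub_subset[OF fD1 D12(1,2)]
    have "0 < dim D12" using D12(3) n by linarith
    then obtain y2 where y2: "y2 \<in> D12" "y2 \<noteq> 0" by (rule exists_nonzero[OF fD12])
    have y2D: "y2 \<in> D" "b M1 x y2 = 0" "b M2 x y2 = 0" using y2 by (auto simp: D12_def D1_def)
    obtain M3 where M3: "M3 \<in> aff A V" "b M3 x y2 \<noteq> 0" using onto[OF y2D(1) y2(2)] by blast
    obtain z3 where z3: "?T1 M3 z3" using T1[OF M3(1) y2D(1) M3(2)] by blast
    define P where "P = ssum L (span {z1})"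
    have P: "subspace P" "P \<subseteq> E" unfolding P_def using subspace_ssum[OF L(1)] ssum_least[OF sE L(2) sz1] by auto
    have dP: "dim P = 2"
      using dim_ssum[OF fL fdsub_span[of "{z1}"]] line[of z1] z1 L(3) dim_span_singleton[OF z10] fdsub_zero by (simp add: P_def)
    have z2P: "z2 \<notin> P"
    proof
      assume "z2 \<in> P"
      then obtain l c where l: "l \<in> L" "z2 = l + scale c z1" unfolding P_def by (auto elim!: ssumE simp: span_singleton)
      have "c \<noteq> 0" using z2 l by auto
      moreover have "b N z2 y1 = c * b N z1 y1" if "N \<in> U" for N using vanishD[OF UL[OF that] l(1) y1D(1)] l(2) by (simp add: form_simps)
      moreover have "b N z1 y1 = 0" if "N \<in> U" for N using z1 that y1D by blast
      ultimately have "b N z2 y1 = 0" if "N \<in> U" for N using that by simp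
      then show False using kv[OF z2 y1D(1)] M2(2) by blast
    qed
    have z20: "z2 \<noteq> 0" using z2P subspace_0[OF P(1)] by blast
    define P3 where "P3 = ssum P (span {z2})"
    have sz2: "span {z2} \<subseteq> E" using z2 sE by (intro span_minimal) auto
    have P3: "subspace P3" "P3 \<subseteq> E" unfolding P3_def using subspace_ssum[OF P(1)] ssum_least[OF sE P(2) sz2] by auto
    have dP3: "dim P3 = 3"
      using dim_ssum[OF fdsub_subset[OF E P] fdsub_span[of "{z2}"]] Int_span_singleton[OF P(1) z2P] dP dim_span_singleton[OF z20] fdsub_zero
      by (simp add: P3_def)
    \<comment> \<open>For \<open>3 \<le> r\<close> the plane of \<open>z1\<close> and
      \<open>z2\<close> against the common kernel \<open>D12\<close> is a vanishing rectangle that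
      \<open>count\<close> forbids.\<close>
    have "r = 2"
    proof (rule ccontr)
      assume "r \<noteq> 2"
      then have r3: "3 \<le> r" using n by linarith
      define F2 where "F2 = span {z1, z2}"
      have z12: "z2 \<notin> span {z1}" using z2P ssum_upper[OF L(1) subspace_span, of "{z1}"] by (auto simp: P_def)
      have dF2: "dim F2 = 2" using dim_span_pair[OF z10 z12] by (simp add: F2_def)
      have F2E: "F2 \<subseteq> E" using z1 z2 sE unfolding F2_def by (intro span_minimal) auto
      have LF2: "L \<inter> F2 = {0}"
      proof -
        have "w = 0" if w: "w \<in> L" "w \<in> F2" for w
        proof -
          obtain a c where ac: "w = scale a z1 + scale c z2"
          proof -
            have "F2 = ssum (span {z1}) (span {z2})" using span_Un[of "{z1}" "{z2}"] by (simp add: F2_def ssum_def insert_commute)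
            then show ?thesis using w(2) that by (auto elim!: ssumE simp: span_singleton)
          qed
          have "scale c z2 \<in> P"
          proof -
            have "scale c z2 = w - scale a z1" using ac by simp
            moreover have "w \<in> P" "scale a z1 \<in> P"
              using ssum_upper[OF L(1) subspace_span, of "{z1}"] w(1) span_scale[OF span_base, of z1 "{z1}" a] by (auto simp: P_def)
            ultimately show ?thesis using subspace_diff[OF P(1)] by simp
          qed
          moreover have "scale c z2 \<in> span {z2}" by (intro span_scale span_base) simp
          ultimately have "scale c z2 = 0" using Int_span_singleton[OF P(1) z2P] by blast
          then have "w = scale a z1" using ac by (simp only: add_0_right)
          moreover have "scale a z1 \<in> span {z1}" by (intro span_scale span_base) simp
          ultimately show "w = 0" using line[of z1] z1 w(1) by blast
        qed
        then show ?thesis using subspace_0[OF L(1)] span_zero by (auto simp: F2_def)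
      qed
      have v2: "vanish N F2 D12" if "N \<in> U" for N
      proof -
        have "vanish N {z1, z2} D12" using z1 z2 that by (auto simp: vanish_def D12_def D1_def)
        then show ?thesis unfolding F2_def by (rule vanish_span_left[OF D12(1)])
      qed
      have "D12 \<subseteq> D" using D12(2) D1(2) by blast
      then have "nx + (r + 1) + dim F2 * dim D12 \<le> r * (r + 1)"
        using count[OF _ F2E LF2 _ D12(1) _ v2] dF2 r3 by (simp add: F2_def)
      then show False using dF2 D12(3) nx r3 by simp
    qed
    then have "P3 = E" using fdsub_dim_eq[OF E P3] dP3 n by simp
    then have "z3 \<in> ssum (ssum L (span {z1})) (span {z2})" using z3 by (simp add: P3_def P_def)
    then obtain l a c where l: "l \<in> L" "z3 = l + scale a z1 + scale c z2"
      by (auto elim!: ssumE simp: span_singleton)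
    have z3e: "a * b N z1 y + c * b N z2 y = b N z3 y" if "N \<in> U" "y \<in> D" for N y
      using vanishD[OF UL[OF that(1)] l(1) that(2)] l(2) by (simp add: form_simps)
    \<comment> \<open>Modulo \<open>L\<close> the vector \<open>z3\<close> is a combination of
      \<open>z1\<close> and \<open>z2\<close>, but for each form of \<open>U\<close> the three
      functionals are multiples of independent ones. Evaluation at a suitable vector makes one of
      them zero throughout \<open>U\<close>, against \<open>NV\<close>.\<close>
    show ?thesis
    proof (cases "a = 0")
      case True
      have "c \<noteq> 0"
      proof
        assume "c = 0"
        then have "z3 = l" using l(2) True by simp
        then show False using z3 l(1) by blast
      qed
      have "b N z2 y2 = 0" if "N \<in> U" for N using z2 that y2D by blast
      then have "b N z3 y2 = 0" if "N \<in> U" for N using z3e[OF that y2D(1)] True that by simp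
      then show ?thesis using kv[OF z3 y2D(1)] M3(2) by blast
    next
      case False
      \<comment> \<open>\<open>w1\<close> is corrected by \<open>y1\<close> and \<open>y2\<close>
        into the kernels of \<open>M2\<close> and \<open>M3\<close> at \<open>x\<close>, keeping its
        value under \<open>M1\<close>.\<close>
      define w2 where "w2 = w1 - scale (b M2 x w1 / b M2 x y1) y1"
      define w3 where "w3 = w2 - scale (b M3 x w2 / b M3 x y2) y2"
      have wD: "w3 \<in> D" unfolding w3_def w2_def using M1(2) y1D(1) y2D(1) sD by (intro subspace_diff subspace_scale)
      have "b M2 x w3 = 0" "b M3 x w3 = 0" "b M1 x w3 = b M1 x w1"
        using M2(2) M3(2) y1D y2D by (simp_all add: w3_def w2_def form_simps)
      then have "b N z2 w3 = 0" "b N z3 w3 = 0" if "N \<in> U" for N using z2 z3 that wD by blast+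
      then have "b N z1 w3 = 0" if "N \<in> U" for N using z3e[OF that wD] False that by simp
      then show ?thesis using kv[OF z1 wD] \<open>b M1 x w3 = b M1 x w1\<close> M1(3) by auto
    qed
  qed
qed

section \<open>The induction\<close>

lemma classification_step:
  assumes IH: "classified k" and k: "dim E + dim D \<le> k"
    and V: "fdsub V" and E: "fdsub E" and D: "fdsub D" and ed: "dim E \<le> dim D" "r \<le> dim E"
    and rk: "\<And>M. M \<in> aff A V \<Longrightarrow> rk M E D \<le> r"
    and large: "dim D * r + dim E \<le> rd V E D + dim D + r"
  shows "compressed (aff A V) r E D \<or> exceptional A V r E D"
proof -
  interpret fl: form_space scale "\<lambda>N x y. b N y x" by (rule flip_form_space)
  have sV: "subspace V" and sE: "subspace E" and sD: "subspace D" using V E D fdsub_subspace by auto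
  consider "r = 0" | "r = 1" | "r = dim E" | "2 \<le> r" "r < dim E" using ed(2) by linarith
  then show ?thesis
  proof cases
    case 1
    have "compressed (aff A V) r E D"
      by (rule compressedI[OF sE subset_refl sD subset_refl]) (use 1 rk rk_0_iff[OF E] in auto)
    then show ?thesis ..
  next
    case 2
    have "compressed (aff A V) 1 E D" by (rule compressed_rank_one[OF V E D]) (use 2 rk ed in auto)
    then show ?thesis using 2 by simp
  next
    case 3
    have "compressed (aff A V) r E D"
      by (rule compressedI[OF subspace_single_0 _ sD subset_refl]) (use 3 subspace_0[OF sE] fdsub_zero vanish_zero_left in auto)
    then show ?thesis ..
  next
    case 4
    show ?thesis
    proof (rule ccontr)
      assume no: "\<not> ?thesis"
      have dropD: "rd V E H = rd V E D \<or> rd V E H + r \<le> rd V E D" if H: "subspace H" "H \<subseteq> D" "dim H + 1 = dim D" for H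
      proof (rule ccontr)
        assume a: "\<not> ?thesis"
        have "rd V E H \<le> rd V E D" by (rule rd_mono[OF V subset_refl H(2)])
        then show False
          using intermediate_drop[where A = A, OF IH k V E D ed(1) 4(2,1) rk large H] a no by linarith
      qed
      have "\<exists>H. subspace H \<and> H \<subseteq> D \<and> dim H + 1 = dim D \<and> \<not> rd V E H + r \<le> rd V E D"
      proof (rule ccontr)
        assume "\<not> ?thesis"
        then have "compressed (aff A V) r E D" by (intro compressed_of_large_drops[OF V E D _ rk]) (use 4 ed in auto)
        then show False using no by blast
      qed
      then obtain H0 where H0: "subspace H0" "H0 \<subseteq> D" "dim H0 + 1 = dim D" "rd V E H0 = rd V E D" using dropD by blast
      have "\<not> (dim E < dim D \<or> r + 1 < dim E)"
        using zero_drop_reduction[where A = A, OF IH k V E D ed(1) 4(2,1) rk large H0] no by blast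
      then have n: "dim E = r + 1" "dim D = r + 1" using ed 4 by linarith+
      \<comment> \<open>In the square case the dimension hypothesis is symmetric, so what was proved
        for hyperplanes of \<open>D\<close> also applies to hyperplanes of \<open>E\<close>.\<close>
      have IH': "fl.classified k" by (rule classified_flip_imp[OF IH])
      have k': "dim D + dim E \<le> k" using k by simp
      have rk': "fl.rk M D E \<le> r" if "M \<in> aff A V" for M using rk[OF that] by (simp add: rk_flip[OF E D])
      have large': "dim E * r + dim D \<le> fl.rd V D E + dim E + r" using large n by (simp add: rd_flip)
      have no': "\<not> (fl.compressed (aff A V) r D E \<or> fl.exceptional A V r D E)"
        using no unfolding compressed_flip exceptional_flip .
      have n': "dim D \<le> dim E" "r < dim D" using n by auto
      have dropE: "rd V K D = rd V E D \<or> rd V K D + r \<le> rd V E D" if K: "subspace K" "K \<subseteq> E" "dim K + 1 = dim E" for K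
      proof (rule ccontr)
        assume a: "\<not> ?thesis"
        have "rd V K D \<le> rd V E D" by (rule rd_mono[OF V K(2) subset_refl])
        then have "fl.rd V D E < fl.rd V D K + r" "fl.rd V D K < fl.rd V D E" unfolding rd_flip using a by linarith+
        then show False 
          using fl.intermediate_drop[where A = A, OF IH' k' V D E n' 4(1) rk' large' K] no' by blast
      qed
      have "\<exists>K. subspace K \<and> K \<subseteq> E \<and> dim K + 1 = dim E \<and> \<not> rd V K D + r \<le> rd V E D"
      proof (rule ccontr)
        assume "\<not> ?thesis"
        then have "fl.compressed (aff A V) r D E" by (intro fl.compressed_of_large_drops[OF V D E _ rk']) (use n in \<open>auto simp: rd_flip\<close>)
        then show False using no' by blast
      qed
      then obtain K0 where K0: "subspace K0" "K0 \<subseteq> E" "dim K0 + 1 = dim E" "rd V K0 D = rd V E D" using dropE by blast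
      have "compressed (aff A V) r E D"
      proof (cases "\<exists>N\<in>V. rk N E D = 1")
        case True
        then obtain N where N: "N \<in> V" "rk N E D = 1" by blast
        show ?thesis by (rule rank_one_member_case[OF V E D n 4(1) rk dropD dropE H0 K0 N])
      next
        case False
        have sq: "r * r \<le> rd V E D" using large n by simp
        show ?thesis by (rule rank_one_free_case[OF IH k V E D n 4(1) rk sq]) (use False in auto)
      qed
      then show False using no by blast
    qed
  qed
qed

theorem classification: "classified k"
proof (induction k)
  case 0
  then show ?case by (simp add: classified_def)
next
  case (Suc k)
  show ?case unfolding classified_def
  proof (intro allI impI)
    fix A V r E D
    assume V: "fdsub V" and E: "fdsub E" and D: "fdsub D" and k: "dim E + dim D < Suc k"
      and r: "r \<le> min (dim E) (dim D)" and rk: "\<forall>M\<in>aff A V. rk M E D \<le> r"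
      and large: "max (dim E) (dim D) * r + min (dim E) (dim D) \<le> rd V E D + max (dim E) (dim D) + r"
    show "compressed (aff A V) r E D \<or> exceptional A V r E D"
    proof (cases "dim E \<le> dim D")
      case True
      have "dim D * r + dim E \<le> rd V E D + dim D + r" using large True by (simp add: max_def min_def)
      then show ?thesis using classification_step[OF Suc.IH _ V E D True, of r A] k r rk by simp
    next
      case False
      interpret fl: form_space scale "\<lambda>N x y. b N y x" by (rule flip_form_space)
      have "dim E * r + dim D \<le> fl.rd V D E + dim E + r" using large False by (simp add: max_def min_def rd_flip)
      then have "fl.compressed (aff A V) r D E \<or> fl.exceptional A V r D E"
        using fl.classification_step[OF classified_flip_imp[OF Suc.IH] _ V D E, of r A] k r rk False
        by (simp add: rk_flip[OF E D])
      then show ?thesis unfolding compressed_flip exceptional_flip .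
    qed
  qed
qed

end

section \<open>Matrices as bilinear forms\<close>

definition fscale :: "'a :: field \<Rightarrow> (nat \<times> nat \<Rightarrow> 'a) \<Rightarrow> nat \<times> nat \<Rightarrow> 'a" where
  "fscale c f = (\<lambda>i. c * f i)"

interpretation fs: field_space "fscale :: 'a :: field \<Rightarrow> _"
  by unfold_locales (auto simp: fscale_def fun_eq_iff algebra_simps)

text \<open>An \<open>n \<times> p\<close> matrix acts as the bilinear form \<open>(x, y) \<mapsto> y\<^sup>T M x\<close>. Matrices and vectors share the
  type \<^typ>\<open>nat \<times> nat \<Rightarrow> 'a\<close>; a vector uses only the indices \<open>(j, 0)\<close>.\<close>

definition mat_form :: "nat \<Rightarrow> nat \<Rightarrow> (nat \<times> nat \<Rightarrow> 'a :: field) \<Rightarrow> (nat \<times> nat \<Rightarrow> 'a) \<Rightarrow> (nat \<times> nat \<Rightarrow> 'a) \<Rightarrow> 'a" where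
  "mat_form n p N x y = (\<Sum>j<p. \<Sum>i<n. N (i, j) * x (j, 0) * y (i, 0))"

lemma form_space_mat_form:
  assumes "\<exists>c :: 'a :: field. c \<noteq> 0 \<and> c \<noteq> 1"
  shows "form_space fscale (mat_form n p :: (nat \<times> nat \<Rightarrow> 'a) \<Rightarrow> _)"
  by unfold_locales
    (use assms in \<open>auto simp: mat_form_def fscale_def algebra_simps sum.distrib sum_distrib_left\<close>)

definition supp :: "(nat \<times> nat) set \<Rightarrow> (nat \<times> nat \<Rightarrow> 'a :: field) set" where
  "supp I = {f. \<forall>i. i \<notin> I \<longrightarrow> f i = 0}"

definition unitf :: "nat \<times> nat \<Rightarrow> nat \<times> nat \<Rightarrow> 'a :: field" where
  "unitf i = (\<lambda>j. if j = i then 1 else 0)"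

lemma subspace_supp: "fs.subspace (supp I :: (nat \<times> nat \<Rightarrow> 'a :: field) set)"
  by (auto simp: fs.subspace_def supp_def fscale_def)

lemma span_unitf:
  assumes "finite I"
  shows "fs.span (unitf ` I) = (supp I :: (nat \<times> nat \<Rightarrow> 'a :: field) set)"
    and "fs.independent (unitf ` I :: (nat \<times> nat \<Rightarrow> 'a) set)"
    and "card (unitf ` I :: (nat \<times> nat \<Rightarrow> 'a) set) = card I"
proof -
  have sub: "fs.span (unitf ` J) \<subseteq> (supp J :: (nat \<times> nat \<Rightarrow> 'a) set)" for J
    by (rule fs.span_minimal[OF _ subspace_supp]) (auto simp: supp_def unitf_def)
  have sum: "(\<Sum>i\<in>J. fscale (f i) (unitf i)) j = (if j \<in> J then f j else 0)" if "finite J" for J j and f :: "nat \<times> nat \<Rightarrow> 'a"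
    using that by (induction J) (auto simp: fscale_def unitf_def)
  show "fs.span (unitf ` I) = (supp I :: (nat \<times> nat \<Rightarrow> 'a) set)"
  proof
    show "supp I \<subseteq> fs.span (unitf ` I :: (nat \<times> nat \<Rightarrow> 'a) set)"
    proof
      fix f :: "nat \<times> nat \<Rightarrow> 'a" assume "f \<in> supp I"
      then have "f = (\<Sum>i\<in>I. fscale (f i) (unitf i))" by (auto simp: fun_eq_iff sum[OF assms] supp_def)
      moreover have "(\<Sum>i\<in>I. fscale (f i) (unitf i)) \<in> fs.span (unitf ` I)"
        by (intro fs.span_sum fs.span_scale fs.span_base) auto
      ultimately show "f \<in> fs.span (unitf ` I)" by simp
    qed
  qed (rule sub)
  show "fs.independent (unitf ` I :: (nat \<times> nat \<Rightarrow> 'a) set)"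
    using assms
  proof (induction I)
    case (insert i I)
    have "(unitf i :: nat \<times> nat \<Rightarrow> 'a) \<notin> supp I" 
    proof
      assume "(unitf i :: nat \<times> nat \<Rightarrow> 'a) \<in> supp I"
      then have "unitf i i = (0 :: 'a)" using insert.hyps(2) unfolding supp_def by blast
      then show False by (simp add: unitf_def)
    qed
    then have "(unitf i :: nat \<times> nat \<Rightarrow> 'a) \<notin> fs.span (unitf ` I)" using sub by blast
    then show ?case using insert.IH fs.independent_insertI by simp
  qed (simp add: fs.independent_empty)
  have "inj (unitf :: nat \<times> nat \<Rightarrow> nat \<times> nat \<Rightarrow> 'a)"
    by (rule injI) (metis unitf_def zero_neq_one)
  then show "card (unitf ` I :: (nat \<times> nat \<Rightarrow> 'a) set) = card I" by (metis card_image inj_on_subset subset_UNIV)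
qed

lemma fdsub_supp:
  assumes "finite I"
  shows "fs.fdsub (supp I :: (nat \<times> nat \<Rightarrow> 'a :: field) set)" "fs.dim (supp I :: (nat \<times> nat \<Rightarrow> 'a) set) = card I"
proof -
  note sp = span_unitf[OF assms, where 'a = 'a]
  show "fs.fdsub (supp I :: (nat \<times> nat \<Rightarrow> 'a :: field) set)"
    using fs.fdsub_span[of "unitf ` I :: (nat \<times> nat \<Rightarrow> 'a) set"] assms unfolding sp(1) by blast
  show "fs.dim (supp I :: (nat \<times> nat \<Rightarrow> 'a) set) = card I"
    using fs.dim_span_eq_card_independent[OF sp(2)] unfolding sp(1,3) .
qed

definition colsp :: "nat \<Rightarrow> (nat \<times> nat \<Rightarrow> 'a :: field) set" where
  "colsp m = supp ({..<m} \<times> {0})"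

lemma fdsub_colsp: "fs.fdsub (colsp m :: (nat \<times> nat \<Rightarrow> 'a :: field) set)" "fs.dim (colsp m :: (nat \<times> nat \<Rightarrow> 'a) set) = m"
  using fdsub_supp[of "{..<m} \<times> {0 :: nat}", where 'a = 'a] by (auto simp: colsp_def card_cartesian_product)

lemma unitf_colsp: "j < m \<Longrightarrow> unitf (j, 0) \<in> colsp m"
  by (auto simp: colsp_def supp_def unitf_def)

definition emb :: "nat \<Rightarrow> nat \<Rightarrow> 'a :: field mat \<Rightarrow> nat \<times> nat \<Rightarrow> 'a" where
  "emb n p M = (\<lambda>(i, j). if i < n \<and> j < p then M $$ (i, j) else 0)"

lemma emb_supp: "emb n p M \<in> supp ({..<n} \<times> {..<p})"
  by (auto simp: emb_def supp_def)

lemma emb_mat: "f \<in> supp ({..<n} \<times> {..<p}) \<Longrightarrow> emb n p (mat n p f) = f"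
  by (auto simp: emb_def supp_def fun_eq_iff)

lemma mat_emb: "M \<in> carrier_mat n p \<Longrightarrow> mat n p (emb n p M) = M"
  by (intro eq_matI) (auto simp: emb_def)

lemma emb_linear:
  assumes "M \<in> carrier_mat n p" "N \<in> carrier_mat n p"
  shows "emb n p (M + N) = emb n p M + emb n p N" "emb n p (c \<cdot>\<^sub>m M) = fscale c (emb n p M)"
    "emb n p (M - N) = emb n p M - emb n p N"
  using assms by (auto simp: emb_def fscale_def fun_eq_iff)

lemma mat_form_unitf:
  assumes "i < n" "j < p"
  shows "mat_form n p N (unitf (j, 0)) (unitf (i, 0)) = N (i, j)"
proof -
  have "mat_form n p N (unitf (j, 0)) (unitf (i, 0)) = (\<Sum>j'<p. \<Sum>i'<n. if j' = j then (if i' = i then N (i', j') else 0) else 0)"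
    unfolding mat_form_def by (intro sum.cong refl) (auto simp: unitf_def)
  also have "\<dots> = (\<Sum>j'<p. if j' = j then N (i, j') else 0)"
    using assms(1) by (intro sum.cong refl) auto
  also have "\<dots> = N (i, j)" using assms(2) by simp
  finally show ?thesis .
qed

text \<open>The bases of the two spaces are recorded as the columns of \<^term>\<open>colmat xs\<close> and the rows of
  \<^term>\<open>rowmat ys\<close>, so the form of \<open>M\<close> has the matrix \<^term>\<open>rowmat ys * M * colmat xs\<close>.\<close>

definition colmat :: "(nat \<times> nat \<Rightarrow> 'a :: field) list \<Rightarrow> 'a mat" where
  "colmat xs = mat (length xs) (length xs) (\<lambda>(j, k). (xs ! k) (j, 0))"

definition rowmat :: "(nat \<times> nat \<Rightarrow> 'a :: field) list \<Rightarrow> 'a mat" where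
  "rowmat ys = mat (length ys) (length ys) (\<lambda>(i, j). (ys ! i) (j, 0))"

lemma rowmat_transpose: "rowmat ys = transpose_mat (colmat ys)"
  by (intro eq_matI) (auto simp: rowmat_def colmat_def)

lemma mat_form_change_basis:
  assumes M: "M \<in> carrier_mat n p" and "length xs = p" "length ys = n" and ik: "i < n" "k < p"
  shows "(rowmat ys * M * colmat xs) $$ (i, k) = mat_form n p (emb n p M) (xs ! k) (ys ! i)"
proof -
  have c: "rowmat ys \<in> carrier_mat n n" "colmat xs \<in> carrier_mat p p" using assms by (auto simp: rowmat_def colmat_def)
  have d: "dim_row M = n" "dim_col M = p" using M by auto
  have "(rowmat ys * M * colmat xs) $$ (i, k) = (\<Sum>j<p. (rowmat ys * M) $$ (i, j) * colmat xs $$ (j, k))"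
    using c M ik by (simp add: scalar_prod_def lessThan_atLeast0 del: assoc_mult_mat)
  also have "\<dots> = (\<Sum>j<p. (\<Sum>l<n. rowmat ys $$ (i, l) * M $$ (l, j)) * colmat xs $$ (j, k))"
    using c d ik by (intro sum.cong refl) (simp add: scalar_prod_def lessThan_atLeast0)
  also have "\<dots> = (\<Sum>j<p. \<Sum>l<n. (ys ! i) (l, 0) * M $$ (l, j) * (xs ! k) (j, 0))"
    using assms by (intro sum.cong refl) (simp add: rowmat_def colmat_def sum_distrib_right)
  also have "\<dots> = mat_form n p (emb n p M) (xs ! k) (ys ! i)"
    unfolding mat_form_def by (intro sum.cong refl) (simp add: emb_def mult_ac)
  finally show ?thesis .
qed

text \<open>A spanning list of length \<open>m\<close> has no repetitions, so coefficients indexed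
  by vectors can be read by position. Expanding the unit vectors gives a right inverse, which for a
  square matrix is also a left inverse.\<close>

lemma colmat_inverse:
  fixes xs :: "(nat \<times> nat \<Rightarrow> 'a :: field) list"
  assumes len: "length xs = m" and sp: "colsp m \<subseteq> fs.span (set xs)"
  obtains T where "T \<in> carrier_mat m m" "colmat xs * T = 1\<^sub>m m" "T * colmat xs = 1\<^sub>m m"
proof -
  have "m \<le> card (set xs)" using fs.dim_le_card[OF sp] by (simp add: fdsub_colsp)
  then have dist: "distinct xs" using len card_length[of xs] card_distinct[of xs] by simp
  have "\<exists>c. unitf (j, 0) = (\<Sum>v\<in>set xs. fscale (c v) v)" if "j < m" for j
    using sp unitf_colsp[OF that] fs.span_finite[of "set xs"] by auto
  then obtain c where c: "\<And>j. j < m \<Longrightarrow> unitf (j, 0) = (\<Sum>v\<in>set xs. fscale (c j v) v)" by metis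
  define T where "T = mat m m (\<lambda>(k, j). c j (xs ! k))"
  have R: "colmat xs \<in> carrier_mat m m" and T: "T \<in> carrier_mat m m" using len by (auto simp: colmat_def T_def)
  have sumapp: "(\<Sum>v\<in>A. h v) z = (\<Sum>v\<in>A. h v z)" for A :: "(nat \<times> nat \<Rightarrow> 'a) set" and h :: "_ \<Rightarrow> nat \<times> nat \<Rightarrow> 'a" and z
    by (induction A rule: infinite_finite_induct) auto
  have "colmat xs * T = 1\<^sub>m m"
  proof (rule eq_matI)
    fix i j assume "i < dim_row (1\<^sub>m m :: 'a mat)" "j < dim_col (1\<^sub>m m :: 'a mat)"
    then have ij: "i < m" "j < m" by auto
    have "(colmat xs * T) $$ (i, j) = (\<Sum>k<m. (xs ! k) (i, 0) * c j (xs ! k))"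
      using R T ij len by (simp add: scalar_prod_def lessThan_atLeast0 colmat_def T_def)
    also have "\<dots> = (\<Sum>v\<in>set xs. v (i, 0) * c j v)"
      using sum.reindex_bij_betw[OF bij_betw_nth[OF dist _ refl], of "{..<m}" "\<lambda>v. v (i, 0) * c j v"] len by simp
    also have "\<dots> = unitf (j, 0) (i, 0)" unfolding c[OF ij(2)] sumapp by (simp add: fscale_def mult.commute)
    also have "\<dots> = (1\<^sub>m m :: 'a mat) $$ (i, j)" using ij by (simp add: unitf_def)
    finally show "(colmat xs * T) $$ (i, j) = (1\<^sub>m m :: 'a mat) $$ (i, j)" .
  qed (use R T in auto)
  then show ?thesis using that[OF T] mat_mult_left_right_inverse[OF R T] by blast
qed

lemma rowmat_inverse:
  fixes ys :: "(nat \<times> nat \<Rightarrow> 'a :: field) list"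
  assumes len: "length ys = m" and sp: "colsp m \<subseteq> fs.span (set ys)"
  obtains T where "T \<in> carrier_mat m m" "rowmat ys * T = 1\<^sub>m m" "T * rowmat ys = 1\<^sub>m m"
proof -
  obtain T where T: "T \<in> carrier_mat m m" "colmat ys * T = 1\<^sub>m m" "T * colmat ys = 1\<^sub>m m"
    by (rule colmat_inverse[OF len sp])
  have R: "colmat ys \<in> carrier_mat m m" using len by (auto simp: colmat_def)
  show ?thesis
  proof (rule that)
    show "transpose_mat T \<in> carrier_mat m m" using T by simp
    show "rowmat ys * transpose_mat T = 1\<^sub>m m"
      unfolding rowmat_transpose transpose_mult[OF T(1) R, symmetric] T(3) by simp
    show "transpose_mat T * rowmat ys = 1\<^sub>m m"
      unfolding rowmat_transpose transpose_mult[OF R T(1), symmetric] T(2) by simp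
  qed
qed

lemma invertible_matI:
  assumes "A \<in> carrier_mat m m" "B \<in> carrier_mat m m" "A * B = 1\<^sub>m m" "B * A = 1\<^sub>m m"
  shows "invertible_mat A"
  using assms unfolding invertible_mat_def inverts_mat_def square_mat.simps by auto

text \<open>The basis of \<open>F\<close> is put last because the zero block of
  \<open>compression_space\<close> is the lower right one.\<close>

lemma adapted_basis:
  fixes F :: "(nat \<times> nat \<Rightarrow> 'a :: field) set"
  assumes F: "fs.subspace F" "F \<subseteq> colsp m"
  obtains xs where "length xs = m" "colsp m \<subseteq> fs.span (set xs)" "\<And>k. m - fs.dim F \<le> k \<Longrightarrow> k < m \<Longrightarrow> xs ! k \<in> F"
proof -
  note fF = fs.fdsub_subset[OF fdsub_colsp(1) F]
  obtain C where C: "C \<subseteq> F" "finite C" "fs.independent C" "fs.span C = F" "card C = fs.dim F" by (rule fs.fdsub_basis[OF fF])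
  obtain B where B: "C \<subseteq> B" "B \<subseteq> colsp m" "finite B" "fs.independent B" "fs.span B = colsp m" "card B = fs.dim (colsp m :: (nat \<times> nat \<Rightarrow> 'a) set)"
    by (rule fs.fdsub_extend_basis[OF fdsub_colsp(1) subset_trans[OF C(1) F(2)] C(3)])
  obtain as where as: "set as = B - C" "distinct as" using finite_distinct_list[of "B - C"] B(3) by blast
  obtain cs where cs: "set cs = C" "distinct cs" using finite_distinct_list[of C] C(2) by blast
  have lc: "length cs = fs.dim F" using distinct_card[OF cs(2)] cs(1) C(5) by simp
  have "length as + length cs = m"
    using distinct_card[OF cs(2)] cs(1) distinct_card[OF as(2)] as(1) card_Diff_subset[OF C(2) B(1)] card_mono[OF B(3,1)] B(6)
    by (simp add: fdsub_colsp)
  then have la: "length as = m - fs.dim F" "length (as @ cs) = m" using lc by auto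
  show ?thesis
  proof (rule that[OF la(2)])
    have "set (as @ cs) = B" using as(1) cs(1) B(1) by auto
    then show "colsp m \<subseteq> fs.span (set (as @ cs))" using B(5) by simp
    fix k assume "m - fs.dim F \<le> k" "k < m"
    then have "(as @ cs) ! k \<in> set cs" using la by (auto simp: nth_append)
    then show "(as @ cs) ! k \<in> F" using cs(1) C(1) by blast
  qed
qed

section \<open>Compression spaces, subspaces and dimensions in the matrix module\<close>

lemma mem_compression_space:
  assumes X: "X \<in> carrier_mat n p" and st: "s \<le> n" "t \<le> p"
    and z: "\<And>i k. s \<le> i \<Longrightarrow> i < n \<Longrightarrow> t \<le> k \<Longrightarrow> k < p \<Longrightarrow> X $$ (i, k) = 0"
  shows "X \<in> compression_space n p s t"
proof -
  let ?A = "mat s t (\<lambda>(i, j). X $$ (i, j))" and ?B = "mat (n - s) t (\<lambda>(i, j). X $$ (i + s, j))"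
    and ?C = "mat s (p - t) (\<lambda>(i, j). X $$ (i, j + t))"
  have "X = four_block_mat ?A ?C ?B (0\<^sub>m (n - s) (p - t))"
    using X st z by (intro eq_matI) auto
  then show ?thesis unfolding compression_space_def by (intro CollectI exI[of _ ?A] exI[of _ ?C] exI[of _ ?B]) auto
qed

lemma compression_space_closed:
  assumes st: "s \<le> n" "t \<le> p" and X: "X \<in> compression_space n p s t" and Y: "Y \<in> compression_space n p s t"
  shows "X \<in> carrier_mat n p" "X + Y \<in> compression_space n p s t" "c \<cdot>\<^sub>m X \<in> compression_space n p s t"
proof -
  have c: "Z \<in> carrier_mat n p \<and> (\<forall>i k. s \<le> i \<longrightarrow> i < n \<longrightarrow> t \<le> k \<longrightarrow> k < p \<longrightarrow> Z $$ (i, k) = 0)"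
    if "Z \<in> compression_space n p s t" for Z :: "'a mat"
    using that st unfolding compression_space_def by auto
  show "X \<in> carrier_mat n p" using c[OF X] by blast
  show "X + Y \<in> compression_space n p s t" by (rule mem_compression_space[OF _ st]) (use c[OF X] c[OF Y] in auto)
  show "c \<cdot>\<^sub>m X \<in> compression_space n p s t" by (rule mem_compression_space[OF _ st]) (use c[OF X] in auto)
qed

lemma subspace_module_matI:
  assumes "W \<subseteq> carrier_mat n p" "0\<^sub>m n p \<in> W" "\<And>X Y. X \<in> W \<Longrightarrow> Y \<in> W \<Longrightarrow> X + Y \<in> W" "\<And>c X. X \<in> W \<Longrightarrow> c \<cdot>\<^sub>m X \<in> W"
  shows "VectorSpace.subspace class_ring (W :: 'a :: field mat set) (module_mat TYPE('a) n p)"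
proof -
  interpret vs: vectorspace class_ring "module_mat TYPE('a) n p" by (rule matrix_vs)
  have "submodule class_ring W (module_mat TYPE('a) n p)"
    unfolding submodule_def using assms vs.module_axioms by (auto simp: module_mat_simps)
  then show ?thesis unfolding VectorSpace.subspace_def using vs.vectorspace_axioms by blast
qed

lemma subspace_module_matD:
  assumes V: "VectorSpace.subspace class_ring V (module_mat TYPE('a :: field) n p)"
  shows "V \<subseteq> carrier_mat n p" "0\<^sub>m n p \<in> V" "X \<in> V \<Longrightarrow> Y \<in> V \<Longrightarrow> X + Y \<in> V" "X \<in> V \<Longrightarrow> c \<cdot>\<^sub>m X \<in> V"
proof -
  have sm: "submodule class_ring V (module_mat TYPE('a) n p)"
    using V unfolding VectorSpace.subspace_def by blast
  show "V \<subseteq> carrier_mat n p" using submodule.subset[OF sm] unfolding module_mat_simps .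
  show "0\<^sub>m n p \<in> V" using submodule.zero_closed[OF sm] unfolding module_mat_simps .
  show "X \<in> V \<Longrightarrow> Y \<in> V \<Longrightarrow> X + Y \<in> V" using submodule.m_closed[OF sm] unfolding module_mat_simps .
  show "X \<in> V \<Longrightarrow> c \<cdot>\<^sub>m X \<in> V" using submodule.smult_closed[OF sm, of c X] unfolding module_mat_simps by simp
qed

lemma subspace_emb:
  assumes V: "VectorSpace.subspace class_ring V (module_mat TYPE('a :: field) n p)"
  shows "fs.fdsub (emb n p ` V)"
proof (rule fs.fdsub_subset[of "supp ({..<n} \<times> {..<p})"])
  note VD = subspace_module_matD[OF V]
  show "fs.subspace (emb n p ` V)"
    unfolding fs.subspace_def
  proof (intro conjI ballI allI)
    have "emb n p (0\<^sub>m n p) = (0 :: nat \<times> nat \<Rightarrow> 'a)" by (auto simp: emb_def fun_eq_iff)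
    then show "0 \<in> emb n p ` V" using VD(2) by (metis imageI)
    show "x + y \<in> emb n p ` V" if xy: "x \<in> emb n p ` V" "y \<in> emb n p ` V" for x y
    proof -
      obtain X Y where "X \<in> V" "Y \<in> V" "x = emb n p X" "y = emb n p Y" using xy by blast
      then show ?thesis using emb_linear(1)[of X n p Y] VD(1,3) by (metis imageI subsetD)
    qed
    show "fscale c x \<in> emb n p ` V" if x: "x \<in> emb n p ` V" for c x
    proof -
      obtain X where "X \<in> V" "x = emb n p X" using x by blast
      then show ?thesis using emb_linear(2)[of X n p X c] VD(1,4) by (metis imageI subsetD)
    qed
  qed
  show "emb n p ` V \<subseteq> supp ({..<n} \<times> {..<p})" using emb_supp by blast
qed (simp add: fdsub_supp)

text \<open>The theorem bounds the module dimension from below, so this is the direction wanted. The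
  module dimension is the least size of a generating set, and a basis of the image under
  \<open>emb\<close> pulls back to such a set.\<close>

lemma dim_emb_ge:
  assumes V: "VectorSpace.subspace class_ring V (module_mat TYPE('a :: field) n p)"
  shows "vectorspace.dim class_ring ((module_mat TYPE('a) n p)\<lparr>carrier := V\<rparr>) \<le> fs.dim (emb n p ` V)"
proof -
  note VD = subspace_module_matD[OF V]
  let ?M = "(module_mat TYPE('a) n p)\<lparr>carrier := V\<rparr>"
  have vs: "vectorspace class_ring ?M" by (rule vectorspace.subspace_is_vs[OF matrix_vs V])
  interpret W: vectorspace class_ring ?M by (rule vs)
  obtain B where B: "B \<subseteq> emb n p ` V" "finite B" "fs.independent B" "fs.span B = emb n p ` V" "card B = fs.dim (emb n p ` V)"
    by (rule fs.fdsub_basis[OF subspace_emb[OF V]])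
  let ?A = "mat n p ` B"
  have AV: "?A \<subseteq> V"
  proof
    fix X assume "X \<in> ?A"
    then obtain Y where "Y \<in> V" "X = mat n p (emb n p Y)" using B(1) by blast
    then show "X \<in> V" using mat_emb[of Y n p] VD(1) by auto
  qed
  have sm: "submodule class_ring (W.span ?A) ?M" using AV by (intro W.span_is_submodule) simp
  have Vc: "W.span ?A \<subseteq> V" using submodule.subset[OF sm] by simp
  have inA: "?A \<subseteq> W.span ?A" using AV by (intro W.in_own_span) simp
  have sp: "fs.subspace (emb n p ` W.span ?A)"
  proof (rule subspace_emb[unfolded fs.fdsub_def, THEN conjunct1], rule subspace_module_matI)
    show "W.span ?A \<subseteq> carrier_mat n p" using Vc VD(1) by blast
    show "0\<^sub>m n p \<in> W.span ?A" using submodule.zero_closed[OF sm] by (simp add: module_mat_simps)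
    show "X + Y \<in> W.span ?A" if "X \<in> W.span ?A" "Y \<in> W.span ?A" for X Y
      using submodule.m_closed[OF sm that] by (simp add: module_mat_simps)
    show "c \<cdot>\<^sub>m X \<in> W.span ?A" if "X \<in> W.span ?A" for c X
      using submodule.smult_closed[OF sm _ that, of c] by (simp add: module_mat_simps)
  qed
  have "B \<subseteq> emb n p ` W.span ?A"
  proof
    fix x assume x: "x \<in> B"
    then have "emb n p (mat n p x) = x" using B(1) emb_supp by (intro emb_mat) blast
    moreover have "mat n p x \<in> W.span ?A" using x inA by blast
    ultimately show "x \<in> emb n p ` W.span ?A" by (metis imageI)
  qed
  then have "fs.span B \<subseteq> emb n p ` W.span ?A" using sp by (rule fs.span_minimal)
  then have VA: "V \<subseteq> W.span ?A"
  proof (intro subsetI)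
    fix X assume s: "fs.span B \<subseteq> emb n p ` W.span ?A" and X: "X \<in> V"
    then obtain Y where Y: "Y \<in> W.span ?A" "emb n p X = emb n p Y" using B(4) by blast
    then have "X = Y" using mat_emb[of X n p] mat_emb[of Y n p] X Vc VD(1) by (metis subsetD)
    then show "X \<in> W.span ?A" using Y by simp
  qed
  have "W.dim \<le> card ?A"
    unfolding W.dim_def by (rule Least_le) (use B(2) AV VA Vc in auto)
  also have "\<dots> \<le> card B" by (rule card_image_le[OF B(2)])
  finally show ?thesis using B(5) by simp
qed

text \<open>A basis \<open>C\<close> of the radical is completed to one of the whole space by unit
  vectors, whose indices form \<open>J\<close>. A relation between the columns with index in
  \<open>J\<close> is a vector of the radical supported on \<open>J\<close>, hence zero; so these
  columns are independent, and \<open>card J\<close> is the rank of the form.\<close>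

lemma rk_le_rank:
  fixes M :: "'a :: field mat"
  assumes three: "\<exists>c :: 'a. c \<noteq> 0 \<and> c \<noteq> 1" and M: "M \<in> carrier_mat n p"
  shows "form_space.rk fscale (mat_form n p) (emb n p M) (colsp p) (colsp n) \<le> vec_space.rank n M"
proof -
  interpret F: form_space fscale "mat_form n p :: (nat \<times> nat \<Rightarrow> 'a) \<Rightarrow> _" by (rule form_space_mat_form[OF three])
  interpret W: vec_space "TYPE('a)" n .
  let ?E = "colsp p :: (nat \<times> nat \<Rightarrow> 'a) set" and ?u = "\<lambda>j. unitf (j, 0) :: nat \<times> nat \<Rightarrow> 'a"
  define R where "R = F.rad (emb n p M) ?E (colsp n)"
  have memR: "x \<in> R" if x: "x \<in> ?E" and z: "\<And>i. i < n \<Longrightarrow> (\<Sum>j<p. M $$ (i, j) * x (j, 0)) = 0" for x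
  proof -
    have "mat_form n p (emb n p M) x y = 0" for y
    proof -
      have "mat_form n p (emb n p M) x y = (\<Sum>i<n. \<Sum>j<p. M $$ (i, j) * x (j, 0) * y (i, 0))"
        unfolding mat_form_def by (subst sum.swap) (simp add: emb_def)
      also have "\<dots> = (\<Sum>i<n. (\<Sum>j<p. M $$ (i, j) * x (j, 0)) * y (i, 0))" by (simp add: sum_distrib_right)
      also have "\<dots> = 0" using z by simp
      finally show ?thesis .
    qed
    then show ?thesis using x by (simp add: R_def F.rad_def)
  qed
  have E: "fs.fdsub ?E" "fs.dim ?E = p" by (rule fdsub_colsp)+
  have sR: "fs.subspace R" "R \<subseteq> ?E" using F.subspace_rad[OF fs.fdsub_subspace[OF E(1)]] F.rad_subset by (auto simp: R_def)
  have fR: "fs.fdsub R" by (rule fs.fdsub_subset[OF E(1) sR])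
  obtain C where C: "C \<subseteq> R" "finite C" "fs.independent C" "fs.span C = R" "card C = fs.dim R" by (rule fs.fdsub_basis[OF fR])
  have units: "unitf ` ({..<p} \<times> {0}) = ?u ` {..<p}" by auto
  have spu: "fs.span (?u ` {..<p}) = ?E" using span_unitf(1)[of "{..<p} \<times> {0 :: nat}", where 'a = 'a] by (simp add: colsp_def units)
  obtain B where B: "C \<subseteq> B" "B \<subseteq> C \<union> ?u ` {..<p}" "fs.independent B" "C \<union> ?u ` {..<p} \<subseteq> fs.span B"
    using fs.maximal_independent_subset_extend[of C "C \<union> ?u ` {..<p}"] C(3) by blast
  have finB: "finite B" by (rule finite_subset[OF B(2)]) (use C(2) in simp)
  have BE: "B \<subseteq> ?E"
  proof -
    have "?u ` {..<p} \<subseteq> ?E" using unitf_colsp by blast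
    then show ?thesis using B(2) C(1) sR(2) by blast
  qed
  have EB: "?E \<subseteq> fs.span B"
  proof -
    have "fs.span (?u ` {..<p}) \<subseteq> fs.span B" using B(4) by (intro fs.span_minimal) auto
    then show ?thesis using spu by simp
  qed
  have cB: "card B = p" using fs.basis_card_eq_dim[OF BE EB B(3)] E(2) by simp
  have spB: "fs.span B = ?E" using EB fs.span_minimal[OF BE fs.fdsub_subspace[OF E(1)]] by blast
  define J where "J = {j. j < p \<and> ?u j \<in> B - C}"
  have uJ: "?u ` J = B - C" using B(2) by (auto simp: J_def)
  have fJ: "finite J" by (simp add: J_def)
  have inju: "inj ?u" by (rule injI) (metis unitf_def zero_neq_one prod.inject)
  have cJ: "card J + fs.dim R = p"
  proof -
    have "card J = card (B - C)" unfolding uJ[symmetric] by (simp add: card_image inj_on_subset[OF inju])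
    then show ?thesis using card_Diff_subset[OF C(2) B(1)] card_mono[OF finB B(1)] cB C(5) by simp
  qed
  have triv: "x = 0" if x: "x \<in> supp (J \<times> {0})" "x \<in> R" for x
  proof -
    have "unitf ` (J \<times> {0}) = ?u ` J" by auto
    then have "x \<in> fs.span (B - C)" using span_unitf(1)[of "J \<times> {0 :: nat}", where 'a = 'a] fJ x(1) uJ by simp
    moreover have "R \<inter> fs.span (B - C) = {0}"
    proof -
      have ind: "fs.independent (B - C)" using B(3) fs.independent_mono by blast
      have f2: "fs.fdsub (fs.span (B - C))" using finB by (intro fs.fdsub_span) simp
      have "C \<union> (B - C) = B" using B(1) by blast
      then have "fs.ssum R (fs.span (B - C)) = ?E"
        using fs.span_Un[of C "B - C"] spB C(4) unfolding fs.ssum_def by simp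
      then have "fs.dim (R \<inter> fs.span (B - C)) = 0"
        using fs.dim_ssum[OF fR f2] fs.dim_span_eq_card_independent[OF ind] E(2) C(5)
          card_Diff_subset[OF C(2) B(1)] card_mono[OF finB B(1)] cB by simp
      then show ?thesis using fs.fdsub_dim_0[OF fs.fdsub_Int[OF fR fs.subspace_span]] by blast
    qed
    ultimately show "x = 0" using x(2) by blast
  qed
  have JE: "supp (J \<times> {0}) \<subseteq> ?E" by (auto simp: J_def supp_def colsp_def)
  have dM: "dim_row M = n" "dim_col M = p" using M by auto
  \<comment> \<open>Independence concerns the set of columns, so repeated columns have to be
    excluded separately.\<close>
  have injc: "inj_on (col M) J"
  proof (rule inj_onI)
    fix j k assume jk: "j \<in> J" "k \<in> J" "col M j = col M k"
    define x where "x = ?u j - ?u k"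
    have jp: "j < p" "k < p" using jk by (auto simp: J_def)
    have xs: "x \<in> supp (J \<times> {0})" using jk(1,2) by (auto simp: x_def supp_def unitf_def)
    have "x \<in> R"
    proof (rule memR)
      show "x \<in> ?E" using xs JE by blast
      fix i assume i: "i < n"
      have "(\<Sum>l<p. M $$ (i, l) * x (l, 0)) = (\<Sum>l<p. (if l = j then M $$ (i, l) else 0) - (if l = k then M $$ (i, l) else 0))"
        by (intro sum.cong refl) (auto simp: x_def unitf_def)
      also have "\<dots> = M $$ (i, j) - M $$ (i, k)" using jp by (simp add: sum_subtractf)
      also have "\<dots> = col M j $ i - col M k $ i" using i jp dM by simp
      finally show "(\<Sum>l<p. M $$ (i, l) * x (l, 0)) = 0" using jk(3) by simp
    qed
    then have "x = 0" by (rule triv[OF xs])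
    then have "?u j = ?u k" by (simp add: x_def)
    then show "j = k" using inju by (simp add: inj_def)
  qed
  have "W.lin_indpt (col M ` J)"
  proof
    assume "W.lin_dep (col M ` J)"
    then obtain A a v where A: "finite A" "A \<subseteq> col M ` J" "W.lincomb a A = 0\<^sub>v n" "v \<in> A" "a v \<noteq> 0"
      unfolding W.lin_dep_def by (auto simp: module_vec_simps)
    define J' where "J' = {j \<in> J. col M j \<in> A}"
    have J': "col M ` J' = A" "inj_on (col M) J'" "J' \<subseteq> {..<p}" "J' \<subseteq> J"
      using A(2) inj_on_subset[OF injc, of J'] by (auto simp: J'_def J_def)
    define x where "x = (\<lambda>(j, z :: nat). if z = 0 \<and> j \<in> J' then a (col M j) else (0 :: 'a))"
    have xs: "x \<in> supp (J \<times> {0})" using J'(4) by (auto simp: x_def supp_def)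
    have "x \<in> R"
    proof (rule memR)
      show "x \<in> ?E" using xs JE by blast
      fix i assume i: "i < n"
      have "(\<Sum>j<p. M $$ (i, j) * x (j, 0)) = (\<Sum>j\<in>J'. M $$ (i, j) * x (j, 0))"
        using J'(3) by (intro sum.mono_neutral_right) (auto simp: x_def)
      also have "\<dots> = (\<Sum>j\<in>J'. a (col M j) * col M j $ i)"
        using J'(3) i dM by (intro sum.cong refl) (auto simp: x_def)
      also have "\<dots> = (\<Sum>w\<in>A. a w * w $ i)" using sum.reindex[OF J'(2), of "\<lambda>w. a w * w $ i"] J'(1) by simp
      also have "\<dots> = W.lincomb a A $ i" by (rule W.lincomb_index[OF i, symmetric]) (use A(2) dM in auto)
      finally show "(\<Sum>j<p. M $$ (i, j) * x (j, 0)) = 0" using A(3) i by simp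
    qed
    then have x0: "x = 0" by (rule triv[OF xs])
    obtain j where j: "j \<in> J'" "v = col M j" using A(4) J'(1) by blast
    have "x (j, 0) = a v" using j by (simp add: x_def)
    then show False using x0 A(5) by simp
  qed
  moreover have "col M ` J \<subseteq> set (cols M)" using dM by (auto simp: J_def cols_def)
  ultimately have "card (col M ` J) \<le> W.rank M" using W.rank_ge_card_indpt[OF M] by blast
  moreover have "card (col M ` J) = card J" by (rule card_image[OF injc])
  ultimately show ?thesis using cJ E(2) by (simp add: F.rk_def R_def)
qed

section \<open>Return to matrices\<close>

lemma change_basis_inverse:
  fixes M :: "'a :: field mat"
  assumes M: "M \<in> carrier_mat n p" and L: "L \<in> carrier_mat n n" and R: "R \<in> carrier_mat p p"
    and P: "P \<in> carrier_mat n n" and Q: "Q \<in> carrier_mat p p"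
    and PL: "P * L = 1\<^sub>m n" and RQ: "R * Q = 1\<^sub>m p"
  shows "P * (L * M * R) * Q = M"
proof -
  have "P * (L * M * R) * Q = (P * (L * M)) * (R * Q)"
    using assms(1-5) by (simp add: assoc_mult_mat[of _ n n _ p _ p])
  also have "P * (L * M) = (P * L) * M" using assms(1-5) by (simp add: assoc_mult_mat[of _ n n _ n _ p])
  finally show ?thesis using PL RQ M by simp
qed

text \<open>In bases adapted to \<open>F\<close> and \<open>Y\<close>, with
  \<open>s = n - fs.dim Y\<close> and \<open>t = p - fs.dim F\<close>, vanishing on \<open>F\<close>
  times \<open>Y\<close> means that the lower right block is zero.\<close>

lemma decomposable_of_vanish:
  fixes S :: "'a :: field mat set"
  assumes S: "S \<subseteq> carrier_mat n p"
    and F: "fs.subspace F" "F \<subseteq> colsp p" and Y: "fs.subspace Y" "Y \<subseteq> colsp n"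
    and d: "fs.dim F + fs.dim Y + r = p + n"
    and v: "\<And>M x y. M \<in> S \<Longrightarrow> x \<in> F \<Longrightarrow> y \<in> Y \<Longrightarrow> mat_form n p (emb n p M) x y = 0"
  shows "decomposable_mat_set n p r S"
proof -
  define s t where "s = n - fs.dim Y" and "t = p - fs.dim F"
  have le: "fs.dim F \<le> p" "fs.dim Y \<le> n"
    using fs.fdsub_dim_mono[OF fdsub_colsp(1) F] fs.fdsub_dim_mono[OF fdsub_colsp(1) Y] by (simp_all add: fdsub_colsp)
  have st: "s \<le> n" "t \<le> p" "s + t = r" using d le by (auto simp: s_def t_def)
  obtain xs where xs: "length xs = p" "colsp p \<subseteq> fs.span (set xs)" "\<And>k. p - fs.dim F \<le> k \<Longrightarrow> k < p \<Longrightarrow> xs ! k \<in> F"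
    by (rule adapted_basis[OF F]) blast
  obtain ys where ys: "length ys = n" "colsp n \<subseteq> fs.span (set ys)" "\<And>k. n - fs.dim Y \<le> k \<Longrightarrow> k < n \<Longrightarrow> ys ! k \<in> Y"
    by (rule adapted_basis[OF Y]) blast
  obtain Q where Q: "Q \<in> carrier_mat p p" "colmat xs * Q = 1\<^sub>m p" "Q * colmat xs = 1\<^sub>m p" by (rule colmat_inverse[OF xs(1,2)])
  obtain P where P: "P \<in> carrier_mat n n" "rowmat ys * P = 1\<^sub>m n" "P * rowmat ys = 1\<^sub>m n" by (rule rowmat_inverse[OF ys(1,2)])
  have R: "colmat xs \<in> carrier_mat p p" and L: "rowmat ys \<in> carrier_mat n n" using xs(1) ys(1) by (auto simp: colmat_def rowmat_def)
  let ?K = "compression_space n p s t :: 'a mat set"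
  let ?W = "{P * M * Q | M. M \<in> ?K}"
  have Kc: "?K \<subseteq> carrier_mat n p" using compression_space_closed(1)[OF st(1,2)] by blast
  have inv: "invertible_mat P" "invertible_mat Q" using invertible_matI[OF P(1) L P(3,2)] invertible_matI[OF Q(1) R Q(3,2)] by auto
  have WI: "P * M * Q \<in> ?W" if "M \<in> ?K" for M using that by blast
  have sub: "VectorSpace.subspace class_ring ?W (module_mat TYPE('a) n p)"
  proof (rule subspace_module_matI)
    show Wc: "?W \<subseteq> carrier_mat n p" using P(1) Q(1) Kc by auto
    have z: "0\<^sub>m n p \<in> ?K" by (rule mem_compression_space[OF _ st(1,2)]) auto
    have "P * 0\<^sub>m n p * Q = 0\<^sub>m n p" using P(1) Q(1) by simp
    then show "0\<^sub>m n p \<in> ?W" using WI[OF z] by (simp only:)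
    show "X + X' \<in> ?W" if XX: "X \<in> ?W" "X' \<in> ?W" for X X'
    proof -
      obtain M M' where m: "M \<in> ?K" "M' \<in> ?K" "X = P * M * Q" "X' = P * M' * Q" using XX by blast
      have c: "M \<in> carrier_mat n p" "M' \<in> carrier_mat n p" using m Kc by auto
      have "P * (M + M') * Q = X + X'"
        using P(1) Q(1) c m(3,4) by (simp add: mult_add_distrib_mat[of P n n] add_mult_distrib_mat[of _ n p])
      then show ?thesis using WI[OF compression_space_closed(2)[OF st(1,2) m(1,2)]] by (simp only:)
    qed
    show "c \<cdot>\<^sub>m X \<in> ?W" if X: "X \<in> ?W" for c X
    proof -
      obtain M where m: "M \<in> ?K" "X = P * M * Q" using X by blast
      have cM: "M \<in> carrier_mat n p" using m Kc by auto
      have "P * (c \<cdot>\<^sub>m M) * Q = c \<cdot>\<^sub>m X"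
        using P(1) Q(1) cM m(2) by (simp add: mult_smult_distrib[of P n n] mult_smult_assoc_mat[of _ n p])
      then show ?thesis using WI[OF compression_space_closed(3)[OF st(1,2) m(1) m(1)], of c] by (simp only:)
    qed
  qed
  have SW: "S \<subseteq> ?W"
  proof
    fix M assume M: "M \<in> S"
    have Mc: "M \<in> carrier_mat n p" using M S by blast
    let ?X = "rowmat ys * M * colmat xs"
    have "?X \<in> ?K"
    proof (rule mem_compression_space[OF _ st(1,2)])
      show "?X \<in> carrier_mat n p" using L Mc R by auto
      fix i k assume "s \<le> i" "i < n" "t \<le> k" "k < p"
      then show "?X $$ (i, k) = 0"
        using mat_form_change_basis[OF Mc xs(1) ys(1)] v[OF M xs(3) ys(3)] by (simp add: s_def t_def)
    qed
    then have "P * ?X * Q \<in> ?W" by (rule WI)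
    then show "M \<in> ?W" unfolding change_basis_inverse[OF Mc L R P(1) Q(1) P(3) Q(2)] .
  qed
  have "?W \<subseteq> carrier_mat n p" using P(1) Q(1) Kc by auto
  then have "equivalent_mat_sets n p ?W ?K"
    unfolding equivalent_mat_sets_def using Kc P(1) Q(1) inv by blast
  then show ?thesis unfolding decomposable_mat_set_def
    using st sub SW by (rule_tac exI[of _ s], rule_tac exI[of _ t], rule_tac exI[of _ ?W]) blast
qed

text \<open>The equations confine the direction space to \<open>V2\<close>, which has only four free
  entries. Having dimension at least \<open>4\<close>, the direction space is all of
  \<open>V2\<close>, and this gives equivalence with \<open>U3\<close> rather than mere
  inclusion.\<close>

lemma equivalent_U3_of_exceptional:
  fixes A :: "'a :: field mat"
  assumes three: "\<exists>c :: 'a. c \<noteq> 0 \<and> c \<noteq> 1" and A: "A \<in> carrier_mat n p"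
    and V: "VectorSpace.subspace class_ring V (module_mat TYPE('a) n p)"
    and ex: "form_space.exceptional fscale (mat_form n p) (emb n p A) (emb n p ` V) r (colsp p) (colsp n)"
  shows "equivalent_mat_sets n p {A + X | X. X \<in> V} U3"
proof -
  interpret F: form_space fscale "mat_form n p :: (nat \<times> nat \<Rightarrow> 'a) \<Rightarrow> _" by (rule form_space_mat_form[OF three])
  note VD = subspace_module_matD[OF V]
  let ?V = "emb n p ` V"
  have fV: "fs.fdsub ?V" by (rule subspace_emb[OF V])
  obtain x0 x1 x2 y0 y1 y2 where pn: "p = 3" "n = 3" and rd: "F.rd ?V (colsp p) (colsp n) = 4"
    and spx: "fs.span {x0, x1, x2} = colsp p" and spy: "fs.span {y0, y1, y2} = colsp n"
    and m: "\<forall>M\<in>F.aff (emb n p A) ?V. mat_form n p M x0 y1 = 0 \<and> mat_form n p M x0 y2 = 0 \<and> mat_form n p M x1 y2 = 0 \<and>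
          mat_form n p M x1 y1 = mat_form n p M x0 y0 + 1 \<and> mat_form n p M x2 y2 = mat_form n p M x0 y0 - 1"
    using ex unfolding F.exceptional_def fdsub_colsp by blast
  define xs ys where "xs = [x0, x1, x2]" and "ys = [y0, y1, y2]"
  have len: "length xs = p" "length ys = n" by (simp_all add: xs_def ys_def pn)
  have sp: "colsp p \<subseteq> fs.span (set xs)" "colsp n \<subseteq> fs.span (set ys)" using spx spy by (simp_all add: xs_def ys_def)
  obtain Q where Q: "Q \<in> carrier_mat p p" "colmat xs * Q = 1\<^sub>m p" "Q * colmat xs = 1\<^sub>m p" by (rule colmat_inverse[OF len(1) sp(1)])
  obtain P where P: "P \<in> carrier_mat n n" "rowmat ys * P = 1\<^sub>m n" "P * rowmat ys = 1\<^sub>m n" by (rule rowmat_inverse[OF len(2) sp(2)])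
  have R: "colmat xs \<in> carrier_mat p p" and L: "rowmat ys \<in> carrier_mat n n" using len by (auto simp: colmat_def rowmat_def)
  let ?\<phi> = "\<lambda>M. rowmat ys * M * colmat xs"
  let ?b = "\<lambda>M. mat_form n p (emb n p M)"
  have U3c: "U3 \<subseteq> (carrier_mat n p :: 'a mat set)" by (auto simp: U3_def pn mat_of_rows_list_def)
  have lt3: "i < 3 \<longleftrightarrow> i = 0 \<or> i = 1 \<or> i = 2" for i :: nat by auto
  have affm: "emb n p (A + X) \<in> F.aff (emb n p A) ?V" if "X \<in> V" for X
    using that emb_linear(1)[OF A, of X] VD(1) by (auto simp: F.aff_def)
  have forward: "?\<phi> M \<in> U3" if M: "M \<in> carrier_mat n p" and h: "?b M x0 y1 = 0" "?b M x0 y2 = 0" "?b M x1 y2 = 0"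
      "?b M x1 y1 = ?b M x0 y0 + 1" "?b M x2 y2 = ?b M x0 y0 - 1" for M
  proof -
    have "?\<phi> M = mat_of_rows_list 3 [[?b M x0 y0, ?b M x1 y0, ?b M x2 y0], [0, ?b M x0 y0 + 1, ?b M x2 y1], [0, 0, ?b M x0 y0 - 1]]" (is "_ = ?N")
    proof (rule eq_matI)
      fix i k assume "i < dim_row ?N" "k < dim_col ?N"
      then have ik: "i < 3" "k < 3" by (auto simp: mat_of_rows_list_def)
      have "?\<phi> M $$ (i, k) = ?b M (xs ! k) (ys ! i)" by (rule mat_form_change_basis[OF M len]) (use ik pn in auto)
      then show "?\<phi> M $$ (i, k) = ?N $$ (i, k)"
        using ik h unfolding lt3 by (auto simp: mat_of_rows_list_def xs_def ys_def numeral_2_eq_2)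
    qed (use L R pn in \<open>auto simp: mat_of_rows_list_def\<close>)
    then show ?thesis unfolding U3_def by blast
  qed
  have Sc: "{A + X | X. X \<in> V} \<subseteq> carrier_mat n p" using A VD(1) by auto
  define V2 where "V2 = {N \<in> supp ({..<n} \<times> {..<p}). mat_form n p N x0 y1 = 0 \<and> mat_form n p N x0 y2 = 0 \<and> mat_form n p N x1 y2 = 0 \<and>
          mat_form n p N x1 y1 = mat_form n p N x0 y0 \<and> mat_form n p N x2 y2 = mat_form n p N x0 y0}"
  have fV2: "fs.fdsub V2"
  proof (rule fs.fdsub_subset[OF fdsub_supp(1)[of "{..<n} \<times> {..<p}"]])
    show "fs.subspace V2"
      unfolding V2_def fs.subspace_def using subspace_supp[unfolded fs.subspace_def, of "{..<n} \<times> {..<p}"] by (auto simp: F.form_simps)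
  qed (auto simp: V2_def)
  have VV2: "?V \<subseteq> V2"
  proof
    fix N assume "N \<in> ?V"
    then obtain X where X: "X \<in> V" "N = emb n p X" by blast
    have z: "0\<^sub>m n p \<in> V" "A + 0\<^sub>m n p = A" using VD(2) A by auto
    have e: "emb n p (A + X) = emb n p A + N" using emb_linear(1)[OF A, of X] VD(1) X by auto
    note m1 = m[rule_format, OF affm[OF X(1)], unfolded e] and m0 = m[rule_format, OF affm[OF z(1)], unfolded z(2)]
    then show "N \<in> V2" using X(2) emb_supp[of n p X] by (auto simp: V2_def F.form_simps)
  qed
  have nondeg: "N = 0" if N: "N \<in> supp ({..<n} \<times> {..<p})" and v: "F.vanish N {x0, x1, x2} {y0, y1, y2}" for N
  proof -
    have v': "F.vanish N (colsp p) (colsp n)" using F.vanish_span[OF v] spx spy by simp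
    have "N (i, j) = 0" if "i < n" "j < p" for i j
      using F.vanishD[OF v' unitf_colsp[OF that(2)] unitf_colsp[OF that(1)]] mat_form_unitf[OF that, of N] by simp
    then show "N = 0" using N by (auto simp: supp_def fun_eq_iff)
  qed
  have "fs.dim V2 \<le> 4"
  proof -
    \<comment> \<open>The positions of the four parameters \<open>x\<close>, \<open>a\<close>,
      \<open>b\<close>, \<open>c\<close> of \<open>U3\<close>.\<close>
    let ?I = "{(x0, y0), (x1, y0), (x2, y0), (x2, y1)}"
    have "{N \<in> V2. \<forall>i\<in>?I. mat_form n p N (fst i) (snd i) = 0} = {0}"
    proof -
      have "N = 0" if "N \<in> V2" "\<forall>i\<in>?I. mat_form n p N (fst i) (snd i) = 0" for N
        by (rule nondeg) (use that in \<open>auto simp: V2_def F.vanish_def\<close>)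
      moreover have "0 \<in> V2" using fs.subspace_0[OF fs.fdsub_subspace[OF fV2]] .
      ultimately show ?thesis by (auto simp: F.zero_form)
    qed
    moreover have "card ?I \<le> 4" by (simp add: card_insert_if)
    moreover have "fs.dim V2 \<le> fs.dim {N \<in> V2. \<forall>i\<in>?I. mat_form n p N (fst i) (snd i) = 0} + card ?I
      \<and> fs.subspace {N \<in> V2. \<forall>i\<in>?I. mat_form n p N (fst i) (snd i) = 0}"
      by (rule fs.dim_kernel_functionals[OF fV2]) (auto intro: F.lin_form)
    ultimately show ?thesis using fs.fdsub_zero(2) by (metis (no_types, lifting) add_0 le_trans)
  qed
  moreover have "4 \<le> fs.dim ?V" using rd F.rd_ann[OF fV, of "colsp p" "colsp n"] by simp
  ultimately have VeqV2: "?V = V2" using fs.fdsub_dim_eq[OF fV2 fs.fdsub_subspace[OF fV] VV2] by simp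
  have A0: "A + 0\<^sub>m n p = A" using A by simp
  note mA = m[rule_format, OF affm[OF VD(2)], unfolded A0]
  have "{A + X | X. X \<in> V} = {P * U * Q | U. U \<in> U3}"
  proof
    show "{A + X | X. X \<in> V} \<subseteq> {P * U * Q | U. U \<in> U3}"
    proof
      fix M assume "M \<in> {A + X | X. X \<in> V}"
      then obtain X where X: "X \<in> V" "M = A + X" by blast
      have Mc: "M \<in> carrier_mat n p" using X A VD(1) by auto
      have "?\<phi> M \<in> U3" using m[rule_format, OF affm[OF X(1)]] forward[OF Mc] X(2) by blast
      then have "P * ?\<phi> M * Q \<in> {P * U * Q | U. U \<in> U3}" by blast
      then show "M \<in> {P * U * Q | U. U \<in> U3}" unfolding change_basis_inverse[OF Mc L R P(1) Q(1) P(3) Q(2)] .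
    qed
    show "{P * U * Q | U. U \<in> U3} \<subseteq> {A + X | X. X \<in> V}"
    proof
      fix M assume "M \<in> {P * U * Q | U. U \<in> U3}"
      then obtain U where U: "U \<in> U3" "M = P * U * Q" by blast
      have Uc: "U \<in> carrier_mat n p" using U U3c by blast
      have Mc: "M \<in> carrier_mat n p" using U(2) Uc P(1) Q(1) by auto
      have \<phi>: "?\<phi> M = U" unfolding U(2) by (rule change_basis_inverse[OF Uc P(1) Q(1) L R P(2) Q(3)])
      have ent: "?b M (xs ! k) (ys ! i) = U $$ (i, k)" if "i < 3" "k < 3" for i k
        using mat_form_change_basis[OF Mc len, of i k] \<phi> that pn by simp
      obtain x a b c where Ue: "U = mat_of_rows_list 3 [[x, a, b], [0, x + 1, c], [0, 0, x - 1]]" using U(1) unfolding U3_def by blast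
      have bM: "?b M x0 y1 = 0" "?b M x0 y2 = 0" "?b M x1 y2 = 0" "?b M x1 y1 = ?b M x0 y0 + 1" "?b M x2 y2 = ?b M x0 y0 - 1"
        using ent[of 0 0] ent[of 1 0] ent[of 2 0] ent[of 2 1] ent[of 1 1] ent[of 2 2]
        by (simp_all add: Ue mat_of_rows_list_def xs_def ys_def numeral_2_eq_2)
      have "emb n p (M - A) \<in> V2"
        unfolding V2_def emb_linear(3)[OF Mc A] using bM mA emb_supp[of n p "M - A"] unfolding emb_linear(3)[OF Mc A]
        by (simp add: F.form_simps)
      then obtain X where X: "X \<in> V" "emb n p (M - A) = emb n p X" unfolding VeqV2[symmetric] by blast
      have Xc: "X \<in> carrier_mat n p" using X(1) VD(1) by blast
      have "M - A = X" using mat_emb[of "M - A" n p] mat_emb[OF Xc] X(2) Mc A by (metis minus_carrier_mat)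
      then have "M = A + X" using Mc A by (intro eq_matI) auto
      then show "M \<in> {A + X | X. X \<in> V}" using X(1) by blast
    qed
  qed
  then show ?thesis unfolding equivalent_mat_sets_def
    using Sc U3c P(1) Q(1) invertible_matI[OF P(1) L P(3,2)] invertible_matI[OF Q(1) R Q(3,2)] by blast
qed

theorem theorem1p6:
  fixes S :: "'a :: field mat set" and n p r :: nat
  assumes "n \<ge> p" and "p \<ge> r"
    and "affine_subspace_mat n p S"
    and "\<forall>M \<in> S. vec_space.rank n M \<le> r"
    and "int (affine_dim_mat n p S) \<ge> int n * int r - (int n - int p + int r)"
    and "infinite (UNIV :: 'a set) \<or> card (UNIV :: 'a set) > 2"
  shows "decomposable_mat_set n p r S \<or>
         (card (UNIV :: 'a set) = 3 \<and> equivalent_mat_sets n p S U3)"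
proof -
  have three: "\<exists>c :: 'a. c \<noteq> 0 \<and> c \<noteq> 1"
  proof (rule ccontr)
    assume "\<not> ?thesis"
    then have U: "(UNIV :: 'a set) \<subseteq> {0, 1}" by auto
    then have "finite (UNIV :: 'a set)" by (rule finite_subset) simp
    moreover have "card (UNIV :: 'a set) \<le> card {0, 1 :: 'a}" using U by (intro card_mono) auto
    ultimately show False using assms(6) by (simp add: card_insert_if)
  qed
  interpret F: form_space fscale "mat_form n p :: (nat \<times> nat \<Rightarrow> 'a) \<Rightarrow> _" by (rule form_space_mat_form[OF three])
  obtain A V where A: "A \<in> carrier_mat n p" and V: "VectorSpace.subspace class_ring V (module_mat TYPE('a) n p)"
    and S: "S = {A + X | X. X \<in> V}" using assms(3) unfolding affine_subspace_mat_def by blast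
  note VD = subspace_module_matD[OF V]
  let ?V = "emb n p ` V" and ?E = "colsp p :: (nat \<times> nat \<Rightarrow> 'a) set" and ?D = "colsp n :: (nat \<times> nat \<Rightarrow> 'a) set"
  have fV: "fs.fdsub ?V" by (rule subspace_emb[OF V])
  have Sc: "S \<subseteq> carrier_mat n p" using A VD(1) by (auto simp: S)
  have aff: "F.aff (emb n p A) ?V = emb n p ` S"
  proof -
    have "emb n p A + emb n p X = emb n p (A + X)" if "X \<in> V" for X using emb_linear(1)[OF A, of X] VD(1) that by auto
    then show ?thesis unfolding F.aff_def S by (force simp: image_iff)
  qed
  have rk: "\<forall>N\<in>F.aff (emb n p A) ?V. F.rk N ?E ?D \<le> r"
  proof
    fix N assume "N \<in> F.aff (emb n p A) ?V"
    then obtain M where M: "M \<in> S" "N = emb n p M" unfolding aff by blast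
    then have "F.rk N ?E ?D \<le> vec_space.rank n M" using rk_le_rank[OF three, of M n p] Sc by blast
    also have "\<dots> \<le> r" using assms(4) M(1) by blast
    finally show "F.rk N ?E ?D \<le> r" .
  qed
  \<comment> \<open>Pairing with the unit vectors recovers every entry, so on the full coordinate
    spaces restriction loses no dimension.\<close>
  have "F.ann ?V ?E ?D \<subseteq> {0}"
  proof
    fix N assume N: "N \<in> F.ann ?V ?E ?D"
    have v: "F.vanish N ?E ?D" using N by (simp add: F.ann_def)
    have "N (i, j) = 0" if "i < n" "j < p" for i j
      using F.vanishD[OF v unitf_colsp[OF that(2)] unitf_colsp[OF that(1)]] mat_form_unitf[OF that, of N] by simp
    moreover have "N \<in> supp ({..<n} \<times> {..<p})" using N emb_supp by (auto simp: F.ann_def)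
    ultimately show "N \<in> {0}" by (auto simp: supp_def fun_eq_iff)
  qed
  then have "fs.dim (F.ann ?V ?E ?D) \<le> 0"
    using fs.fdsub_dim_mono[OF fs.fdsub_zero(1) F.subspace_ann[OF fs.fdsub_subspace[OF fV]]] fs.fdsub_zero(2) by metis
  then have rd: "F.rd ?V ?E ?D = fs.dim ?V" by (simp add: F.rd_def)
  have "affine_dim_mat n p S \<le> fs.dim ?V"
    unfolding affine_dim_mat_def S translation_space_translate[OF A V] by (rule dim_emb_ge[OF V])
  then have "int n * int r + int p \<le> int (fs.dim ?V) + int n + int r" using assms(5) by linarith
  then have "int (n * r + p) \<le> int (fs.dim ?V + n + r)" by simp
  then have "n * r + p \<le> fs.dim ?V + n + r" by (rule zle_int[THEN iffD1])
  then have large: "max (fs.dim ?E) (fs.dim ?D) * r + min (fs.dim ?E) (fs.dim ?D) \<le> F.rd ?V ?E ?D + max (fs.dim ?E) (fs.dim ?D) + r"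
    unfolding rd fdsub_colsp(2) using assms(1) by (simp add: max_def min_def)
  have "F.compressed (F.aff (emb n p A) ?V) r ?E ?D \<or> F.exceptional (emb n p A) ?V r ?E ?D"
    using F.classification[of "p + n + 1"] fV fdsub_colsp[where 'a = 'a] rk large assms(1,2)
    unfolding F.classified_def by simp
  then show ?thesis
  proof
    assume "F.compressed (F.aff (emb n p A) ?V) r ?E ?D"
    then obtain X Y where XY: "fs.subspace X" "X \<subseteq> ?E" "fs.subspace Y" "Y \<subseteq> ?D" "fs.dim X + fs.dim Y + r = p + n"
      "\<forall>N\<in>emb n p ` S. F.vanish N X Y" unfolding F.compressed_def aff fdsub_colsp(2) by blast
    have "decomposable_mat_set n p r S"
      by (rule decomposable_of_vanish[OF Sc XY(1-5)]) (use XY(6) in \<open>auto simp: F.vanish_def\<close>)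
    then show ?thesis ..
  next
    assume ex: "F.exceptional (emb n p A) ?V r ?E ?D"
    then have "card (UNIV :: 'a set) = 3" unfolding F.exceptional_def by blast
    then show ?thesis using equivalent_U3_of_exceptional[OF three A V ex] unfolding S by blast
  qed
qed

end
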